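(* Theta-products give examples of Jacobi forms of singular weight with trivial character for some lattices of all even ranks $\ge6$; that is, for every even integer $n\ge6$ there exist a positive definite even lattice $L$ of rank $n$ and a non-zero Jacobi form in $J_{\frac n2,L}$ which is a theta-product.
   Context: **Jacobi forms of index one.** Let $L$ be a positive definite even lattice with form $(\cdot,\cdot)$ (extended bilinearly to $L\otimes\mathbb C$) and dual $L^\vee$. For $k\in\mathbb Z$, $J_{k,L}$ (index one, trivial character) is the space of holomorphic $\varphi:\mathbb H\times(L\otimes\mathbb C)\to\mathbb C$ such that $\varphi(\frac{a\tau+b}{c\tau+d},\frac{\mathfrak Z}{c\tau+d})=(c\tau+d)^ke^{\pi i\frac{c(\mathfrak Z,\mathfrak Z)}{c\tau+d}}\varphi(\tau,\mathfrak Z)$ for all $\begin{pmatrix}a&b\\c&d\end{pmatrix}\in\mathrm{SL}_2(\mathbb Z)$, $\varphi(\tau,\mathfrak Z+x\tau+y)=e^{-\pi i((x,x)\tau+2(x,\mathfrak Z))}\varphi(\tau,\mathfrak Z)$ for $x,y\in L$, and $\varphi=\sum f(n,l)e^{2\pi i(n\tau+(l,\mathfrak Z))}$ with the sum over integers $n\ge0$ and $l\in L^\vee$ with $2n-(l,l)\ge0$. The singular weight for $L$ is $\frac{\mathrm{rank}L}2$. **Theta-products.** $\vartheta(\tau,z)=\sum_{n\in\mathbb Z}\left(\frac{-4}n\right)e^{2\pi i(\frac{n^2}8\tau+\frac n2z)}$, where $\left(\frac{-4}n\right)$ is $1,-1,0$ for $n\equiv1\bmod4$, $n\equiv3\bmod4$,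 $n$ even; $\eta$ is the Dedekind eta function; $\vartheta_{3/2}(\tau,z)=\eta(\tau)\vartheta(\tau,2z)/\vartheta(\tau,z)$. A theta-product on $\mathbb H\times(L\otimes\mathbb C)$ is a finite product of functions $\vartheta(\tau,\ell(\mathfrak Z))$ and $\vartheta_{3/2}(\tau,\ell(\mathfrak Z))$, with $\ell$ linear forms on $L\otimes\mathbb C$, times an integral (possibly negative) power of $\eta(\tau)$. *)

theory Defs
  imports "HOL-Complex_Analysis.Complex_Analysis"
begin

section \<open>Lattices\<close>

text \<open>
  A lattice of rank \<open>CARD('n)\<close> is given as the \<open>\<int>\<close>-span \<open>L\<close> of a basis of \<open>real ^ 'n\<close> together
  with a bilinear form \<open>B\<close> on \<open>real ^ 'n\<close>, which plays the role of \<open>L \<otimes> \<real>\<close>. The form is arbitrary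
  and need not be the standard inner product. Accordingly, \<open>complex ^ 'n\<close> plays the role of
  \<open>L \<otimes> \<complex>\<close>.
\<close>

definition pos_def_even_lattice ::
    "(real ^ 'n) set \<Rightarrow> (real ^ 'n \<Rightarrow> real ^ 'n \<Rightarrow> real) \<Rightarrow> bool" where
  "pos_def_even_lattice L B \<longleftrightarrow>
     (\<exists>b :: 'n \<Rightarrow> real ^ 'n. inj b \<and> independent (range b) \<and>
        L = {\<Sum>i\<in>UNIV. of_int (c i) *\<^sub>R b i | c :: 'n \<Rightarrow> int. True}) \<and>
     bilinear B \<and> (\<forall>x y. B x y = B y x) \<and> (\<forall>x. x \<noteq> 0 \<longrightarrow> B x x > 0) \<and>
     (\<forall>x\<in>L. \<forall>y\<in>L. B x y \<in> \<int>) \<and> (\<forall>x\<in>L. \<exists>m::int. B x x = 2 * of_int m)"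

definition dual_lattice ::
    "(real ^ 'n) set \<Rightarrow> (real ^ 'n \<Rightarrow> real ^ 'n \<Rightarrow> real) \<Rightarrow> (real ^ 'n) set" where
  "dual_lattice L B = {l. \<forall>x\<in>L. B l x \<in> \<int>}"

definition cvec :: "real ^ 'n \<Rightarrow> complex ^ 'n" where
  "cvec x = (\<chi> i. complex_of_real (x $ i))"

text \<open>The \<open>\<complex>\<close>-bilinear extension of \<open>B\<close>.\<close>

definition cform :: "(real ^ 'n \<Rightarrow> real ^ 'n \<Rightarrow> real) \<Rightarrow> complex ^ 'n \<Rightarrow> complex ^ 'n \<Rightarrow> complex" where
  "cform B Z W =
     (\<Sum>i\<in>UNIV. \<Sum>j\<in>UNIV. Z $ i * W $ j * complex_of_real (B (axis i 1) (axis j 1)))"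

section \<open>Jacobi forms of index one with trivial character\<close>

text \<open>
  Holomorphy in several variables: at every point of the upper half-plane times \<open>complex ^ 'n\<close> there is
  a total derivative, and it is complex linear.
\<close>

definition holomorphic_on_upper :: "(complex \<Rightarrow> complex ^ 'n \<Rightarrow> complex) \<Rightarrow> bool" where
  "holomorphic_on_upper \<phi> \<longleftrightarrow>
     (\<forall>\<tau> Z. Im \<tau> > 0 \<longrightarrow>
        (\<exists>D. ((\<lambda>(t, w). \<phi> t w) has_derivative D) (at (\<tau>, Z)) \<and>
             (\<forall>c t w. D (c * t, c *s w) = c * D (t, w))))"

text \<open>
  Only the values of \<open>\<phi> \<tau> Z\<close> with \<open>Im \<tau> > 0\<close> are meaningful. The Fourier expansion is required
  to converge unconditionally (equivalently, absolutely) at each such point.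
\<close>

definition jacobi_forms ::
    "int \<Rightarrow> (real ^ 'n) set \<Rightarrow> (real ^ 'n \<Rightarrow> real ^ 'n \<Rightarrow> real) \<Rightarrow>
       (complex \<Rightarrow> complex ^ 'n \<Rightarrow> complex) set" where
  "jacobi_forms k L B = {\<phi>.
     holomorphic_on_upper \<phi> \<and>
     (\<forall>(a::int) (b::int) (c::int) (d::int) \<tau> Z. a * d - b * c = 1 \<longrightarrow> Im \<tau> > 0 \<longrightarrow>
        \<phi> ((of_int a * \<tau> + of_int b) / (of_int c * \<tau> + of_int d))
          ((1 / (of_int c * \<tau> + of_int d)) *s Z)
        = (of_int c * \<tau> + of_int d) powi k
          * exp (of_real pi * \<i> * (of_int c * cform B Z Z / (of_int c * \<tau> + of_int d)))
          * \<phi> \<tau> Z) \<and>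
     (\<forall>x\<in>L. \<forall>y\<in>L. \<forall>\<tau> Z. Im \<tau> > 0 \<longrightarrow>
        \<phi> \<tau> (Z + \<tau> *s cvec x + cvec y)
        = exp (- (of_real pi * \<i> * (of_real (B x x) * \<tau> + 2 * cform B (cvec x) Z))) * \<phi> \<tau> Z) \<and>
     (\<exists>f :: int \<Rightarrow> real ^ 'n \<Rightarrow> complex. \<forall>\<tau> Z. Im \<tau> > 0 \<longrightarrow>
        ((\<lambda>(n, l). f n l * exp (2 * of_real pi * \<i> * (of_int n * \<tau> + cform B (cvec l) Z)))
           has_sum \<phi> \<tau> Z)
          {(n, l). n \<ge> 0 \<and> l \<in> dual_lattice L B \<and> 2 * of_int n - B l l \<ge> 0})}"

section \<open>Theta-products\<close>

definition kronecker_m4 :: "int \<Rightarrow> complex" where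
  "kronecker_m4 n = (if n mod 4 = 1 then 1 else if n mod 4 = 3 then -1 else 0)"

definition theta :: "complex \<Rightarrow> complex \<Rightarrow> complex" where
  "theta \<tau> z =
     (\<Sum>\<^sub>\<infinity>n\<in>(UNIV::int set). kronecker_m4 n *
        exp (2 * of_real pi * \<i> * (of_int n ^ 2 / 8 * \<tau> + of_int n / 2 * z)))"

definition eta :: "complex \<Rightarrow> complex" where
  "eta \<tau> = exp (2 * of_real pi * \<i> * \<tau> / 24) *
     (\<Prod>n. 1 - exp (2 * of_real pi * \<i> * of_nat (Suc n) * \<tau>))"

text \<open>
  The quotient below has removable singularities at the zeros of \<open>theta \<tau>\<close>, where plain division
  would give \<open>0\<close>; \<open>remove_sings\<close> replaces this by the limit, yielding an entire function of \<open>z\<close>.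
\<close>

definition theta_3_2 :: "complex \<Rightarrow> complex \<Rightarrow> complex" where
  "theta_3_2 \<tau> z = remove_sings (\<lambda>w. eta \<tau> * theta \<tau> (2 * w) / theta \<tau> w) z"

definition linear_form :: "(complex ^ 'n \<Rightarrow> complex) \<Rightarrow> bool" where
  "linear_form l \<longleftrightarrow> Vector_Spaces.linear (*s) (*) l"

definition theta_product :: "(complex \<Rightarrow> complex ^ 'n \<Rightarrow> complex) \<Rightarrow> bool" where
  "theta_product \<phi> \<longleftrightarrow>
     (\<exists>ls ms (m::int). (\<forall>l\<in>set ls \<union> set ms. linear_form l) \<and>
        (\<forall>\<tau> Z. Im \<tau> > 0 \<longrightarrow>
           \<phi> \<tau> Z = eta \<tau> powi m * (\<Prod>l\<leftarrow>ls. theta \<tau> (l Z)) * (\<Prod>l\<leftarrow>ms. theta_3_2 \<tau> (l Z))))"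

end

theory Submission
  imports Defs
begin

text \<open>
  A theta-product all of whose factors are theta series can be a Jacobi form of singular weight for a simple
  reason: if the linear forms are coordinates of the ambient space and the factors are theta series of one
  variable, the product is a theta series on the lattice, and its Fourier coefficients are supported on
  \<open>2 n = (l, l)\<close>. Now \<open>\<vartheta>\<close> is such a series by definition and \<open>\<vartheta>\<^bsub>3/2\<^esub>\<close> is one by the quintuple product
  identity (\<open>quintuple_product\<close>, \<open>theta_3_2_eq\<close>). Both have weight \<open>1/2\<close>, so the product of \<open>a\<close> factors \<open>\<vartheta>\<close> and
  \<open>n - a\<close> factors \<open>\<vartheta>\<^bsub>3/2\<^esub>\<close> in separate variables has singular weight in rank \<open>n\<close>. Its character is the power
  \<open>3 a + (n - a) = n + 2 a\<close> of the character of \<open>\<eta>\<close>, hence trivial if \<open>24\<close> divides \<open>n + 2 a\<close>. A suitable \<open>a \<le> n\<close>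
  exists for every even \<open>n \<ge> 8\<close> (\<open>diagonal_theta_product\<close>).

  For \<open>n = 6\<close> the building block is \<open>\<vartheta>(z) \<vartheta>(w) \<vartheta>(z + w) / \<eta>\<close>, which is a theta series in two variables by
  the denominator identity of the affine root system of type A2 (\<open>a2_product\<close>). It has rank \<open>2\<close>, weight \<open>1\<close> and the
  eighth power of the character of \<open>\<eta>\<close>, so the product of three copies has trivial character
  (\<open>a2_cubed_theta_product\<close>). Both identities follow by rearranging the product of the series; the
  inner sums vanish by symmetry or are evaluated by Euler's pentagonal number theorem, which comes, like the product formula for \<open>\<vartheta>\<close>,
  from the Jacobi triple product (\<open>jacobi_triple_product\<close>).

  The modular law is needed only for \<open>\<tau> + 1\<close> and \<open>- 1 / \<tau>\<close> (\<open>modular_law_from_S_T\<close>). The inversion formula for \<open>\<vartheta>\<close>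
  is obtained up to a factor \<open>c\<close> from Liouville's theorem (\<open>theta_S_exists\<close>); the factor is determined up to
  sign by the behaviour of \<open>\<vartheta>\<close> at \<open>0\<close> and at the half-periods, both of which express \<open>\<eta>\<^sup>3\<close>
  (\<open>theta_eta_S\<close>). In all cases the lattice is \<open>(2\<int>)\<^sup>n\<close> with the quadratic form that is the index of the product; the factor
  \<open>2\<close> removes the signs from the elliptic law.
\<close>

section \<open>The Jacobi triple product\<close>

text \<open>
  The Gaussian binomial coefficient, as a function of the base \<open>x\<close>, given by its \<open>q\<close>-Pascal rule.
\<close>

fun qbin :: "complex \<Rightarrow> nat \<Rightarrow> nat \<Rightarrow> complex" where
  "qbin x M 0 = 1"
| "qbin x 0 (Suc j) = 0"
| "qbin x (Suc M) (Suc j) = qbin x M (Suc j) + x ^ (M - j) * qbin x M j"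

lemma qbin_eq_0: "j > M \<Longrightarrow> qbin x M j = 0"
  by (induction x M j rule: qbin.induct) auto

text \<open>
  The finite product \<open>(1 - x) (1 - x\<^sup>2) \<dots> (1 - x\<^sup>n)\<close>.
\<close>

definition qpoch :: "complex \<Rightarrow> nat \<Rightarrow> complex" where
  "qpoch x n = (\<Prod>k<n. 1 - x ^ Suc k)"

lemma qpoch_Suc: "qpoch x (Suc n) = qpoch x n * (1 - x ^ Suc n)"
  by (simp add: qpoch_def)

lemma qpoch_0 [simp]: "qpoch x 0 = 1"
  by (simp add: qpoch_def)

lemma qbin_qpoch: "j \<le> M \<Longrightarrow> qbin x M j * qpoch x j * qpoch x (M - j) = qpoch x M"
proof (induction x M j rule: qbin.induct)
  case (3 x M j)
  show ?case
  proof (cases "j = M")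
    case True
    have "qbin x M M * qpoch x M = qpoch x M" using 3(2) True by simp
    then show ?thesis using True by (simp add: qbin_eq_0 qpoch_Suc mult.assoc[symmetric])
  next
    case False
    with 3 have jM: "j < M" by simp
    then obtain d where d: "M = Suc (j + d)" using less_imp_Suc_add by blast
    have a: "qbin x M (Suc j) * qpoch x (Suc j) * qpoch x d = qpoch x M"
      using 3(1) jM d by simp
    have b: "qbin x M j * qpoch x j * qpoch x (Suc d) = qpoch x M"
      using 3(2) jM d by simp
    have "qbin x (Suc M) (Suc j) * qpoch x (Suc j) * qpoch x (Suc M - Suc j)
        = (qbin x M (Suc j) * qpoch x (Suc j) * qpoch x d) * (1 - x ^ Suc d)
          + x ^ Suc d * (1 - x ^ Suc j) * (qbin x M j * qpoch x j * qpoch x (Suc d))"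
      using d by (simp add: qpoch_Suc algebra_simps)
    also have "\<dots> = qpoch x (Suc M)"
      unfolding a b by (simp add: qpoch_Suc d algebra_simps power_add)
    finally show ?thesis .
  qed
qed auto

lemma triangular_Suc: "Suc j * (Suc j - 1) div 2 = j * (j - 1) div 2 + j"
proof -
  have "Suc j * (Suc j - 1) = j * (j - 1) + j * 2" by (cases j) (auto simp: algebra_simps)
  then show ?thesis by simp
qed

lemma q_binomial:
  "(\<Prod>k<M. 1 + y * x ^ k) = (\<Sum>j\<le>M. qbin x M j * x ^ (j * (j - 1) div 2) * y ^ j)"
proof (induction M)
  case (Suc M)
  let ?t = "\<lambda>j. x ^ (j * (j - 1) div 2) * y ^ j"
  have t: "?t (Suc j) = ?t j * x ^ j * y" for j
    unfolding triangular_Suc by (simp add: power_add)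
  have "(\<Sum>j\<le>Suc M. qbin x (Suc M) j * ?t j)
      = 1 + (\<Sum>j\<le>M. qbin x (Suc M) (Suc j) * ?t (Suc j))"
    by (subst sum.atMost_Suc_shift) simp
  also have "(\<Sum>j\<le>M. qbin x (Suc M) (Suc j) * ?t (Suc j))
     = (\<Sum>j\<le>M. qbin x M (Suc j) * ?t (Suc j)) + (\<Sum>j\<le>M. y * x ^ M * (qbin x M j * ?t j))"
  proof (subst sum.distrib[symmetric], rule sum.cong)
    fix j assume "j \<in> {..M}"
    then have e: "x ^ (M - j) * x ^ j = x ^ M" by (simp add: power_add[symmetric])
    have "qbin x (Suc M) (Suc j) * ?t (Suc j)
        = qbin x M (Suc j) * ?t (Suc j) + (x ^ (M - j) * x ^ j) * y * (qbin x M j * ?t j)"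
      by (simp only: qbin.simps t) (simp add: algebra_simps)
    then show "qbin x (Suc M) (Suc j) * ?t (Suc j) = qbin x M (Suc j) * ?t (Suc j) + y * x ^ M * (qbin x M j * ?t j)"
      unfolding e by (simp add: mult_ac)
  qed simp
  also have "1 + \<dots> = (1 + (\<Sum>j\<le>M. qbin x M (Suc j) * ?t (Suc j))) + y * x ^ M * (\<Sum>j\<le>M. qbin x M j * ?t j)"
    by (simp add: sum_distrib_left)
  also have "1 + (\<Sum>j\<le>M. qbin x M (Suc j) * ?t (Suc j)) = (\<Sum>j\<le>Suc M. qbin x M j * ?t j)"
    by (simp only: sum.atMost_Suc_shift[of _ M]) simp
  also have "\<dots> = (\<Sum>j\<le>M. qbin x M j * ?t j)" by (simp add: qbin_eq_0)
  finally show ?case using Suc by (simp add: algebra_simps)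
qed simp

text \<open>
  The \<open>q\<close>-binomial theorem with \<open>2N\<close> factors, recentred at \<open>y = - w x\<^bsup>1-N\<^esup>\<close>: the \<open>N\<close> factors with
  nonpositive exponent of \<open>x\<close> are inverted, which produces the monomial \<open>K\<close> in the proof.
\<close>

lemma finite_jacobi_triple_product:
  assumes x: "x \<noteq> 0" and w: "w \<noteq> 0"
  shows "(\<Prod>r<N. (1 - w * x ^ Suc r) * (1 - x ^ r / w))
       = (\<Sum>j\<le>2*N. qbin x (2*N) j * (- w) powi (int j - int N)
            * x ^ nat ((int j - int N) * (int j - int N + 1) div 2))"
proof -
  define y where "y = - w * x powi (1 - int N)"
  have p0: "x powi a \<noteq> 0" for a using x by simp
  have neg: "(\<Prod>k<N. 1 + y * x ^ k) = (\<Prod>r<N. (- w) * x powi (- int r) * (1 - x ^ r / w))"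
  proof -
    have "(\<Prod>k<N. 1 + y * x ^ k) = (\<Prod>r<N. 1 + y * x ^ (N - Suc r))"
      by (rule prod.nat_diff_reindex[symmetric])
    also have "\<dots> = (\<Prod>r<N. (- w) * x powi (- int r) * (1 - x ^ r / w))"
    proof (rule prod.cong)
      fix r assume "r \<in> {..<N}"
      then have r: "r < N" by simp
      have "x powi (1 - int N) * x ^ (N - Suc r) = x powi (1 - int N + int (N - Suc r))"
        using x by (simp add: power_int_add)
      also have "1 - int N + int (N - Suc r) = - int r" using r by auto
      finally have e: "x powi (1 - int N) * x ^ (N - Suc r) = x powi (- int r)" .
      have "x powi (- int r) * x ^ r = 1" using x by (simp add: power_int_minus)
      then show "1 + y * x ^ (N - Suc r) = (- w) * x powi (- int r) * (1 - x ^ r / w)"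
        unfolding y_def using w by (simp add: mult.assoc e field_simps)
    qed simp
    finally show ?thesis .
  qed
  have pos: "(\<Prod>k\<in>{N..<2*N}. 1 + y * x ^ k) = (\<Prod>r<N. 1 - w * x ^ Suc r)"
  proof -
    have "(\<Prod>k\<in>{N..<2*N}. 1 + y * x ^ k) = (\<Prod>r<N. 1 + y * x ^ (r + N))"
      using prod.shift_bounds_nat_ivl[of "\<lambda>k. 1 + y * x ^ k" 0 N N]
      by (simp add: mult_2 atLeast0LessThan)
    also have "\<dots> = (\<Prod>r<N. 1 - w * x ^ Suc r)"
    proof (rule prod.cong)
      fix r
      have "x powi (1 - int N) * x ^ (r + N) = x powi (1 - int N + int (r + N))"
        using x power_int_add[of x "1 - int N" "int (r + N)"] by (simp only: power_int_of_nat) simp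
      also have "1 - int N + int (r + N) = int (Suc r)" by simp
      finally have "x powi (1 - int N) * x ^ (r + N) = x ^ Suc r" by (simp only: power_int_of_nat)
      then show "1 + y * x ^ (r + N) = 1 - w * x ^ Suc r"
        unfolding y_def by (simp only: mult.assoc) simp
    qed simp
    finally show ?thesis .
  qed
  define K where "K = (\<Prod>r<N. (- w) * x powi (- int r))"
  have Kval: "K = (- w) ^ N * x powi (- int (N * (N - 1) div 2))"
    unfolding K_def
  proof (induction N)
    case (Suc N)
    show ?case unfolding prod.lessThan_Suc Suc triangular_Suc using x
      by (simp add: power_int_add power_int_diff power_int_minus field_simps power_add)
  qed simp
  have K0: "K \<noteq> 0" using Kval w x by simp
  have "(\<Prod>k<2*N. 1 + y * x ^ k) = (\<Prod>k<N. 1 + y * x ^ k) * (\<Prod>k\<in>{N..<2*N}. 1 + y * x ^ k)"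
  proof -
    have "{..<2*N} = {..<N} \<union> {N..<2*N}" by auto
    then show ?thesis by (simp add: prod.union_disjoint ivl_disj_int)
  qed
  also have "\<dots> = K * (\<Prod>r<N. (1 - w * x ^ Suc r) * (1 - x ^ r / w))"
    unfolding neg pos K_def by (simp only: prod.distrib mult_ac)
  finally have L: "K * (\<Prod>r<N. (1 - w * x ^ Suc r) * (1 - x ^ r / w)) = (\<Prod>k<2*N. 1 + y * x ^ k)" by simp
  also have "\<dots> = (\<Sum>j\<le>2*N. qbin x (2*N) j * x ^ (j * (j - 1) div 2) * y ^ j)" by (rule q_binomial)
  also have "\<dots> = K * (\<Sum>j\<le>2*N. qbin x (2*N) j * (- w) powi (int j - int N)
            * x ^ nat ((int j - int N) * (int j - int N + 1) div 2))"
    unfolding sum_distrib_left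
  proof (rule sum.cong)
    fix j
    let ?m = "int j - int N"
    have ev: "even (?m * (?m + 1))" "even (int j * (int j - 1))" "even (int N * (int N - 1))" by auto
    have nn: "?m * (?m + 1) \<ge> 0"
    proof (cases "?m \<ge> 0")
      case False then show ?thesis by (intro mult_nonpos_nonpos) auto
    qed auto
    have i1: "int (n * (n - 1) div 2) = int n * (int n - 1) div 2" for n
      by (cases n) (auto simp: zdiv_int algebra_simps)
    have ex: "int (nat (?m * (?m + 1) div 2)) - int (N * (N - 1) div 2)
        = int (j * (j - 1) div 2) + (1 - int N) * int j"
    proof -
      obtain a b c where abc: "?m * (?m + 1) = 2 * a" "int j * (int j - 1) = 2 * b" "int N * (int N - 1) = 2 * c"
        using ev by (elim evenE)
      have "2 * (a - c) = 2 * (b + (1 - int N) * int j)"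
        using abc by (simp add: algebra_simps)
      moreover have "a \<ge> 0" using nn abc by simp
      ultimately show ?thesis unfolding i1 abc by simp
    qed
    have "K * ((- w) powi ?m * x ^ nat (?m * (?m + 1) div 2))
        = ((- w) powi ?m * (- w) powi int N) * (x powi int (nat (?m * (?m + 1) div 2)) * x powi (- int (N * (N - 1) div 2)))"
      unfolding Kval by (simp only: power_int_of_nat) (simp add: mult_ac)
    also have "\<dots> = (- w) powi (int j) * x powi (int (nat (?m * (?m + 1) div 2)) - int (N * (N - 1) div 2))"
      using x w by (subst (1 2) power_int_add[symmetric]) simp_all
    also have "\<dots> = (- w) ^ j * (x powi int (j * (j - 1) div 2) * x powi ((1 - int N) * int j))"
      unfolding ex using x by (subst power_int_add) simp_all
    also have "\<dots> = x ^ (j * (j - 1) div 2) * y ^ j"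
      unfolding y_def by (simp only: power_mult_distrib power_int_mult power_int_of_nat) simp
    finally show "qbin x (2*N) j * x ^ (j * (j - 1) div 2) * y ^ j =
       K * (qbin x (2*N) j * (- w) powi ?m * x ^ nat (?m * (?m + 1) div 2))"
      by (simp add: mult_ac)
  qed simp
  finally show ?thesis using K0 by simp
qed

text \<open>
  The Euler product \<open>\<Prod>n\<ge>1. 1 - x\<^sup>n\<close>, as a function of the nome \<open>x\<close>.
\<close>

abbreviation euler_fn :: "complex \<Rightarrow> complex" where
  "euler_fn x \<equiv> (\<Prod>n. 1 - x ^ Suc n)"

lemma one_minus_power_nonzero:
  assumes "norm (x::complex) < 1"
  shows "1 - x ^ Suc n \<noteq> 0"
proof
  assume "1 - x ^ Suc n = 0"
  then have "x ^ Suc n = 1" by (simp only: right_minus_eq)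
  then have "norm x ^ Suc n = 1" by (metis norm_one norm_power)
  moreover have "norm x ^ Suc n < 1"
    using assms by (subst power_less_one_iff) auto
  ultimately show False by simp
qed

lemma convergent_prod_geometric:
  assumes "norm (x::complex) < 1"
  shows "convergent_prod (\<lambda>n. 1 + c * x ^ n)"
proof (intro abs_convergent_prod_imp_convergent_prod summable_imp_abs_convergent_prod)
  show "summable (\<lambda>n. norm (1 + c * x ^ n - 1))"
    using assms by (auto simp: norm_mult norm_power intro!: summable_mult summable_geometric)
qed

lemma convergent_prod_geometric_minus:
  assumes "norm (x::complex) < 1"
  shows "convergent_prod (\<lambda>n. 1 - c * x ^ n)"
  using convergent_prod_geometric[OF assms, of "- c"] by simp

lemma qpoch_LIMSEQ:
  assumes "norm x < 1"
  shows "qpoch x \<longlonglongrightarrow> euler_fn x"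
proof -
  have "convergent_prod (\<lambda>n. 1 - x ^ Suc n)"
    using convergent_prod_geometric_minus[OF assms, of x] by simp
  then have "(\<lambda>n. \<Prod>k\<le>n. 1 - x ^ Suc k) \<longlonglongrightarrow> euler_fn x"
    by (rule convergent_prod_LIMSEQ)
  then have "(\<lambda>n. qpoch x (Suc n)) \<longlonglongrightarrow> euler_fn x"
    by (simp add: qpoch_def lessThan_Suc_atMost)
  then show ?thesis by (rule LIMSEQ_imp_Suc)
qed

lemma euler_fn_nonzero:
  assumes "norm x < 1"
  shows "euler_fn x \<noteq> 0"
proof (rule prodinf_nonzero)
  show "convergent_prod (\<lambda>n. 1 - x ^ Suc n)"
    using convergent_prod_geometric_minus[OF assms, of x] by simp
qed (use one_minus_power_nonzero[OF assms] in blast)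

lemma qpoch_nonzero: "norm x < 1 \<Longrightarrow> qpoch x n \<noteq> 0"
  unfolding qpoch_def using one_minus_power_nonzero by (simp del: power_Suc)

lemma qbin_central_limit:
  assumes x: "norm x < 1"
  shows "(\<lambda>N. qbin x (2 * N) (N + k)) \<longlonglongrightarrow> 1 / euler_fn x"
    and "(\<lambda>N. qbin x (2 * N) (N - k)) \<longlonglongrightarrow> 1 / euler_fn x"
proof -
  note L = qpoch_LIMSEQ[OF x] and nz = euler_fn_nonzero[OF x]
  have L2: "(\<lambda>N. qpoch x (2 * N)) \<longlonglongrightarrow> euler_fn x"
    using L by (rule filterlim_compose) (intro filterlim_subseq strict_monoI, simp)
  have Lp: "(\<lambda>N. qpoch x (N + k)) \<longlonglongrightarrow> euler_fn x"
    using L by (rule LIMSEQ_ignore_initial_segment)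
  have Lm: "(\<lambda>N. qpoch x (N - k)) \<longlonglongrightarrow> euler_fn x"
    by (rule LIMSEQ_offset[of _ k]) (use L in simp)
  have lim: "(\<lambda>N. qpoch x (2 * N) / (qpoch x (N + k) * qpoch x (N - k))) \<longlonglongrightarrow> 1 / euler_fn x"
    using tendsto_divide[OF L2 tendsto_mult[OF Lp Lm]] nz by simp
  have e: "qbin x M j = qpoch x M / (qpoch x j * qpoch x (M - j))" if "j \<le> M" for M j
    using qbin_qpoch[OF that, of x] qpoch_nonzero[OF x] by (simp add: field_simps)
  have ev: "eventually (\<lambda>N. N \<ge> k) sequentially" by (rule eventually_ge_at_top)
  show "(\<lambda>N. qbin x (2 * N) (N + k)) \<longlonglongrightarrow> 1 / euler_fn x"
    by (rule Lim_transform_eventually[OF lim], use ev in eventually_elim) (simp add: e mult_2)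
  show "(\<lambda>N. qbin x (2 * N) (N - k)) \<longlonglongrightarrow> 1 / euler_fn x"
    by (rule Lim_transform_eventually[OF lim], use ev in eventually_elim) (simp add: e mult_2 mult_ac add_ac)
qed

text \<open>
  The uniform bound that allows the passage to the limit in the finite triple product by Tannery's theorem.
\<close>

lemma qbin_bounded:
  assumes x: "norm x < 1"
  obtains C where "\<And>M j. norm (qbin x M j) \<le> C"
proof -
  have "Bseq (qpoch x)" using qpoch_LIMSEQ[OF x] convergent_imp_Bseq convergentI by blast
  then obtain A where A: "A > 0" "\<And>n. norm (qpoch x n) \<le> A" by (auto simp: Bseq_def)
  have "(\<lambda>n. inverse (qpoch x n)) \<longlonglongrightarrow> inverse (euler_fn x)"
    by (intro tendsto_inverse qpoch_LIMSEQ euler_fn_nonzero x)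
  then have "Bseq (\<lambda>n. inverse (qpoch x n))" using convergent_imp_Bseq convergentI by blast
  then obtain B where B: "B > 0" "\<And>n. norm (inverse (qpoch x n)) \<le> B" unfolding Bseq_def by auto
  have "norm (qbin x M j) \<le> A * (B * B)" for M j
  proof (cases "j \<le> M")
    case True
    have "qbin x M j = qpoch x M * (inverse (qpoch x j) * inverse (qpoch x (M - j)))"
      using qbin_qpoch[OF True, of x] qpoch_nonzero[OF x] by (simp add: field_simps)
    then have "norm (qbin x M j) = norm (qpoch x M) * (norm (inverse (qpoch x j)) * norm (inverse (qpoch x (M - j))))"
      by (simp only: norm_mult)
    also have "\<dots> \<le> A * (B * B)"
      by (intro mult_mono mult_nonneg_nonneg norm_ge_zero A(2) B(2) less_imp_le[OF A(1)] less_imp_le[OF B(1)])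
    finally show ?thesis .
  next
    case False then show ?thesis using A B by (simp add: qbin_eq_0)
  qed
  then show ?thesis using that by blast
qed

lemma summable_triangular:
  assumes x: "norm (x::complex) < 1"
  shows "summable (\<lambda>k. norm (w ^ k * x ^ (k * Suc k div 2)))"
proof -
  have "(\<lambda>k. norm w * norm x ^ Suc k) \<longlonglongrightarrow> norm w * 0"
    using x by (intro tendsto_mult tendsto_const LIMSEQ_Suc LIMSEQ_power_zero) auto
  then have "eventually (\<lambda>k. norm w * norm x ^ Suc k < 1/2) sequentially"
    by (rule order_tendstoD) simp
  then obtain N where N: "\<And>k. k \<ge> N \<Longrightarrow> norm w * norm x ^ Suc k < 1/2"
    by (auto simp: eventually_sequentially)
  show ?thesis
  proof (rule summable_ratio_test[of "1/2" N])
    fix k assume k: "N \<le> k"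
    have "Suc k * Suc (Suc k) = k * Suc k + Suc k * 2" by simp
    then have t: "Suc k * Suc (Suc k) div 2 = k * Suc k div 2 + Suc k" by simp
    have "norm (w ^ Suc k * x ^ (Suc k * Suc (Suc k) div 2)) = norm (w ^ k * x ^ (k * Suc k div 2)) * (norm w * norm x ^ Suc k)"
      unfolding t by (simp add: norm_mult norm_power power_add)
    also have "\<dots> \<le> norm (w ^ k * x ^ (k * Suc k div 2)) * (1/2)"
      using N[OF k] by (intro mult_left_mono) auto
    finally show "norm (norm (w ^ Suc k * x ^ (Suc k * Suc (Suc k) div 2))) \<le> 1/2 * norm (norm (w ^ k * x ^ (k * Suc k div 2)))"
      by simp
  qed simp
qed

lemma has_sum_int_split:
  fixes f :: "int \<Rightarrow> 'a::banach"
  assumes "summable (\<lambda>k. norm (f (int k)))" "summable (\<lambda>k. norm (f (- int k - 1)))"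
  shows "(f has_sum ((\<Sum>k. f (int k)) + (\<Sum>k. f (- int k - 1)))) UNIV"
proof -
  have i1: "inj (int :: nat \<Rightarrow> int)" by simp
  have i2: "inj (\<lambda>k. - int k - 1)" by (auto simp: inj_def)
  have "((\<lambda>k. f (int k)) has_sum (\<Sum>k. f (int k))) UNIV"
    using assms by (intro norm_summable_imp_has_sum summable_sums) (auto intro: summable_norm_cancel)
  then have 1: "(f has_sum (\<Sum>k. f (int k))) (range int)"
    using has_sum_reindex[OF i1, of f] by (simp add: o_def)
  have "((\<lambda>k. f (- int k - 1)) has_sum (\<Sum>k. f (- int k - 1))) UNIV"
    using assms by (intro norm_summable_imp_has_sum summable_sums) (auto intro: summable_norm_cancel)
  then have 2: "(f has_sum (\<Sum>k. f (- int k - 1))) (range (\<lambda>k. - int k - 1))"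
    using has_sum_reindex[OF i2, of f] by (simp add: o_def)
  have u: "range int \<union> range (\<lambda>k. - int k - 1) = (UNIV :: int set)"
  proof -
    have "m \<in> range int \<union> range (\<lambda>k. - int k - 1)" for m
    proof (cases "m \<ge> 0")
      case True then show ?thesis by (metis UnI1 nonneg_int_cases rangeI)
    next
      case False
      then have "m = - int (nat (- m - 1)) - 1" by simp
      then show ?thesis by blast
    qed
    then show ?thesis by blast
  qed
  have "range int \<inter> range (\<lambda>k. - int k - 1) = {}" by auto
  then show ?thesis using has_sum_Un_disjoint[OF 1 2] unfolding u by blast
qed

text \<open>
  The exponent \<open>m (m + 1) / 2\<close> is a nonnegative integer for every integer \<open>m\<close>, so no square root of \<open>x\<close> is needed.
\<close>

theorem jacobi_triple_product:
  assumes x: "norm x < 1" "x \<noteq> 0" and w: "w \<noteq> 0"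
  shows "((\<lambda>m::int. (- w) powi m * x ^ nat (m * (m + 1) div 2)) has_sum
     (euler_fn x * ((\<Prod>n. 1 - w * x ^ Suc n) * (\<Prod>n. 1 - x ^ n / w)))) UNIV"
proof -
  define f where "f = (\<lambda>m::int. (- w) powi m * x ^ nat (m * (m + 1) div 2))"
  define u where "u = (\<lambda>k. f (int k))"
  define v where "v = (\<lambda>k. f (- int k - 1))"
  have tri: "nat (int k * (int k + 1) div 2) = k * Suc k div 2" for k
    by (simp add: nat_div_distrib nat_mult_distrib nat_add_distrib)
  have u: "u k = (- w) ^ k * x ^ (k * Suc k div 2)" for k
    unfolding u_def f_def tri by simp
  have tri': "(- int k - 1) * (- int k - 1 + 1) = int k * (int k + 1)" for k by (simp add: algebra_simps)
  have v: "v k = (- 1 / w) * ((- 1 / w) ^ k * x ^ (k * Suc k div 2))" for k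
  proof -
    have "(- w) powi (- int k - 1) = (- 1 / w) ^ Suc k"
    proof -
      have e1: "- int k - 1 = - int (Suc k)" by simp
      have e2: "- 1 / w = inverse (- w)" using w by (simp add: field_simps)
      have "(- w) powi (- int (Suc k)) = inverse ((- w) ^ Suc k)"
        by (subst power_int_minus, subst power_int_of_nat) (rule refl)
      then show ?thesis by (simp only: e1 e2 power_inverse)
    qed
    then show ?thesis unfolding v_def f_def tri' tri by simp
  qed
  have su: "summable (\<lambda>k. norm (u k))" unfolding u by (rule summable_triangular[OF x(1)])
  have sv: "summable (\<lambda>k. norm (v k))" unfolding v norm_mult[of "-1/w"]
    by (intro summable_mult summable_triangular[OF x(1)])
  have hs: "(f has_sum (suminf u + suminf v)) UNIV"
    using has_sum_int_split[of f] su sv unfolding u_def v_def by blast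
  obtain C where C: "\<And>M j. norm (qbin x M j) \<le> C" using qbin_bounded[OF x(1)] by blast
  \<comment> \<open>The terms with nonnegative and with negative index, as two series in the index \<open>k\<close> that
    depend on the number \<open>N\<close> of factors.\<close>
  define a where "a = (\<lambda>k N. if k \<le> N then qbin x (2*N) (N + k) * u k else 0)"
  define b where "b = (\<lambda>k N. if Suc k \<le> N then qbin x (2*N) (N - Suc k) * v k else 0)"
  have C0: "C \<ge> 0" using C[of 0 0] norm_ge_zero order_trans by blast
  have A: "(\<lambda>N. \<Sum>k. a k N) \<longlonglongrightarrow> (\<Sum>k. 1 / euler_fn x * u k)"
  proof (rule tannerys_theorem[THEN conjunct2, THEN conjunct2])
    fix k
    have "eventually (\<lambda>N. qbin x (2*N) (N + k) * u k = a k N) sequentially"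
      using eventually_ge_at_top[of k] by eventually_elim (simp add: a_def)
    then show "(\<lambda>N. a k N) \<longlonglongrightarrow> 1 / euler_fn x * u k"
      by (rule Lim_transform_eventually[rotated]) (intro tendsto_mult tendsto_const qbin_central_limit x)
  next
    show "\<forall>\<^sub>F (k, N) in sequentially \<times>\<^sub>F sequentially. norm (a k N) \<le> C * norm (u k)"
      by (intro always_eventually) (auto simp: a_def norm_mult C0 intro!: mult_right_mono C)
    show "summable (\<lambda>k. C * norm (u k))" by (intro summable_mult su)
  qed simp
  have B: "(\<lambda>N. \<Sum>k. b k N) \<longlonglongrightarrow> (\<Sum>k. 1 / euler_fn x * v k)"
  proof (rule tannerys_theorem[THEN conjunct2, THEN conjunct2])
    fix k
    have "eventually (\<lambda>N. qbin x (2*N) (N - Suc k) * v k = b k N) sequentially"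
      using eventually_ge_at_top[of "Suc k"] by eventually_elim (simp add: b_def)
    then show "(\<lambda>N. b k N) \<longlonglongrightarrow> 1 / euler_fn x * v k"
      by (rule Lim_transform_eventually[rotated]) (intro tendsto_mult tendsto_const qbin_central_limit x)
  next
    show "\<forall>\<^sub>F (k, N) in sequentially \<times>\<^sub>F sequentially. norm (b k N) \<le> C * norm (v k)"
      by (intro always_eventually) (auto simp: b_def norm_mult C0 intro!: mult_right_mono C)
    show "summable (\<lambda>k. C * norm (v k))" by (intro summable_mult sv)
  qed simp
  have fin: "(\<Prod>r<N. (1 - w * x ^ Suc r) * (1 - x ^ r / w)) = (\<Sum>k. a k N) + (\<Sum>k. b k N)" for N
  proof -
    have g: "(\<Prod>r<N. (1 - w * x ^ Suc r) * (1 - x ^ r / w)) = (\<Sum>j\<le>2*N. qbin x (2*N) j * f (int j - int N))"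
      unfolding finite_jacobi_triple_product[OF x(2) w] f_def by (simp add: mult.assoc)
    have s: "{..2*N} = {..<N} \<union> {N..2*N}" by auto
    have "(\<Sum>j\<le>2*N. qbin x (2*N) j * f (int j - int N))
       = (\<Sum>j<N. qbin x (2*N) j * f (int j - int N)) + (\<Sum>j\<in>{N..2*N}. qbin x (2*N) j * f (int j - int N))"
      unfolding s by (rule sum.union_disjoint) auto
    also have "(\<Sum>j\<in>{N..2*N}. qbin x (2*N) j * f (int j - int N)) = (\<Sum>k\<le>N. a k N)"
      by (rule sum.reindex_bij_witness[of _ "\<lambda>k. k + N" "\<lambda>j. j - N"]) (auto simp: a_def u_def of_nat_diff)
    also have "\<dots> = (\<Sum>k. a k N)"
      by (rule suminf_finite[symmetric]) (auto simp: a_def)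
    also have "(\<Sum>j<N. qbin x (2*N) j * f (int j - int N)) = (\<Sum>k<N. b k N)"
      by (rule sum.reindex_bij_witness[of _ "\<lambda>k. N - Suc k" "\<lambda>j. N - Suc j"])
         (auto simp: b_def v_def of_nat_diff algebra_simps)
    also have "\<dots> = (\<Sum>k. b k N)"
      by (rule suminf_finite[symmetric]) (auto simp: b_def)
    finally show ?thesis unfolding g by (simp add: add_ac)
  qed
  have "(\<lambda>N. \<Prod>r<N. (1 - w * x ^ Suc r) * (1 - x ^ r / w)) \<longlonglongrightarrow> (\<Sum>k. 1 / euler_fn x * u k) + (\<Sum>k. 1 / euler_fn x * v k)"
    unfolding fin by (intro tendsto_add A B)
  moreover have "(\<lambda>N. \<Prod>r<N. (1 - w * x ^ Suc r) * (1 - x ^ r / w)) \<longlonglongrightarrow> (\<Prod>n. 1 - w * x ^ Suc n) * (\<Prod>n. 1 - x ^ n / w)"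
  proof -
    have c1: "convergent_prod (\<lambda>n. 1 - w * x ^ Suc n)"
      using convergent_prod_geometric_minus[OF x(1), of "w * x"] by (simp add: mult.assoc)
    have c2: "convergent_prod (\<lambda>n. 1 - x ^ n / w)"
      using convergent_prod_geometric_minus[OF x(1), of "1 / w"] by simp
    have "(\<lambda>N. \<Prod>r<N. 1 - w * x ^ Suc r) \<longlonglongrightarrow> (\<Prod>n. 1 - w * x ^ Suc n)"
      using convergent_prod_LIMSEQ[OF c1] by (simp add: LIMSEQ_lessThan_iff_atMost)
    moreover have "(\<lambda>N. \<Prod>r<N. 1 - x ^ r / w) \<longlonglongrightarrow> (\<Prod>n. 1 - x ^ n / w)"
      using convergent_prod_LIMSEQ[OF c2] by (simp add: LIMSEQ_lessThan_iff_atMost)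
    ultimately show ?thesis unfolding prod.distrib by (rule tendsto_mult)
  qed
  ultimately have "(\<Sum>k. 1 / euler_fn x * u k) + (\<Sum>k. 1 / euler_fn x * v k) = (\<Prod>n. 1 - w * x ^ Suc n) * (\<Prod>n. 1 - x ^ n / w)"
    by (rule LIMSEQ_unique)
  moreover have "(\<Sum>k. 1 / euler_fn x * u k) = 1 / euler_fn x * suminf u" "(\<Sum>k. 1 / euler_fn x * v k) = 1 / euler_fn x * suminf v"
    by (rule suminf_mult[OF summable_norm_cancel[OF su]], rule suminf_mult[OF summable_norm_cancel[OF sv]])
  ultimately have "suminf u + suminf v = euler_fn x * ((\<Prod>n. 1 - w * x ^ Suc n) * (\<Prod>n. 1 - x ^ n / w))"
    using euler_fn_nonzero[OF x(1)] by (simp add: field_simps)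
  then show ?thesis using hs unfolding f_def by simp
qed

section \<open>One-variable theta series\<close>

text \<open>
  \<open>e2pi X\<close> is \<open>exp (2\<pi>\<i> X)\<close>.
\<close>

definition e2pi :: "complex \<Rightarrow> complex" where
  "e2pi X = exp (2 * of_real pi * \<i> * X)"

lemma e2pi_add: "e2pi (X + Y) = e2pi X * e2pi Y"
  by (simp add: e2pi_def ring_distribs exp_add)

lemma e2pi_diff: "e2pi (X - Y) = e2pi X / e2pi Y"
  by (simp add: e2pi_def ring_distribs exp_diff)

lemma e2pi_minus: "e2pi (- X) = inverse (e2pi X)"
  by (simp add: e2pi_def exp_minus)

lemma e2pi_0 [simp]: "e2pi 0 = 1"
  by (simp add: e2pi_def)

lemma e2pi_nonzero [simp]: "e2pi X \<noteq> 0"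
  by (simp add: e2pi_def)

lemma e2pi_powi: "e2pi X powi m = e2pi (of_int m * X)"
  by (simp add: e2pi_def exp_power_int mult_ac)

lemma e2pi_power: "e2pi X ^ m = e2pi (of_nat m * X)"
  by (simp add: e2pi_def exp_of_nat_mult[symmetric] mult_ac)

lemma norm_e2pi: "norm (e2pi X) = exp (- (2 * pi * Im X))"
  by (simp add: e2pi_def norm_exp_eq_Re)

lemma e2pi_eq_1_iff: "e2pi X = 1 \<longleftrightarrow> X \<in> \<int>"
proof
  assume "e2pi X = 1"
  then obtain n :: int where "Re (2 * of_real pi * \<i> * X) = 0" "Im (2 * of_real pi * \<i> * X) = of_int (2 * n) * pi"
    unfolding e2pi_def exp_eq_1 by auto
  then have "X = of_int n" by (simp add: complex_eq_iff)
  then show "X \<in> \<int>" by simp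
next
  assume "X \<in> \<int>"
  then obtain n where "X = of_int n" by (elim Ints_cases)
  then show "e2pi X = 1" unfolding e2pi_def exp_eq_1 by (auto intro!: exI[of _ n])
qed

lemma e2pi_of_int [simp]: "e2pi (of_int n) = 1"
  by (simp add: e2pi_eq_1_iff)

lemma e2pi_half: "e2pi (1 / 2) = - 1"
  by (simp add: e2pi_def)

lemma gaussian_summable:
  fixes a b :: real
  assumes a: "a > 0"
  shows "(\<lambda>n::int. (1 + of_int n ^ 2) * exp (- (a * of_int n ^ 2) + b * \<bar>of_int n\<bar>)) summable_on UNIV"
proof -
  define K where "K = (b + 2)\<^sup>2 / (4 * a)"
  have geo: "summable (\<lambda>k. norm (exp (- real k)))"
  proof -
    have "summable (\<lambda>k. exp (- 1 :: real) ^ k)" by (rule summable_geometric) simp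
    then show ?thesis by (simp add: exp_of_nat_mult[symmetric])
  qed
  have g2: "summable (\<lambda>k. norm (exp (- real k - 1)))"
    using summable_mult[OF geo, of "exp (- 1)"] by (simp add: exp_diff exp_minus field_simps)
  have eq: "(\<lambda>k. norm (exp (- \<bar>real_of_int (int k)\<bar>))) = (\<lambda>k. norm (exp (- real k)))"
    "(\<lambda>k. norm (exp (- \<bar>real_of_int (- int k - 1)\<bar>))) = (\<lambda>k. norm (exp (- real k - 1)))"
    by (auto simp: fun_eq_iff)
  have "(\<lambda>n::int. exp (- \<bar>real_of_int n\<bar>)) summable_on UNIV"
    by (rule has_sum_imp_summable, rule has_sum_int_split) (simp_all only: eq geo g2)
  then have s: "(\<lambda>n::int. 2 * exp K * exp (- \<bar>real_of_int n\<bar>)) summable_on UNIV"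
    by (rule summable_on_cmult_right)
  have bnd: "(1 + x ^ 2) * exp (- (a * x ^ 2) + b * \<bar>x\<bar>) \<le> 2 * exp K * exp (- \<bar>x\<bar>)" for x :: real
  proof -
    have "1 + \<bar>x\<bar> + \<bar>x\<bar>\<^sup>2 / 2 \<le> exp \<bar>x\<bar>" by (rule exp_lower_Taylor_quadratic) simp
    moreover have "1 + \<bar>x\<bar> + \<bar>x\<bar>\<^sup>2 / 2 = 1 + \<bar>x\<bar> + x\<^sup>2 / 2" by simp
    ultimately have "1 + x ^ 2 \<le> 2 * exp \<bar>x\<bar>" by argo
    then have "(1 + x ^ 2) * exp (- (a * x ^ 2) + b * \<bar>x\<bar>) \<le> 2 * exp \<bar>x\<bar> * exp (- (a * x ^ 2) + b * \<bar>x\<bar>)"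
      by (intro mult_right_mono) auto
    also have "\<dots> = 2 * exp (- (a * x ^ 2) + (b + 1) * \<bar>x\<bar>)" by (simp add: exp_add[symmetric] algebra_simps)
    also have "- (a * x ^ 2) + (b + 1) * \<bar>x\<bar> \<le> K - \<bar>x\<bar>"
    proof -
      have "0 \<le> (2 * a * \<bar>x\<bar> - (b + 2))\<^sup>2 / (4 * a)" using a by simp
      also have "(2 * a * \<bar>x\<bar> - (b + 2))\<^sup>2 / (4 * a) = a * x ^ 2 - (b + 2) * \<bar>x\<bar> + K"
        using a unfolding K_def by (simp add: field_simps power2_eq_square)
      finally show ?thesis by (simp add: algebra_simps)
    qed
    then have "2 * exp (- (a * x ^ 2) + (b + 1) * \<bar>x\<bar>) \<le> 2 * exp (K - \<bar>x\<bar>)" by simp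
    also have "\<dots> = 2 * exp K * exp (- \<bar>x\<bar>)" by (simp add: exp_diff exp_minus field_simps)
    finally show ?thesis by simp
  qed
  show ?thesis
    by (rule summable_on_comparison_test[OF s]) (use bnd in auto)
qed

text \<open>
  \<open>gsum a D\<close> is the theta series \<open>\<Sum>n\<in>\<int>. a n q\<^bsup>n\<^sup>2/D\<^esup> \<zeta>\<^bsup>n/2\<^esup>\<close> with \<open>q = e2pi \<tau>\<close> and \<open>\<zeta> = e2pi z\<close>, for a bounded
  coefficient function \<open>a\<close>; \<open>gterm\<close> is its term of index \<open>n\<close>. Both \<open>\<vartheta>\<close> (with \<open>D = 8\<close>) and
  \<open>\<vartheta>\<^bsub>3/2\<^esub>\<close> (with \<open>D = 24\<close>) are of this shape.
\<close>
definition gterm :: "(int \<Rightarrow> complex) \<Rightarrow> real \<Rightarrow> int \<Rightarrow> complex \<Rightarrow> complex \<Rightarrow> complex" where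
  "gterm a D n \<tau> z = a n * e2pi (of_int n ^ 2 / of_real D * \<tau> + of_int n / 2 * z)"

definition gsum :: "(int \<Rightarrow> complex) \<Rightarrow> real \<Rightarrow> complex \<Rightarrow> complex \<Rightarrow> complex" where
  "gsum a D \<tau> z = (\<Sum>\<^sub>\<infinity>n\<in>UNIV. gterm a D n \<tau> z)"

lemma norm_gterm_le:
  assumes "norm (a n) \<le> 1" "D > 0" "Im \<tau> \<ge> \<delta>" "norm z \<le> R"
  shows "norm (gterm a D n \<tau> z) \<le> exp (- (2 * pi * \<delta> / D * of_int n ^ 2) + pi * R * \<bar>of_int n\<bar>)"
proof -
  have "norm (gterm a D n \<tau> z) \<le> 1 * norm (e2pi (of_int n ^ 2 / of_real D * \<tau> + of_int n / 2 * z))"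
    unfolding gterm_def norm_mult using assms by (intro mult_right_mono) auto
  also have "\<dots> = exp (- (2 * pi * (of_int n ^ 2 / D * Im \<tau> + of_int n / 2 * Im z)))"
  proof -
    have "Im (of_int n ^ 2 / of_real D * \<tau> + of_int n / 2 * z) = of_int n ^ 2 / D * Im \<tau> + of_int n / 2 * Im z"
    proof -
      have "of_int n ^ 2 / of_real D * \<tau> + of_int n / 2 * z
          = of_real (of_int n ^ 2 / D) * \<tau> + of_real (of_int n / 2) * z" by simp
      then show ?thesis by (simp only: plus_complex.simps Im_complex_of_real times_complex.simps Re_complex_of_real mult_zero_left add_0_right)
    qed
    then show ?thesis by (simp add: norm_e2pi)
  qed
  also have "\<dots> \<le> exp (- (2 * pi * \<delta> / D * of_int n ^ 2) + pi * R * \<bar>of_int n\<bar>)"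
  proof -
    have "of_int n ^ 2 / D * \<delta> \<le> of_int n ^ 2 / D * Im \<tau>"
      using assms by (intro mult_left_mono) auto
    moreover have "- (of_int n / 2 * Im z) \<le> \<bar>of_int n\<bar> / 2 * R"
    proof -
      have "- (of_int n / 2 * Im z) \<le> \<bar>of_int n / 2 * Im z\<bar>" by linarith
      also have "\<dots> = \<bar>of_int n\<bar> / 2 * \<bar>Im z\<bar>" by (simp add: abs_mult)
      also have "\<dots> \<le> \<bar>of_int n\<bar> / 2 * R"
        using abs_Im_le_cmod[of z] assms by (intro mult_left_mono) auto
      finally show ?thesis .
    qed
    ultimately have "- (of_int n ^ 2 / D * Im \<tau> + of_int n / 2 * Im z) \<le> - (of_int n ^ 2 / D * \<delta>) + \<bar>of_int n\<bar> / 2 * R"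
      by linarith
    then have "2 * pi * (- (of_int n ^ 2 / D * Im \<tau> + of_int n / 2 * Im z)) \<le> 2 * pi * (- (of_int n ^ 2 / D * \<delta>) + \<bar>of_int n\<bar> / 2 * R)"
      by (intro mult_left_mono) auto
    then show ?thesis by (simp add: algebra_simps)
  qed
  finally show ?thesis .
qed

lemma gterm_abs_summable:
  assumes "\<And>n. norm (a n) \<le> 1" "D > 0" "Im \<tau> > 0"
  shows "(\<lambda>n. norm (gterm a D n \<tau> z)) summable_on UNIV"
proof (rule Infinite_Sum.abs_summable_on_comparison_test')
  show "(\<lambda>n::int. (1 + of_int n ^ 2) * exp (- (2 * pi * Im \<tau> / D * of_int n ^ 2) + pi * norm z * \<bar>of_int n\<bar>)) summable_on UNIV"
    by (rule gaussian_summable) (use assms in auto)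
next
  fix n
  have "norm (gterm a D n \<tau> z) \<le> exp (- (2 * pi * Im \<tau> / D * of_int n ^ 2) + pi * norm z * \<bar>of_int n\<bar>)"
    by (rule norm_gterm_le) (use assms in auto)
  also have "\<dots> \<le> (1 + of_int n ^ 2) * exp (- (2 * pi * Im \<tau> / D * of_int n ^ 2) + pi * norm z * \<bar>of_int n\<bar>)"
    by simp
  finally show "norm (gterm a D n \<tau> z) \<le> (1 + of_int n ^ 2) * exp (- (2 * pi * Im \<tau> / D * of_int n ^ 2) + pi * norm z * \<bar>of_int n\<bar>)" .
qed

lemma gsum_has_sum:
  assumes "\<And>n. norm (a n) \<le> 1" "D > 0" "Im \<tau> > 0"
  shows "((\<lambda>n. gterm a D n \<tau> z) has_sum gsum a D \<tau> z) UNIV"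
  unfolding gsum_def by (rule has_sum_infsum[OF abs_summable_summable[OF gterm_abs_summable[OF assms]]])

text \<open>
  Total differentiability in the two variables jointly, with a complex linear derivative. It holds
  because the series and its formal derivative are dominated, on a neighbourhood \<open>S\<close> of the point, by one
  convergent Gaussian series; the integer indices are enumerated by \<open>int_decode\<close>.
\<close>

lemma gsum_has_derivative:
  assumes a: "\<And>n. norm (a n) \<le> 1" and D: "D > 0" and \<tau>: "Im \<tau> > 0"
  obtains A B where "((\<lambda>(t, w). gsum a D t w) has_derivative (\<lambda>(h, k). A * h + B * k)) (at (\<tau>, z))"
proof -
  define \<delta> where "\<delta> = Im \<tau> / 2"
  define R where "R = norm z + 1"
  have \<delta>: "\<delta> > 0" using \<tau> by (simp add: \<delta>_def)
  define S where "S = {t. Im t > \<delta>} \<times> ball (0::complex) R"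
  have opS: "open S" unfolding S_def
    by (intro open_Times open_halfspace_Im_gt open_ball)
  have cvS: "convex S" unfolding S_def
    by (intro convex_Times convex_halfspace_Im_gt convex_ball)
  have inS: "(\<tau>, z) \<in> S" using \<tau> by (simp add: S_def \<delta>_def R_def)
  define ix where "ix = int_decode"
  define f where "f = (\<lambda>i (x::complex \<times> complex). gterm a D (ix i) (fst x) (snd x))"
  define M where "M = (\<lambda>n::int. (1 + of_int n ^ 2) * exp (- (2 * pi * \<delta> / D * of_int n ^ 2) + pi * R * \<bar>of_int n\<bar>))"
  have "M summable_on UNIV" unfolding M_def by (rule gaussian_summable) (use D \<delta> in auto)
  then have "(\<lambda>i. M (ix i)) summable_on UNIV"
    unfolding ix_def using summable_on_reindex_bij_betw[OF bij_int_decode, of M] by simp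
  then have sM: "summable (\<lambda>i. M (ix i))" by (rule summable_on_imp_summable)
  define ca where "ca = (\<lambda>i. 2 * of_real pi * \<i> * (of_int (ix i) ^ 2 / of_real D))"
  define cb where "cb = (\<lambda>i. 2 * of_real pi * \<i> * (of_int (ix i) / 2 :: complex))"
  define ga where "ga = (\<lambda>x. \<Sum>i. f i x * ca i)"
  define gb where "gb = (\<lambda>x. \<Sum>i. f i x * cb i)"
  have fM: "norm (f i x) * (1 + of_int (ix i) ^ 2) \<le> M (ix i)" if "x \<in> S" for i x
  proof -
    have "norm (f i x) \<le> exp (- (2 * pi * \<delta> / D * of_int (ix i) ^ 2) + pi * R * \<bar>of_int (ix i)\<bar>)"
      unfolding f_def by (rule norm_gterm_le) (use that a D in \<open>auto simp: S_def dist_norm\<close>)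
    then have "norm (f i x) * (1 + of_int (ix i) ^ 2) \<le> exp (- (2 * pi * \<delta> / D * of_int (ix i) ^ 2) + pi * R * \<bar>of_int (ix i)\<bar>) * (1 + of_int (ix i) ^ 2)"
      by (intro mult_right_mono) auto
    then show ?thesis by (simp add: M_def mult_ac)
  qed
  have bA: "norm (f i x * ca i) \<le> 2 * pi / D * M (ix i)" if "x \<in> S" for i x
  proof -
    have "norm (f i x * ca i) = 2 * pi / D * (norm (f i x) * of_int (ix i) ^ 2)"
      using D by (simp add: ca_def norm_mult norm_divide norm_power field_simps)
    also have "\<dots> \<le> 2 * pi / D * (norm (f i x) * (1 + of_int (ix i) ^ 2))"
      using D by (intro mult_left_mono) auto
    also have "\<dots> \<le> 2 * pi / D * M (ix i)"
      using fM[OF that] D by (intro mult_left_mono) auto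
    finally show ?thesis .
  qed
  have bB: "norm (f i x * cb i) \<le> pi * M (ix i)" if "x \<in> S" for i x
  proof -
    have "\<bar>of_int (ix i) :: real\<bar> \<le> 1 + of_int (ix i) ^ 2"
      using power2_eq_square[of "\<bar>of_int (ix i) :: real\<bar>"] sum_power2_ge_zero[of "\<bar>of_int (ix i) :: real\<bar> - 1" 0]
      by (simp add: power2_diff)
    moreover have "norm (f i x * cb i) = pi * (norm (f i x) * \<bar>of_int (ix i)\<bar>)"
      by (simp add: cb_def norm_mult norm_divide)
    ultimately have "norm (f i x * cb i) \<le> pi * (norm (f i x) * (1 + of_int (ix i) ^ 2))"
      by (simp only:) (intro mult_left_mono, auto)
    also have "\<dots> \<le> pi * M (ix i)" using fM[OF that] by (intro mult_left_mono) auto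
    finally show ?thesis .
  qed
  have uA: "uniform_limit S (\<lambda>N x. \<Sum>i<N. f i x * ca i) ga sequentially"
    unfolding ga_def by (rule Weierstrass_m_test[OF bA]) (assumption, intro summable_mult sM)
  have uB: "uniform_limit S (\<lambda>N x. \<Sum>i<N. f i x * cb i) gb sequentially"
    unfolding gb_def by (rule Weierstrass_m_test[OF bB]) (assumption, intro summable_mult sM)
  have hs: "(\<lambda>i. f i x) sums gsum a D (fst x) (snd x)" if "x \<in> S" for x
  proof -
    have "((\<lambda>n. gterm a D n (fst x) (snd x)) has_sum gsum a D (fst x) (snd x)) UNIV"
      by (rule gsum_has_sum) (use that a D \<delta> in \<open>auto simp: S_def\<close>)
    then have "((\<lambda>i. gterm a D (int_decode i) (fst x) (snd x)) has_sum gsum a D (fst x) (snd x)) UNIV"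
      using has_sum_reindex_bij_betw[OF bij_int_decode, of "\<lambda>n. gterm a D n (fst x) (snd x)"] by simp
    then show ?thesis unfolding f_def ix_def by (rule has_sum_imp_sums)
  qed
  have "\<exists>g. \<forall>x\<in>S. (\<lambda>i. f i x) sums g x \<and> (g has_derivative (\<lambda>h. ga x * fst h + gb x * snd h)) (at x within S)"
  proof (rule has_derivative_series[where f = f and x = "(\<tau>, z)" and l = "gsum a D \<tau> z"
        and f' = "\<lambda>i x h. f i x * ca i * fst h + f i x * cb i * snd h"])
    show "convex S" "(\<tau>, z) \<in> S" "(\<lambda>i. f i (\<tau>, z)) sums gsum a D \<tau> z"
      using cvS inS hs[OF inS] by auto
  next
    fix i x
    have e: "f i = (\<lambda>x. a (ix i) * exp (ca i * fst x + cb i * snd x))"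
      unfolding f_def gterm_def e2pi_def ca_def cb_def by (simp add: algebra_simps)
    show "(f i has_derivative (\<lambda>h. f i x * ca i * fst h + f i x * cb i * snd h)) (at x within S)"
    proof -
      have "((\<lambda>x. ca i * fst x + cb i * snd x) has_derivative (\<lambda>h. ca i * fst h + cb i * snd h)) (at x within S)"
        by (intro derivative_intros)
      from has_derivative_compose[OF this DERIV_exp[unfolded has_field_derivative_def]]
      have "((\<lambda>x. a (ix i) * exp (ca i * fst x + cb i * snd x)) has_derivative
          (\<lambda>h. a (ix i) * (exp (ca i * fst x + cb i * snd x) * (ca i * fst h + cb i * snd h))))  (at x within S)"
        by (rule has_derivative_mult_right)
      then show ?thesis unfolding e by (rule has_derivative_eq_rhs) (simp add: fun_eq_iff algebra_simps)
    qed
  next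
    fix e :: real assume e: "e > 0"
    have "\<forall>\<^sub>F n in sequentially. \<forall>x\<in>S. dist (\<Sum>i<n. f i x * ca i) (ga x) < e/2"
      "\<forall>\<^sub>F n in sequentially. \<forall>x\<in>S. dist (\<Sum>i<n. f i x * cb i) (gb x) < e/2"
      by (rule uniform_limitD[OF uA], use e in simp) (rule uniform_limitD[OF uB], use e in simp)
    then show "\<forall>\<^sub>F n in sequentially. \<forall>x\<in>S. \<forall>h. norm ((\<Sum>i<n. f i x * ca i * fst h + f i x * cb i * snd h) - (ga x * fst h + gb x * snd h)) \<le> e * norm h"
    proof (rule eventually_elim2, intro ballI allI)
      fix n x and h :: "complex \<times> complex"
      assume "\<forall>x\<in>S. dist (\<Sum>i<n. f i x * ca i) (ga x) < e/2" "\<forall>x\<in>S. dist (\<Sum>i<n. f i x * cb i) (gb x) < e/2" and x: "x \<in> S"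
      then have d: "norm ((\<Sum>i<n. f i x * ca i) - ga x) \<le> e/2" "norm ((\<Sum>i<n. f i x * cb i) - gb x) \<le> e/2"
        by (auto simp: dist_norm less_imp_le)
      have "(\<Sum>i<n. f i x * ca i * fst h + f i x * cb i * snd h) - (ga x * fst h + gb x * snd h)
          = ((\<Sum>i<n. f i x * ca i) - ga x) * fst h + ((\<Sum>i<n. f i x * cb i) - gb x) * snd h"
        by (simp only: sum.distrib left_diff_distrib sum_distrib_right add_diff_add)
      also have "norm \<dots> \<le> e/2 * norm h + e/2 * norm h"
      proof (rule order_trans[OF norm_triangle_ineq], rule add_mono)
        have h: "norm (fst h) \<le> norm h" "norm (snd h) \<le> norm h"
          by (metis norm_fst_le prod.collapse) (metis norm_snd_le prod.collapse)
        show "norm (((\<Sum>i<n. f i x * ca i) - ga x) * fst h) \<le> e/2 * norm h"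
          unfolding norm_mult by (rule mult_mono[OF d(1) h(1)]) (use e in auto)
        show "norm (((\<Sum>i<n. f i x * cb i) - gb x) * snd h) \<le> e/2 * norm h"
          unfolding norm_mult by (rule mult_mono[OF d(2) h(2)]) (use e in auto)
      qed
      finally show "norm ((\<Sum>i<n. f i x * ca i * fst h + f i x * cb i * snd h) - (ga x * fst h + gb x * snd h)) \<le> e * norm h"
        by simp
    qed
  qed
  then obtain g where g: "\<And>x. x \<in> S \<Longrightarrow> (\<lambda>i. f i x) sums g x"
    and gd: "\<And>x. x \<in> S \<Longrightarrow> (g has_derivative (\<lambda>h. ga x * fst h + gb x * snd h)) (at x within S)" by blast
  have geq: "g x = gsum a D (fst x) (snd x)" if "x \<in> S" for x
    using g[OF that] hs[OF that] sums_unique2 by blast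
  have "(g has_derivative (\<lambda>h. ga (\<tau>, z) * fst h + gb (\<tau>, z) * snd h)) (at (\<tau>, z))"
    using gd[OF inS] at_within_open[OF inS opS] by simp
  then have "((\<lambda>x. gsum a D (fst x) (snd x)) has_derivative (\<lambda>h. ga (\<tau>, z) * fst h + gb (\<tau>, z) * snd h)) (at (\<tau>, z))"
    by (rule has_derivative_transform_within_open[OF _ opS inS]) (rule geq)
  then show ?thesis using that[of "ga (\<tau>, z)" "gb (\<tau>, z)"] by (simp add: case_prod_unfold)
qed

section \<open>Product formulas for theta and eta\<close>

lemma kronecker_m4_le: "norm (kronecker_m4 n) \<le> 1"
  by (simp add: kronecker_m4_def)

lemma kronecker_m4_even: "even n \<Longrightarrow> kronecker_m4 n = 0"
  unfolding kronecker_m4_def by (auto; presburger)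

lemma kronecker_m4_minus: "kronecker_m4 (- n) = - kronecker_m4 n"
  unfolding kronecker_m4_def by (auto; presburger)

lemma minus_one_powi: "(- 1 :: 'a::field) powi m = (if even m then 1 else - 1)"
  by (cases "m \<ge> 0") (auto simp: power_int_def even_nat_iff)

lemma kronecker_m4_shift: "kronecker_m4 (n + 2 * a) = (- 1) powi a * kronecker_m4 n"
proof (cases "even a")
  case True
  then obtain b where "a = 2 * b" by (elim evenE)
  then show ?thesis by (simp add: kronecker_m4_def minus_one_powi)
next
  case False
  then obtain b where b: "a = 2 * b + 1" by (elim oddE)
  have "(n + 2 * a) mod 4 = (n + 2) mod 4" unfolding b by presburger
  then show ?thesis using False by (auto simp: kronecker_m4_def minus_one_powi; presburger)
qed

lemma theta_gsum: "theta = gsum kronecker_m4 8"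
  by (simp add: fun_eq_iff theta_def gsum_def gterm_def e2pi_def)

lemma theta_minus: "theta \<tau> (- z) = - theta \<tau> z"
proof -
  have "theta \<tau> (- z) = (\<Sum>\<^sub>\<infinity>n\<in>UNIV. gterm kronecker_m4 8 (- n) \<tau> (- z))"
    unfolding theta_gsum gsum_def by (rule infsum_reindex_bij_betw[symmetric]) (rule bij_uminus)
  also have "\<dots> = (\<Sum>\<^sub>\<infinity>n\<in>UNIV. - gterm kronecker_m4 8 n \<tau> z)"
    by (simp add: gterm_def kronecker_m4_minus)
  finally show ?thesis unfolding infsum_uminus theta_gsum gsum_def .
qed

lemma theta_0 [simp]: "theta \<tau> 0 = 0"
  using theta_minus[of \<tau> 0] by simp

lemma theta_elliptic:
  fixes a b :: int
  shows "theta \<tau> (z + of_int a * \<tau> + of_int b)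
       = (- 1) powi (a + b) * e2pi (- (of_int a ^ 2 / 2 * \<tau> + of_int a * z)) * theta \<tau> z"
proof -
  let ?C = "(- 1) powi (a + b) * e2pi (- (of_int a ^ 2 / 2 * \<tau> + of_int a * z))"
  have t: "gterm kronecker_m4 8 n \<tau> (z + of_int a * \<tau> + of_int b) = ?C * gterm kronecker_m4 8 (n + 2 * a) \<tau> z" for n
  proof (cases "even n")
    case True
    then show ?thesis by (simp add: gterm_def kronecker_m4_even)
  next
    case False
    then obtain m where m: "n = 2 * m + 1" by (elim oddE)
    have X: "of_int n ^ 2 / of_real 8 * \<tau> + of_int n / 2 * (z + of_int a * \<tau> + of_int b)
       = (- (of_int a ^ 2 / 2 * \<tau> + of_int a * z) + (of_int (n + 2 * a) ^ 2 / of_real 8 * \<tau> + of_int (n + 2 * a) / 2 * z))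
         + (of_int b / 2 + of_int (m * b))"
      by (simp add: m field_simps power2_eq_square)
    have h: "e2pi (of_int b / 2) = (- 1) powi b"
      using e2pi_powi[of "1/2" b] by (simp add: e2pi_half)
    have s: "(- 1 :: complex) powi (a + b) * (- 1) powi a = (- 1) powi b"
      by (auto simp: minus_one_powi)
    show ?thesis
      unfolding gterm_def X e2pi_add h kronecker_m4_shift e2pi_of_int s[symmetric] by simp
  qed
  have "theta \<tau> (z + of_int a * \<tau> + of_int b) = (\<Sum>\<^sub>\<infinity>n\<in>UNIV. ?C * gterm kronecker_m4 8 (n + 2 * a) \<tau> z)"
    unfolding theta_gsum gsum_def t ..
  also have "\<dots> = ?C * (\<Sum>\<^sub>\<infinity>n\<in>UNIV. gterm kronecker_m4 8 (n + 2 * a) \<tau> z)"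
    by (rule infsum_cmult_right')
  also have "(\<Sum>\<^sub>\<infinity>n\<in>UNIV. gterm kronecker_m4 8 (n + 2 * a) \<tau> z) = (\<Sum>\<^sub>\<infinity>n\<in>UNIV. gterm kronecker_m4 8 n \<tau> z)"
    by (rule infsum_reindex_bij_betw) (rule bij_plus_right)
  finally show ?thesis unfolding theta_gsum gsum_def .
qed

lemma theta_T: "theta (\<tau> + 1) z = e2pi (1 / 8) * theta \<tau> z"
proof -
  have t: "gterm kronecker_m4 8 n (\<tau> + 1) z = e2pi (1 / 8) * gterm kronecker_m4 8 n \<tau> z" for n
  proof (cases "even n")
    case True
    then show ?thesis by (simp add: gterm_def kronecker_m4_even)
  next
    case False
    then obtain m where m: "n = 2 * m + 1" by (elim oddE)
    have "even (m * (m + 1))" by simp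
    then obtain k where k: "m * (m + 1) = 2 * k" by (elim evenE)
    have "n ^ 2 = 1 + 8 * k" using k by (simp add: m power2_eq_square algebra_simps)
    then have n2: "(of_int n :: complex) ^ 2 = 1 + 8 * of_int k" by (metis of_int_1 of_int_add of_int_mult of_int_numeral of_int_power)
    have X: "of_int n ^ 2 / of_real 8 * (\<tau> + 1) + of_int n / 2 * z = 1 / 8 + (of_int n ^ 2 / of_real 8 * \<tau> + of_int n / 2 * z) + of_int k"
      by (simp add: n2 field_simps)
    show ?thesis unfolding gterm_def X e2pi_add e2pi_of_int by simp
  qed
  show ?thesis unfolding theta_gsum gsum_def t by (rule infsum_cmult_right')
qed

text \<open>
  The infinite \<open>q\<close>-Pochhammer symbol \<open>(w; x)\<^sub>\<infinity>\<close>.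
\<close>

definition qq :: "complex \<Rightarrow> complex \<Rightarrow> complex" where
  "qq x w = (\<Prod>n. 1 - w * x ^ n)"

lemma qq_Suc: "norm x < 1 \<Longrightarrow> qq x w = (1 - w) * qq x (w * x)"
proof (cases "w = 1")
  case False
  assume "norm x < 1"
  from convergent_prod_geometric_minus[OF this, of w] prodinf_split_head[of "\<lambda>n. 1 - w * x ^ n"] False
  have "(\<Prod>n. 1 - w * x ^ Suc n) = qq x w / (1 - w)"
    unfolding qq_def by simp
  then show ?thesis using False by (simp add: qq_def mult.assoc)
next
  case True
  assume x: "norm x < 1"
  have "(\<lambda>n. 1 - w * x ^ n) has_prod qq x w" unfolding qq_def
    using convergent_prod_geometric_minus[OF x, of w] by (rule convergent_prod_has_prod)
  then have "qq x w = 0" using has_prod_eq_0_iff[of "\<lambda>n. 1 - w * x ^ n" "qq x w"] True by (auto intro: image_eqI[of _ _ 0])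
  then show ?thesis using True by simp
qed

lemma norm_e2pi_less_1: "Im \<tau> > 0 \<Longrightarrow> norm (e2pi \<tau>) < 1"
  by (simp add: norm_e2pi)

lemma euler_fn_qq: "euler_fn x = qq x x"
  by (simp add: qq_def)

lemma theta_product_formula:
  fixes \<tau> z :: complex
  assumes \<tau>: "Im \<tau> > 0"
  defines "q \<equiv> e2pi \<tau>" and "w \<equiv> e2pi z"
  shows "theta \<tau> z = e2pi (\<tau> / 8 + z / 2) * (euler_fn q * (qq q (w * q) * qq q (1 / w)))"
proof -
  have q: "norm q < 1" "q \<noteq> 0" "w \<noteq> 0" using norm_e2pi_less_1[OF \<tau>] by (auto simp: q_def w_def)
  let ?C = "e2pi (\<tau> / 8 + z / 2)"
  have "((\<lambda>m::int. ?C * ((- w) powi m * q ^ nat (m * (m + 1) div 2))) has_sum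
     (?C * (euler_fn q * (qq q (w * q) * qq q (1 / w))))) UNIV"
    using has_sum_cmult_right[OF jacobi_triple_product[OF q], of ?C]
    by (simp add: qq_def mult.assoc)
  also have "(\<lambda>m::int. ?C * ((- w) powi m * q ^ nat (m * (m + 1) div 2)))
      = (\<lambda>m. gterm kronecker_m4 8 (2 * m + 1) \<tau> z)"
  proof
    fix m :: int
    have ev: "even (m * (m + 1))" by simp
    then obtain k where k: "m * (m + 1) = 2 * k" by (elim evenE)
    have "m * (m + 1) \<ge> 0" by (cases "m \<ge> 0") (auto intro: mult_nonpos_nonpos)
    then have k0: "k \<ge> 0" using k by simp
    have kr: "kronecker_m4 (2 * m + 1) = (- 1) powi m"
      using kronecker_m4_shift[of 1 m] by (simp add: kronecker_m4_def add.commute)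
    have "(2 * m + 1) ^ 2 = 1 + 8 * k" using k by (simp add: power2_eq_square algebra_simps)
    then have n2: "(of_int (2 * m + 1) :: complex) ^ 2 = 1 + 8 * of_int k" by (metis of_int_1 of_int_add of_int_mult of_int_numeral of_int_power)
    have "(- w) powi m = (- 1) powi m * w powi m"
      using power_int_mult_distrib[of "-1" w m] by simp
    then have "?C * ((- w) powi m * q ^ nat (m * (m + 1) div 2))
       = (- 1) powi m * e2pi (\<tau> / 8 + z / 2 + of_int m * z + of_nat (nat k) * \<tau>)"
      unfolding k w_def q_def by (simp add: e2pi_powi e2pi_power e2pi_add mult_ac)
    also have "\<tau> / 8 + z / 2 + of_int m * z + of_nat (nat k) * \<tau> = of_int (2 * m + 1) ^ 2 / of_real 8 * \<tau> + of_int (2 * m + 1) / 2 * z"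
      unfolding n2 using k0 by (simp add: field_simps)
    finally show "?C * ((- w) powi m * q ^ nat (m * (m + 1) div 2)) = gterm kronecker_m4 8 (2 * m + 1) \<tau> z"
      by (simp add: gterm_def kr)
  qed
  also have "(\<dots> has_sum (?C * (euler_fn q * (qq q (w * q) * qq q (1 / w))))) UNIV \<longleftrightarrow>
     ((\<lambda>n. gterm kronecker_m4 8 n \<tau> z) has_sum (?C * (euler_fn q * (qq q (w * q) * qq q (1 / w))))) (range (\<lambda>m. 2 * m + 1))"
    by (subst has_sum_reindex) (auto simp: inj_def o_def)
  also have "\<dots> \<longleftrightarrow> ((\<lambda>n. gterm kronecker_m4 8 n \<tau> z) has_sum (?C * (euler_fn q * (qq q (w * q) * qq q (1 / w))))) UNIV"
  proof (rule has_sum_cong_neutral)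
    fix n :: int assume "n \<in> UNIV - range (\<lambda>m. 2 * m + 1)"
    then have "even n" by (metis DiffD2 oddE rangeI)
    then show "gterm kronecker_m4 8 n \<tau> z = 0" by (simp add: gterm_def kronecker_m4_even)
  qed auto
  finally show ?thesis unfolding theta_gsum gsum_def by (rule infsumI)
qed

lemma theta_eq_0_iff:
  assumes \<tau>: "Im \<tau> > 0"
  shows "theta \<tau> z = 0 \<longleftrightarrow> (\<exists>a b :: int. z = of_int a * \<tau> + of_int b)"
proof
  assume "\<exists>a b :: int. z = of_int a * \<tau> + of_int b"
  then obtain a b :: int where "z = 0 + of_int a * \<tau> + of_int b" by auto
  then show "theta \<tau> z = 0" by (simp only: theta_elliptic) simp
next
  assume 0: "theta \<tau> z = 0"
  let ?q = "e2pi \<tau>"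
  have q: "norm ?q < 1" by (rule norm_e2pi_less_1[OF \<tau>])
  have "qq ?q (e2pi z * ?q) = 0 \<or> qq ?q (1 / e2pi z) = 0"
    using 0 euler_fn_nonzero[OF q] unfolding theta_product_formula[OF \<tau>] by auto
  then obtain w n where w: "w = e2pi z * ?q \<or> w = 1 / e2pi z" and n: "1 - w * ?q ^ n = 0"
    using prodinf_nonzero convergent_prod_geometric_minus[OF q] unfolding qq_def by metis
  obtain X where X: "e2pi X = 1" and zX: "\<exists>k::int. z = X + of_int k * \<tau> \<or> z = - X + of_int k * \<tau>"
  proof (cases "w = e2pi z * ?q")
    case True
    then have "e2pi (z + of_nat (Suc n) * \<tau>) = 1" using n by (simp add: e2pi_add e2pi_power ring_distribs mult.assoc)
    moreover have "z = (z + of_nat (Suc n) * \<tau>) + of_int (- int (Suc n)) * \<tau>" by (simp add: algebra_simps)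
    ultimately show ?thesis using that by blast
  next
    case False
    then have "w = e2pi (- z)" using w by (simp add: e2pi_minus inverse_eq_divide)
    then have "e2pi (- z + of_nat n * \<tau>) = 1" using n unfolding e2pi_add e2pi_power by simp
    moreover have "z = - (- z + of_nat n * \<tau>) + of_int (int n) * \<tau>" by (simp add: algebra_simps)
    ultimately show ?thesis using that by blast
  qed
  from X obtain j where j: "X = of_int j" by (auto simp: e2pi_eq_1_iff elim: Ints_cases)
  from zX obtain k where "z = X + of_int k * \<tau> \<or> z = - X + of_int k * \<tau>" by blast
  then show "\<exists>a b :: int. z = of_int a * \<tau> + of_int b"
  proof
    assume "z = X + of_int k * \<tau>" then show ?thesis using j by (intro exI[of _ k] exI[of _ j]) simp
  next
    assume "z = - X + of_int k * \<tau>" then show ?thesis using j by (intro exI[of _ k] exI[of _ "- j"]) simp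
  qed
qed

lemma eta_eq: "eta \<tau> = e2pi (\<tau> / 24) * euler_fn (e2pi \<tau>)"
  unfolding eta_def e2pi_def exp_of_nat_mult[symmetric] by (simp add: mult_ac)

lemma eta_nonzero: "Im \<tau> > 0 \<Longrightarrow> eta \<tau> \<noteq> 0"
  using euler_fn_nonzero[OF norm_e2pi_less_1] by (auto simp: eta_eq)

lemma eta_T: "eta (\<tau> + 1) = e2pi (1 / 24) * eta \<tau>"
proof -
  have "e2pi (\<tau> + 1) = e2pi \<tau>" using e2pi_of_int[of 1] by (simp add: e2pi_add)
  moreover have "(\<tau> + 1) / 24 = 1 / 24 + \<tau> / 24" by (simp add: field_simps)
  ultimately show ?thesis unfolding eta_eq by (simp only: e2pi_add mult.assoc)
qed

text \<open>
  An infinite product may be split according to the residue of the index modulo \<open>k\<close>.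
\<close>

lemma prodinf_group:
  fixes f :: "nat \<Rightarrow> complex"
  assumes f: "convergent_prod f" and g: "\<And>i. i < k \<Longrightarrow> convergent_prod (\<lambda>n. f (n * k + i))" and k: "k > 0"
  shows "prodinf f = (\<Prod>i<k. \<Prod>n. f (n * k + i))"
proof -
  have L: "(\<lambda>N. \<Prod>n<N. h n) \<longlonglongrightarrow> prodinf h" if "convergent_prod h" for h :: "nat \<Rightarrow> complex"
    using convergent_prod_LIMSEQ[OF that] by (simp add: LIMSEQ_lessThan_iff_atMost)
  have "strict_mono (\<lambda>N. N * k)" using k by (simp add: strict_mono_def)
  from LIMSEQ_subseq_LIMSEQ[OF L[OF f] this] have "(\<lambda>N. \<Prod>n<N * k. f n) \<longlonglongrightarrow> prodinf f"
    by (simp add: o_def)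
  moreover have "(\<Prod>n<N * k. f n) = (\<Prod>i<k. \<Prod>n<N. f (n * k + i))" for N
  proof -
    have "(\<Prod>n<N * k. f n) = (\<Prod>n<N. \<Prod>m\<in>{n * k..<n * k + k}. f m)" by (rule prod.nat_group[symmetric])
    also have "\<dots> = (\<Prod>n<N. \<Prod>i<k. f (n * k + i))"
    proof (rule prod.cong)
      fix n
      show "(\<Prod>m\<in>{n * k..<n * k + k}. f m) = (\<Prod>i<k. f (n * k + i))"
        by (rule prod.reindex_bij_witness[of _ "\<lambda>i. n * k + i" "\<lambda>m. m - n * k"]) auto
    qed simp
    finally show ?thesis by (subst prod.swap)
  qed
  moreover have "(\<lambda>N. \<Prod>i<k. \<Prod>n<N. f (n * k + i)) \<longlonglongrightarrow> (\<Prod>i<k. \<Prod>n. f (n * k + i))"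
    by (intro tendsto_prod L g) auto
  ultimately show ?thesis using LIMSEQ_unique by simp
qed

lemma qq_group:
  assumes x: "norm x < 1" and k: "k > 0"
  shows "qq x w = (\<Prod>i<k. qq (x ^ k) (w * x ^ i))"
proof -
  have xk: "norm (x ^ k) < 1" using x k by (simp add: norm_power power_less_one_iff)
  have e: "(\<lambda>n. 1 - w * x ^ (n * k + i)) = (\<lambda>n. 1 - (w * x ^ i) * (x ^ k) ^ n)" for i
    by (auto simp: power_add power_mult mult_ac simp flip: power_mult)
  show ?thesis unfolding qq_def
    by (subst prodinf_group[where k = k])
       (use k in \<open>auto simp only: e intro!: convergent_prod_geometric_minus[OF x] convergent_prod_geometric_minus[OF xk]\<close>)
qed

text \<open>
  The triple product with \<open>x = q\<^sup>3\<close> and \<open>w = 1 / q\<close>: its three products collect the exponents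
  divisible by \<open>3\<close>, and those congruent to \<open>2\<close> and to \<open>1\<close> modulo \<open>3\<close>.
\<close>

lemma pentagonal_number_theorem:
  assumes \<tau>: "Im \<tau> > 0"
  shows "((\<lambda>n::int. (- 1) powi n * e2pi (of_int (6 * n + 1) ^ 2 / 24 * \<tau>)) has_sum eta \<tau>) UNIV"
proof -
  let ?q = "e2pi \<tau>"
  have q: "norm ?q < 1" by (rule norm_e2pi_less_1[OF \<tau>])
  have q3: "norm (?q ^ 3) < 1" using q by (simp add: norm_power power_less_one_iff)
  have "euler_fn (?q ^ 3) * ((\<Prod>n. 1 - (1 / ?q) * (?q ^ 3) ^ Suc n) * (\<Prod>n. 1 - (?q ^ 3) ^ n / (1 / ?q))) = euler_fn ?q"
  proof -
    have "euler_fn ?q = (\<Prod>i<3. qq (?q ^ 3) (?q * ?q ^ i))"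
      unfolding euler_fn_qq by (rule qq_group[OF q]) simp
    also have "\<dots> = qq (?q ^ 3) ?q * qq (?q ^ 3) (?q ^ 2) * qq (?q ^ 3) (?q ^ 3)"
      by (simp add: numeral_3_eq_3 power2_eq_square)
    also have "qq (?q ^ 3) (?q ^ 3) = euler_fn (?q ^ 3)" by (rule euler_fn_qq[symmetric])
    also have "qq (?q ^ 3) ?q = (\<Prod>n. 1 - (?q ^ 3) ^ n / (1 / ?q))" by (simp add: qq_def mult.commute)
    also have "qq (?q ^ 3) (?q ^ 2) = (\<Prod>n. 1 - (1 / ?q) * (?q ^ 3) ^ Suc n)"
      by (simp add: qq_def power3_eq_cube power2_eq_square mult.assoc)
    finally show ?thesis by (simp only: mult_ac)
  qed
  with jacobi_triple_product[OF q3, of "1 / ?q"]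
  have "((\<lambda>m::int. (- (1 / ?q)) powi m * (?q ^ 3) ^ nat (m * (m + 1) div 2)) has_sum euler_fn ?q) UNIV"
    by simp
  from has_sum_cmult_right[OF this, of "e2pi (\<tau> / 24)"]
  have "((\<lambda>m::int. e2pi (\<tau> / 24) * ((- (1 / ?q)) powi m * (?q ^ 3) ^ nat (m * (m + 1) div 2))) has_sum eta \<tau>) UNIV"
    by (simp add: eta_eq)
  also have "(\<lambda>m::int. e2pi (\<tau> / 24) * ((- (1 / ?q)) powi m * (?q ^ 3) ^ nat (m * (m + 1) div 2)))
      = (\<lambda>n::int. (- 1) powi n * e2pi (of_int (6 * n + 1) ^ 2 / 24 * \<tau>))"
  proof
    fix m :: int
    have ev: "even (m * (m + 1))" by simp
    then obtain k where k: "m * (m + 1) = 2 * k" by (elim evenE)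
    have "m * (m + 1) \<ge> 0" by (cases "m \<ge> 0") (auto intro: mult_nonpos_nonpos)
    then have k0: "k \<ge> 0" using k by simp
    have "(6 * m + 1) ^ 2 = 1 - 24 * m + 72 * k" using k by (simp add: power2_eq_square algebra_simps)
    then have n2: "(of_int (6 * m + 1) :: complex) ^ 2 = of_int (1 - 24 * m + 72 * k)" by (metis of_int_power)
    have "(- (1 / ?q)) powi m = (- 1) powi m * e2pi (- \<tau>) powi m"
      using power_int_mult_distrib[of "-1" "e2pi (- \<tau>)" m] by (simp add: e2pi_minus field_simps)
    then have "e2pi (\<tau> / 24) * ((- (1 / ?q)) powi m * (?q ^ 3) ^ nat (m * (m + 1) div 2))
       = (- 1) powi m * e2pi (\<tau> / 24 + of_int m * (- \<tau>) + of_nat (3 * nat k) * \<tau>)"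
      unfolding k by (simp only: e2pi_powi e2pi_power e2pi_add power_mult[symmetric]) (simp add: mult_ac)
    also have "\<tau> / 24 + of_int m * (- \<tau>) + of_nat (3 * nat k) * \<tau> = of_int (6 * m + 1) ^ 2 / 24 * \<tau>"
      unfolding n2 using k0 by (simp add: field_simps)
    finally show "e2pi (\<tau> / 24) * ((- (1 / ?q)) powi m * (?q ^ 3) ^ nat (m * (m + 1) div 2))
       = (- 1) powi m * e2pi (of_int (6 * m + 1) ^ 2 / 24 * \<tau>)" .
  qed
  finally show ?thesis .
qed

section \<open>Theta and eta under inversion\<close>

lemma gsum_holomorphic:
  assumes "\<And>n. norm (a n) \<le> 1" "D > 0" "Im \<tau> > 0"
  shows "gsum a D \<tau> holomorphic_on A"
proof -
  have "gsum a D \<tau> field_differentiable (at z)" for z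
  proof -
    obtain A B where AB: "((\<lambda>(t, w). gsum a D t w) has_derivative (\<lambda>(h, k). A * h + B * k)) (at (\<tau>, z))"
      using gsum_has_derivative[of a D \<tau> z] assms by blast
    have "((\<lambda>w. (\<tau>, w)) has_derivative (\<lambda>k. (0, k))) (at z)"
      by (intro derivative_intros)
    from has_derivative_compose[OF this AB] have "(gsum a D \<tau> has_derivative (\<lambda>k. B * k)) (at z)"
      by simp
    then have "(gsum a D \<tau> has_field_derivative B) (at z)"
      by (simp add: has_field_derivative_def)
    then show ?thesis by (auto simp: field_differentiable_def)
  qed
  then show ?thesis by (auto simp: holomorphic_on_def intro: field_differentiable_at_within)
qed

lemma theta_holomorphic: "Im \<tau> > 0 \<Longrightarrow> theta \<tau> holomorphic_on A"
  unfolding theta_gsum by (rule gsum_holomorphic) (auto simp: kronecker_m4_le)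

lemma qq_continuous:
  assumes x: "norm x < 1"
  shows "isCont (qq x) w"
proof -
  define R where "R = norm w + 1"
  have uc: "uniformly_convergent_on (cball 0 R) (\<lambda>N w. \<Prod>n<N. 1 - w * x ^ n)"
  proof (rule uniformly_convergent_on_prod')
    show "uniformly_convergent_on (cball 0 R) (\<lambda>N w. \<Sum>n<N. norm (1 - w * x ^ n - 1))"
    proof (rule Weierstrass_m_test')
      show "norm (norm (1 - w * x ^ n - 1)) \<le> R * norm x ^ n" if "w \<in> cball 0 R" for n w
        using that by (auto simp: norm_mult norm_power intro!: mult_right_mono)
      show "summable (\<lambda>n. R * norm x ^ n)" using x by (intro summable_mult summable_geometric) auto
    qed
  qed (auto intro!: continuous_intros)
  then have "uniform_limit (cball 0 R) (\<lambda>N w. \<Prod>n<N. 1 - w * x ^ n) (\<lambda>w. lim (\<lambda>N. \<Prod>n<N. 1 - w * x ^ n)) sequentially"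
    by (simp add: uniformly_convergent_uniform_limit_iff)
  moreover have "lim (\<lambda>N. \<Prod>n<N. 1 - w * x ^ n) = qq x w" for w
    unfolding qq_def
    using convergent_prod_LIMSEQ[OF convergent_prod_geometric_minus[OF x, of w]]
    by (intro limI) (simp add: LIMSEQ_lessThan_iff_atMost)
  ultimately have "uniform_limit (cball 0 R) (\<lambda>N w. \<Prod>n<N. 1 - w * x ^ n) (qq x) sequentially" by simp
  then have "continuous_on (cball 0 R) (qq x)"
    by (rule uniform_limit_theorem[rotated]) (auto intro!: always_eventually continuous_intros)
  then show ?thesis by (rule continuous_on_interior) (simp add: R_def)
qed

text \<open>
  Jacobi's derivative formula: the product formula is \<open>2 \<i> sin (\<pi> z)\<close> times a function that is
  continuous at \<open>0\<close> with value \<open>\<eta>\<^sup>3\<close>.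
\<close>

lemma theta_deriv_0:
  assumes \<tau>: "Im \<tau> > 0"
  shows "(theta \<tau> has_field_derivative (2 * of_real pi * \<i> * eta \<tau> ^ 3)) (at 0)"
proof -
  let ?q = "e2pi \<tau>"
  have q: "norm ?q < 1" by (rule norm_e2pi_less_1[OF \<tau>])
  define g where "g = (\<lambda>z. e2pi (\<tau> / 8) * euler_fn ?q * (qq ?q (e2pi z * ?q) * qq ?q (e2pi (- z) * ?q)))"
  define s where "s = (\<lambda>z. e2pi (z / 2) - e2pi (- z / 2))"
  have th: "theta \<tau> z = s z * g z" for z
  proof -
    have "e2pi (z / 2) * (1 - e2pi (- z)) = s z"
      unfolding s_def right_diff_distrib by (simp add: e2pi_add[symmetric])
    then show ?thesis
      unfolding theta_product_formula[OF \<tau>] g_def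
      using qq_Suc[OF q, of "e2pi (- z)"] by (simp add: e2pi_add e2pi_minus inverse_eq_divide mult_ac)
  qed
  have e: "(e2pi has_field_derivative 2 * of_real pi * \<i> * e2pi z) (at z)" for z
    unfolding e2pi_def by (auto intro!: derivative_eq_intros)
  have ds: "(s has_field_derivative 2 * of_real pi * \<i>) (at 0)"
    unfolding s_def by (auto intro!: derivative_eq_intros DERIV_chain2[OF e])
  have ce: "isCont e2pi z" for z using e DERIV_isCont by blast
  have cg: "isCont g 0" unfolding g_def
    by (intro continuous_intros isCont_o2[OF _ qq_continuous[OF q]] isCont_o2[OF _ ce])
  have g0: "g 0 = eta \<tau> ^ 3"
  proof -
    have "e2pi (\<tau> / 24) ^ 3 = e2pi (\<tau> / 8)" by (simp add: e2pi_power)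
    then show ?thesis unfolding g_def eta_eq power_mult_distrib euler_fn_qq by (simp add: power3_eq_cube)
  qed
  have "((\<lambda>h. (s (0 + h) - s 0) / h * g h) \<longlongrightarrow> 2 * of_real pi * \<i> * g 0) (at 0)"
    using ds cg unfolding DERIV_def isCont_def by (intro tendsto_mult) auto
  then show ?thesis unfolding DERIV_def g0 by (simp add: th s_def)
qed

text \<open>
  The function \<open>f\<close> below has the same quasi-periods as \<open>\<vartheta>(\<tau>, \<cdot>)\<close> and vanishes at its zeros, which
  are simple. Hence the quotient extends to an entire doubly periodic function, which is constant by
  Liouville's theorem.
\<close>

lemma theta_S_exists:
  assumes \<tau>: "Im \<tau> > 0"
  shows "\<exists>c. \<forall>z. theta (- 1 / \<tau>) (z / \<tau>) = c * e2pi (z ^ 2 / (2 * \<tau>)) * theta \<tau> z"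
proof -
  let ?t = "- 1 / \<tau>"
  have t0: "\<tau> \<noteq> 0" using \<tau> by auto
  have \<tau>': "Im ?t > 0" using \<tau> by (simp add: Im_divide power2_eq_square[symmetric] add_pos_nonneg add_nonneg_pos divide_pos_pos)
  define f where "f = (\<lambda>z. theta ?t (z / \<tau>) * e2pi (- (z ^ 2 / (2 * \<tau>))))"
  have "(\<lambda>z. theta ?t (z / \<tau>)) holomorphic_on UNIV"
  proof -
    have "(\<lambda>z. z / \<tau>) holomorphic_on UNIV" using t0 by (intro holomorphic_intros) auto
    from holomorphic_on_compose[OF this theta_holomorphic[OF \<tau>']] show ?thesis by (simp add: o_def)
  qed
  then have "f holomorphic_on UNIV"
    unfolding f_def e2pi_def by (rule holomorphic_on_mult) (auto intro!: holomorphic_intros simp: t0)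
  then have hf: "f holomorphic_on A" for A by (rule holomorphic_on_subset) simp
  note ht = theta_holomorphic[OF \<tau>]
  have qf: "f (z + of_int a * \<tau> + of_int b) = (- 1) powi (a + b) * e2pi (- (of_int a ^ 2 / 2 * \<tau> + of_int a * z)) * f z" for z a b
  proof -
    have 1: "(z + of_int a * \<tau> + of_int b) / \<tau> = z / \<tau> + of_int (- b) * ?t + of_int a"
      using t0 by (simp add: field_simps)
    have ex: "- (of_int (- b) ^ 2 / 2 * ?t + of_int (- b) * (z / \<tau>)) + - ((z + of_int a * \<tau> + of_int b) ^ 2 / (2 * \<tau>))
        = - (of_int a ^ 2 / 2 * \<tau> + of_int a * z) + - (z ^ 2 / (2 * \<tau>)) + of_int (- (a * b))"
      using t0 by (simp add: field_simps power2_eq_square)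
    have "f (z + of_int a * \<tau> + of_int b) = (- 1) powi (- b + a) * theta ?t (z / \<tau>)
        * e2pi (- (of_int (- b) ^ 2 / 2 * ?t + of_int (- b) * (z / \<tau>)) + - ((z + of_int a * \<tau> + of_int b) ^ 2 / (2 * \<tau>)))"
      unfolding f_def 1 theta_elliptic e2pi_add by (simp only: mult_ac)
    also have "\<dots> = (- 1) powi (a + b) * e2pi (- (of_int a ^ 2 / 2 * \<tau> + of_int a * z)) * f z"
      unfolding ex e2pi_add[of _ "of_int (- (a * b))"] e2pi_of_int e2pi_add[of _ "- (z ^ 2 / (2 * \<tau>))"] f_def
      by (simp add: minus_one_powi mult_ac)
    finally show ?thesis .
  qed
  have f0: "f 0 = 0" by (simp add: f_def)
  obtain L' where L': "(f has_field_derivative L') (at 0)"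
    using hf[of UNIV] by (auto simp: holomorphic_on_def field_differentiable_def)
  define K where "K = 2 * of_real pi * \<i> * eta \<tau> ^ 3"
  have K: "(theta \<tau> has_field_derivative K) (at 0)" "K \<noteq> 0"
    using theta_deriv_0[OF \<tau>] eta_nonzero[OF \<tau>] by (auto simp: K_def)
  \<comment> \<open>The zeros of the denominator form one orbit under the periods, so the value of the quotient at \<open>0\<close>
    serves for all of them.\<close>
  define G where "G = (\<lambda>z. if theta \<tau> z = 0 then L' / K else f z / theta \<tau> z)"
  have per: "G (z + of_int a * \<tau> + of_int b) = G z" for z a b
    unfolding G_def qf theta_elliptic by (simp add: minus_one_powi)
  have lf: "((\<lambda>z. f z / z) \<longlongrightarrow> L') (at 0)" using L' f0 by (simp add: DERIV_def)
  have lt: "((\<lambda>z. theta \<tau> z / z) \<longlongrightarrow> K) (at 0)" using K by (simp add: DERIV_def)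
  have nz: "eventually (\<lambda>z. theta \<tau> z / z \<noteq> 0) (at 0)"
    by (rule tendsto_imp_eventually_ne[OF lt K(2)])
  then obtain r where r: "r > 0" "\<And>z. z \<noteq> 0 \<Longrightarrow> dist z 0 < r \<Longrightarrow> theta \<tau> z / z \<noteq> 0"
    unfolding eventually_at by blast
  have G_lim: "(G \<longlongrightarrow> G 0) (at 0)"
  proof -
    have "((\<lambda>z. (f z / z) / (theta \<tau> z / z)) \<longlongrightarrow> L' / K) (at 0)" by (intro tendsto_divide lf lt K)
    then have "((\<lambda>z. (f z / z) / (theta \<tau> z / z)) \<longlongrightarrow> G 0) (at 0)" by (simp add: G_def)
    then show ?thesis
    proof (rule Lim_transform_eventually)
      show "eventually (\<lambda>z. (f z / z) / (theta \<tau> z / z) = G z) (at 0)"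
        using nz by eventually_elim (auto simp: G_def)
    qed
  qed
  have "(\<lambda>z. f z / theta \<tau> z) holomorphic_on (ball 0 r - {0})"
    using r(2) by (intro holomorphic_on_divide hf ht) (auto simp: dist_commute)
  then have "G holomorphic_on (ball 0 r - {0})"
    by (rule holomorphic_transform) (use r(2) in \<open>auto simp: G_def dist_commute\<close>)
  then have G0: "G holomorphic_on (ball 0 r)"
    by (rule no_isolated_singularity'[rotated, of _ _ "{0}"]) (use G_lim in \<open>auto intro: Lim_at_imp_Lim_at_within\<close>)
  have Gdiff: "G field_differentiable (at z)" for z
  proof (cases "theta \<tau> z = 0")
    case False
    have op: "open {z. theta \<tau> z \<noteq> 0}"
      using holomorphic_on_imp_continuous_on[OF ht[of UNIV]]
      by (auto intro: open_Collect_neq continuous_on_const)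
    have "(\<lambda>z. f z / theta \<tau> z) holomorphic_on {z. theta \<tau> z \<noteq> 0}"
      by (intro holomorphic_on_divide hf ht) auto
    then have "G holomorphic_on {z. theta \<tau> z \<noteq> 0}"
      by (rule holomorphic_transform) (auto simp: G_def)
    then show ?thesis using op False by (auto intro: holomorphic_on_imp_differentiable_at)
  next
    case True
    then obtain a b where z: "z = of_int a * \<tau> + of_int b" using theta_eq_0_iff[OF \<tau>] by blast
    have "G = (\<lambda>w. G (w - z))"
    proof
      fix w show "G w = G (w - z)" using per[of "w - z" a b] by (simp add: z algebra_simps)
    qed
    moreover have "(\<lambda>w. G (w - z)) field_differentiable (at z)"
    proof -
      have "G field_differentiable (at 0)" using G0 r(1) by (auto intro: holomorphic_on_imp_differentiable_at)
      then have "G field_differentiable (at (z - z))" by simp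
      then obtain d where "(G has_field_derivative d) (at (z - z))" by (auto simp: field_differentiable_def)
      then have "((\<lambda>w. G (w - z)) has_field_derivative d * 1) (at z)"
        by (rule DERIV_chain2) (auto intro!: derivative_eq_intros)
      then show ?thesis by (auto simp: field_differentiable_def)
    qed
    ultimately show ?thesis by simp
  qed
  then have hG: "G holomorphic_on UNIV" by (simp add: holomorphic_on_def)
  have "bounded (range G)"
  proof -
    let ?P = "\<lambda>(s, t). of_real s * \<tau> + of_real t"
    have "compact (?P ` ({0..1} \<times> {0..1}))"
      by (intro compact_continuous_image compact_Times compact_Icc) (auto simp: case_prod_unfold intro!: continuous_intros)
    then have "compact (G ` ?P ` ({0..1} \<times> {0..1}))"
      by (rule compact_continuous_image[rotated])
        (rule holomorphic_on_imp_continuous_on[OF holomorphic_on_subset[OF hG subset_UNIV]])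
    then have "bounded (G ` ?P ` ({0..1} \<times> {0..1}))" by (rule compact_imp_bounded)
    moreover have "range G \<subseteq> G ` ?P ` ({0..1} \<times> {0..1})"
    proof clarify
      fix z
      define s where "s = Im z / Im \<tau>"
      define t where "t = Re z - s * Re \<tau>"
      have z: "z = of_real s * \<tau> + of_real t"
        using \<tau> by (simp add: complex_eq_iff s_def t_def)
      have z2: "z = (of_real (frac s) * \<tau> + of_real (frac t)) + of_int \<lfloor>s\<rfloor> * \<tau> + of_int \<lfloor>t\<rfloor>"
        unfolding z frac_def by (simp add: algebra_simps)
      have "G z = G (?P (frac s, frac t))" unfolding case_prod_conv by (subst z2) (rule per)
      moreover have "(frac s, frac t) \<in> {0..1} \<times> {0..1}"
        using frac_lt_1[of s] frac_lt_1[of t] by (auto intro: less_imp_le)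
      then have "G (?P (frac s, frac t)) \<in> G ` ?P ` ({0..1} \<times> {0..1})" by (intro imageI)
      ultimately show "G z \<in> G ` ?P ` ({0..1} \<times> {0..1})" by (simp only:)
    qed
    ultimately show ?thesis by (rule bounded_subset)
  qed
  then have "G constant_on UNIV" by (rule Liouville_theorem[OF hG])
  then obtain c where c: "\<And>z. G z = c" by (auto simp: constant_on_def)
  have fc: "f z = c * theta \<tau> z" for z
  proof (cases "theta \<tau> z = 0")
    case False then show ?thesis using c[of z] by (simp add: G_def field_simps)
  next
    case True
    then obtain a b where z: "z = 0 + of_int a * \<tau> + of_int b" using theta_eq_0_iff[OF \<tau>] by auto
    show ?thesis unfolding z qf theta_elliptic f0 by simp
  qed
  have "theta ?t (z / \<tau>) = c * e2pi (z ^ 2 / (2 * \<tau>)) * theta \<tau> z" for z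
    using fc[of z] unfolding f_def e2pi_minus by (simp add: field_simps)
  then show ?thesis by blast
qed

text \<open>
  The reason is Euler's identity \<open>\<Prod>(1 + q\<^sup>n) (1 - q\<^bsup>2n-1\<^esup>) = 1\<close>, which is the fact \<open>X\<close> in the proof,
  with \<open>1 - q\<^bsup>2n-1\<^esup>\<close> factored by means of \<open>p = q\<^bsup>1/2\<^esup>\<close>.
\<close>

lemma theta_half_periods:
  assumes \<tau>: "Im \<tau> > 0"
  shows "e2pi (\<tau> / 4) * theta \<tau> (1 / 2) * theta \<tau> (\<tau> / 2) * theta \<tau> (\<tau> / 2 + 1 / 2) = 2 * eta \<tau> ^ 3"
proof -
  let ?q = "e2pi \<tau>" and ?p = "e2pi (\<tau> / 2)" and ?E = "euler_fn (e2pi \<tau>)"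
  have q: "norm ?q < 1" by (rule norm_e2pi_less_1[OF \<tau>])
  have p: "norm ?p < 1" using \<tau> by (simp add: norm_e2pi)
  have pp: "?q = ?p * ?p" by (simp add: e2pi_add[symmetric])
  have q2: "norm (?q ^ 2) < 1" using q by (simp add: norm_power power_less_one_iff)
  have p1: "?p \<noteq> 1" "?p \<noteq> - 1" using p by auto
  have X: "qq ?q (- ?q) * (qq ?q ?p * qq ?q (- ?p)) = 1"
  proof -
    have q0: "convergent_prod (\<lambda>n. 1 - a * ?q ^ n)" for a by (rule convergent_prod_geometric_minus[OF q])
    have "qq ?q ?p * qq ?q (- ?p) = (\<Prod>n. (1 - ?p * ?q ^ n) * (1 - (- ?p) * ?q ^ n))"
      unfolding qq_def by (rule prodinf_mult[OF q0 q0])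
    also have "(\<lambda>n. (1 - ?p * ?q ^ n) * (1 - (- ?p) * ?q ^ n)) = (\<lambda>n. 1 - ?q * (?q ^ 2) ^ n)"
      unfolding pp by (simp add: fun_eq_iff algebra_simps power_mult_distrib power2_eq_square)
    finally have 1: "qq ?q ?p * qq ?q (- ?p) = qq (?q ^ 2) ?q" by (simp add: qq_def)
    have "qq ?q ?q * qq ?q (- ?q) = (\<Prod>n. (1 - ?q * ?q ^ n) * (1 - (- ?q) * ?q ^ n))"
      unfolding qq_def by (rule prodinf_mult[OF q0 q0])
    also have "(\<lambda>n. (1 - ?q * ?q ^ n) * (1 - (- ?q) * ?q ^ n)) = (\<lambda>n. 1 - ?q ^ 2 * (?q ^ 2) ^ n)"
      by (simp add: fun_eq_iff algebra_simps power_mult_distrib power2_eq_square)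
    finally have 2: "qq ?q ?q * qq ?q (- ?q) = qq (?q ^ 2) (?q ^ 2)" by (simp add: qq_def)
    have "qq ?q ?q = qq (?q ^ 2) ?q * qq (?q ^ 2) (?q ^ 2)"
      using qq_group[OF q, of 2 ?q] by (simp add: numeral_2_eq_2)
    then have "?E = (qq ?q ?p * qq ?q (- ?p)) * (?E * qq ?q (- ?q))"
      unfolding euler_fn_qq 1 2 .
    then show ?thesis using euler_fn_nonzero[OF q] by (simp add: mult_ac)
  qed
  have h1: "theta \<tau> (1 / 2) = e2pi (\<tau> / 8 + 1 / 4) * (?E * (2 * qq ?q (- ?q) ^ 2))"
    unfolding theta_product_formula[OF \<tau>] e2pi_half using qq_Suc[OF q, of "- 1"]
    by (simp add: power2_eq_square)
  have aux: "qq ?q (w * ?q) * qq ?q (1 / w) = - (1 / w) * qq ?q w ^ 2" if w: "w \<noteq> 1" "w \<noteq> 0" "?q = w * w" for w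
  proof -
    have "qq ?q w = (1 - w) * qq ?q (w * ?q)" by (rule qq_Suc[OF q])
    then have 1: "qq ?q (w * ?q) = qq ?q w / (1 - w)" using w by simp
    have "(1 / w) * ?q = w" using w by simp
    then have 2: "qq ?q (1 / w) = (1 - 1 / w) * qq ?q w" using qq_Suc[OF q, of "1 / w"] by simp
    have "(1 - 1 / w) / (1 - w) = - (1 / w)" using w by (simp add: field_simps)
    then show ?thesis unfolding 1 2 by (metis (no_types, opaque_lifting) mult.commute mult.left_commute power2_eq_square times_divide_eq_left)
  qed
  have h2: "theta \<tau> (\<tau> / 2) = - e2pi (- \<tau> / 8) * (?E * qq ?q ?p ^ 2)"
  proof -
    have e: "e2pi (\<tau> / 8 + \<tau> / 2 / 2) * (1 / ?p) = e2pi (- \<tau> / 8)"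
      unfolding e2pi_diff[symmetric] by (simp add: e2pi_diff[symmetric])
    show ?thesis
      unfolding theta_product_formula[OF \<tau>] aux[OF p1(1) e2pi_nonzero pp] e[symmetric] by simp
  qed
  have h3: "theta \<tau> (\<tau> / 2 + 1 / 2) = e2pi (- \<tau> / 8 + 1 / 4) * (?E * qq ?q (- ?p) ^ 2)"
  proof -
    have w: "e2pi (\<tau> / 2 + 1 / 2) = - ?p" by (simp add: e2pi_add e2pi_half)
    have "- ?p \<noteq> 1" using p1 by (metis add.inverse_inverse)
    note a = aux[OF this, unfolded neg_equal_0_iff_equal minus_mult_minus, OF e2pi_nonzero pp]
    have "e2pi (\<tau> / 8 + (\<tau> / 2 + 1 / 2) / 2) * (1 / ?p) = e2pi (\<tau> / 8 + (\<tau> / 2 + 1 / 2) / 2 - \<tau> / 2)"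
      unfolding e2pi_diff[of "\<tau> / 8 + (\<tau> / 2 + 1 / 2) / 2" "\<tau> / 2"] by (simp only: times_divide_eq_right mult_1_right)
    also have "\<tau> / 8 + (\<tau> / 2 + 1 / 2) / 2 - \<tau> / 2 = - \<tau> / 8 + 1 / 4" by (simp add: field_simps)
    finally have e: "e2pi (\<tau> / 8 + (\<tau> / 2 + 1 / 2) / 2) * (1 / ?p) = e2pi (- \<tau> / 8 + 1 / 4)" .
    show ?thesis
      unfolding theta_product_formula[OF \<tau>] w a e[symmetric] by simp
  qed
  have "e2pi (\<tau> / 4) * theta \<tau> (1 / 2) * theta \<tau> (\<tau> / 2) * theta \<tau> (\<tau> / 2 + 1 / 2)
     = - 2 * (e2pi (\<tau> / 4) * e2pi (\<tau> / 8 + 1 / 4) * e2pi (- \<tau> / 8) * e2pi (- \<tau> / 8 + 1 / 4)) * ?E ^ 3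
       * (qq ?q (- ?q) * (qq ?q ?p * qq ?q (- ?p))) ^ 2"
    unfolding h1 h2 h3 by (simp add: power2_eq_square power3_eq_cube)
  also have "e2pi (\<tau> / 4) * e2pi (\<tau> / 8 + 1 / 4) * e2pi (- \<tau> / 8) * e2pi (- \<tau> / 8 + 1 / 4) = e2pi (\<tau> / 8 + 1 / 2)"
  proof -
    have "\<tau> / 4 + (\<tau> / 8 + 1 / 4) + - \<tau> / 8 + (- \<tau> / 8 + 1 / 4) = \<tau> / 8 + 1 / 2" by (simp add: field_simps)
    then show ?thesis by (simp only: e2pi_add[symmetric])
  qed
  also have "\<dots> = - e2pi (\<tau> / 8)" by (simp add: e2pi_add e2pi_half)
  also have "e2pi (\<tau> / 8) = e2pi (\<tau> / 24) ^ 3" by (simp add: e2pi_power)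
  finally show ?thesis unfolding X eta_eq by (simp add: power_mult_distrib)
qed

text \<open>
  Two relations between the factors of \<open>\<vartheta>\<close> and of \<open>\<eta>\<close> under inversion determine \<open>c\<^sup>2\<close>: the derivative at
  \<open>0\<close> gives \<open>d\<^sup>3 = \<tau> c\<close>, and the half-periods, which inversion permutes, give \<open>d\<^sup>3 = - \<i> c\<^sup>3\<close>. The choice
  of square roots is never needed, since only \<open>c\<^sup>8\<close> and \<open>d\<^sup>3\<close> enter into theta-products with trivial character.
\<close>

theorem theta_eta_S:
  assumes \<tau>: "Im \<tau> > 0"
  obtains c d where "c \<noteq> 0" "d \<noteq> 0" "c ^ 2 = \<i> * \<tau>" "d ^ 3 = \<tau> * c"
    "eta (- 1 / \<tau>) = d * eta \<tau>"
    "\<And>z. theta (- 1 / \<tau>) (z / \<tau>) = c * e2pi (z ^ 2 / (2 * \<tau>)) * theta \<tau> z"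
proof -
  let ?t = "- 1 / \<tau>"
  have t0: "\<tau> \<noteq> 0" using \<tau> by auto
  have \<tau>': "Im ?t > 0" using \<tau> by (simp add: Im_divide power2_eq_square[symmetric] add_pos_nonneg add_nonneg_pos divide_pos_pos)
  obtain c where c: "\<And>z. theta ?t (z / \<tau>) = c * e2pi (z ^ 2 / (2 * \<tau>)) * theta \<tau> z"
    using theta_S_exists[OF \<tau>] by blast
  define d where "d = eta ?t / eta \<tau>"
  have d: "eta ?t = d * eta \<tau>" using eta_nonzero[OF \<tau>] by (simp add: d_def)
  have d0: "d \<noteq> 0" using eta_nonzero[OF \<tau>] eta_nonzero[OF \<tau>'] by (simp add: d_def)
  have e0: "eta \<tau> ^ 3 \<noteq> 0" using eta_nonzero[OF \<tau>] by simp
  have d3: "d ^ 3 = \<tau> * c"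
  proof -
    let ?k = "2 * of_real pi * \<i> :: complex"
    have "((\<lambda>z. theta ?t (z / \<tau>)) has_field_derivative (?k * eta ?t ^ 3) * (1 / \<tau>)) (at 0)"
      by (rule DERIV_chain2[of "theta ?t"]) (use theta_deriv_0[OF \<tau>'] t0 in \<open>auto intro!: derivative_eq_intros\<close>)
    moreover have "((\<lambda>z. theta ?t (z / \<tau>)) has_field_derivative c * (?k * eta \<tau> ^ 3)) (at 0)"
      unfolding c e2pi_def
      by (rule derivative_eq_intros theta_deriv_0[OF \<tau>] refl | use t0 in simp)+
    ultimately have "(?k * eta ?t ^ 3) * (1 / \<tau>) = c * (?k * eta \<tau> ^ 3)" by (rule DERIV_unique)
    then show ?thesis using e0 t0 unfolding d power_mult_distrib by (simp add: field_simps)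
  qed
  have D: "d ^ 3 = - \<i> * c ^ 3"
  proof -
    have e1: "theta ?t (1 / 2) = c * e2pi (\<tau> / 8) * theta \<tau> (\<tau> / 2)"
      using c[of "\<tau> / 2"] t0 by (simp add: power2_eq_square)
    have e2: "theta ?t (?t / 2) = - (c * e2pi (1 / (8 * \<tau>)) * theta \<tau> (1 / 2))"
      using c[of "- (1 / 2)"] t0 unfolding theta_minus by (simp add: power2_eq_square mult.commute)
    have e3: "theta ?t (?t / 2 + 1 / 2) = - (c * e2pi ((\<tau> - 1) ^ 2 / (8 * \<tau>)) * theta \<tau> (\<tau> / 2 + 1 / 2))"
    proof -
      have "?t / 2 + 1 / 2 = ((\<tau> - 1) / 2) / \<tau>" using t0 by (simp add: field_simps)
      then have "theta ?t (?t / 2 + 1 / 2) = c * e2pi (((\<tau> - 1) / 2) ^ 2 / (2 * \<tau>)) * theta \<tau> ((\<tau> - 1) / 2)"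
        by (simp only: c)
      moreover have "theta \<tau> ((\<tau> - 1) / 2) = - theta \<tau> (\<tau> / 2 + 1 / 2)"
        using theta_elliptic[of \<tau> "\<tau> / 2 + 1 / 2" 0 "-1"] by (simp add: diff_divide_distrib minus_one_powi)
      ultimately show ?thesis by (simp add: power_divide)
    qed
    have "2 * eta ?t ^ 3 = (c ^ 3 * (e2pi (?t / 4) * e2pi (\<tau> / 8) * e2pi (1 / (8 * \<tau>)) * e2pi ((\<tau> - 1) ^ 2 / (8 * \<tau>))))
        * (theta \<tau> (1 / 2) * theta \<tau> (\<tau> / 2) * theta \<tau> (\<tau> / 2 + 1 / 2))"
      unfolding theta_half_periods[OF \<tau>', symmetric] e1 e2 e3 by (simp add: power3_eq_cube)
    also have "e2pi (?t / 4) * e2pi (\<tau> / 8) * e2pi (1 / (8 * \<tau>)) * e2pi ((\<tau> - 1) ^ 2 / (8 * \<tau>)) = e2pi (- (1 / 4) + \<tau> / 4)"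
    proof -
      have "?t / 4 + \<tau> / 8 + 1 / (8 * \<tau>) + (\<tau> - 1) ^ 2 / (8 * \<tau>) = - (1 / 4) + \<tau> / 4"
        using t0 by (simp add: divide_simps power2_eq_square) (simp add: algebra_simps)
      then show ?thesis by (simp only: e2pi_add[symmetric])
    qed
    also have "\<dots> = - \<i> * e2pi (\<tau> / 4)"
    proof -
      have "e2pi (- (1 / 4)) = - \<i>"
        by (simp add: e2pi_def complex_eq_iff Re_exp Im_exp)
      then show ?thesis unfolding e2pi_add by simp
    qed
    also have "c ^ 3 * (- \<i> * e2pi (\<tau> / 4)) * (theta \<tau> (1 / 2) * theta \<tau> (\<tau> / 2) * theta \<tau> (\<tau> / 2 + 1 / 2))
      = (- \<i> * c ^ 3) * (2 * eta \<tau> ^ 3)"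
      unfolding theta_half_periods[OF \<tau>, symmetric] by simp
    finally have "(d ^ 3) * (2 * eta \<tau> ^ 3) = (- \<i> * c ^ 3) * (2 * eta \<tau> ^ 3)"
      unfolding d power_mult_distrib by (simp only: mult_ac)
    then show ?thesis using e0 by (simp only: mult_cancel_right) simp
  qed
  have c0: "c \<noteq> 0" using d3 d0 by auto
  have "c * \<tau> = c * (- \<i> * c ^ 2)" using d3 D by (simp add: power2_eq_square power3_eq_cube mult_ac)
  then have "\<tau> = - \<i> * c ^ 2" using c0 by (simp only: mult_cancel_left) simp
  then have "c ^ 2 = \<i> * \<tau>" by simp
  then show ?thesis by (rule that[OF c0 d0 _ d3 d c])
qed

section \<open>The quintuple product and the product for the root system of type A2\<close>

lemma has_sum_times:
  fixes f :: "'a \<Rightarrow> complex" and g :: "'b \<Rightarrow> complex"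
  assumes f: "(f has_sum S) A" and g: "(g has_sum T) B"
  shows "((\<lambda>(x, y). f x * g y) has_sum (S * T)) (A \<times> B)"
proof -
  let ?F = "\<lambda>(x, y). f x * g y"
  have nf: "(\<lambda>x. norm (f x)) summable_on A" and ng: "(\<lambda>y. norm (g y)) summable_on B"
    using f g by (auto dest!: has_sum_imp_summable simp: summable_on_iff_abs_summable_on_complex)
  have "(\<lambda>p. norm (?F p)) summable_on (A \<times> B)"
    unfolding Infinite_Sum.abs_summable_on_Sigma_iff
  proof (intro conjI ballI)
    fix x
    show "(\<lambda>y. norm (case (x, y) of (x, y) \<Rightarrow> f x * g y)) summable_on B"
      using summable_on_cmult_right[OF ng, of "norm (f x)"] by (simp add: norm_mult)
  next
    have "(\<lambda>x. norm (f x) * (\<Sum>\<^sub>\<infinity>y\<in>B. norm (g y))) summable_on A"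
      by (rule summable_on_cmult_left[OF nf])
    moreover have "(\<Sum>\<^sub>\<infinity>y\<in>B. norm (g y)) \<ge> 0" by (rule infsum_nonneg) simp
    ultimately show "(\<lambda>x. norm (\<Sum>\<^sub>\<infinity>y\<in>B. norm (case (x, y) of (x, y) \<Rightarrow> f x * g y))) summable_on A"
      by (simp add: norm_mult infsum_cmult_right')
  qed
  then have "?F summable_on (A \<times> B)" by (rule abs_summable_summable)
  then obtain U where U: "(?F has_sum U) (A \<times> B)" by (auto simp: summable_on_def)
  have "((\<lambda>x. f x * T) has_sum U) A"
    by (rule has_sum_SigmaD[OF U]) (use has_sum_cmult_right[OF g] in simp)
  moreover have "((\<lambda>x. f x * T) has_sum (S * T)) A" by (rule has_sum_cmult_left[OF f])
  ultimately have "U = S * T" by (rule has_sum_unique)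
  then show ?thesis using U by simp
qed

text \<open>
  The quadratic characters \<open>(12/n)\<close> and \<open>(-3/n)\<close>, as periodic functions with complex values.
\<close>

definition chi12 :: "int \<Rightarrow> complex" where
  "chi12 n = (if n mod 12 \<in> {1, 11} then 1 else if n mod 12 \<in> {5, 7} then -1 else 0)"

definition chi3 :: "int \<Rightarrow> complex" where
  "chi3 n = (if n mod 3 = 1 then 1 else if n mod 3 = 2 then -1 else 0)"

lemma chi12_cong: "a mod 12 = b mod 12 \<Longrightarrow> chi12 a = chi12 b"
  by (simp add: chi12_def)

lemma kronecker_m4_cong: "a mod 12 = b mod 12 \<Longrightarrow> kronecker_m4 a = kronecker_m4 b"
proof -
  assume "a mod 12 = b mod 12"
  then have "a mod 12 mod 4 = b mod 12 mod 4" by (simp only:)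
  then have "a mod 4 = b mod 4" by (simp add: mod_mod_cancel)
  then show ?thesis by (simp add: kronecker_m4_def)
qed

lemma chi3_cong: "a mod 12 = b mod 12 \<Longrightarrow> chi3 a = chi3 b"
proof -
  assume "a mod 12 = b mod 12"
  then have "a mod 12 mod 3 = b mod 12 mod 3" by (simp only:)
  then have "a mod 3 = b mod 3" by (simp add: mod_mod_cancel)
  then show ?thesis by (simp add: chi3_def)
qed

lemma chi12_lin: "chi12 (k * (t mod 12) + l * (m mod 12)) = chi12 (k * t + l * m)"
  by (rule chi12_cong, rule mod_add_cong) (simp_all add: mod_mult_right_eq)

lemma kronecker_m4_lin: "kronecker_m4 (k * (t mod 12) + l * (m mod 12)) = kronecker_m4 (k * t + l * m)"
  by (rule kronecker_m4_cong, rule mod_add_cong) (simp_all add: mod_mult_right_eq)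

lemma residues_12: "{0..<12 :: int} = {0, 1, 2, 3, 4, 5, 6, 7, 8, 9, 10, 11}"
  proof -
  have "{0..<12 :: int} = set [0..11]" by (auto simp: set_upto)
  also have "\<dots> = {0, 1, 2, 3, 4, 5, 6, 7, 8, 9, 10, 11}"
    by (simp add: upto_rec1 del: set_upto)
  finally show ?thesis .
qed

lemma chi12_le: "norm (chi12 n) \<le> 1"
  by (simp add: chi12_def)

lemma chi12_minus: "chi12 (- n) = chi12 n"
proof -
  have "\<forall>i\<in>{0..<12}. chi12 (- i) = chi12 i" unfolding residues_12 by (simp add: chi12_def)
  then have "chi12 (- (n mod 12)) = chi12 (n mod 12)" by simp
  moreover have "chi12 (n mod 12) = chi12 n" "chi12 (- (n mod 12)) = chi12 (- n)"
    using chi12_lin[of 1 n 0 0] chi12_lin[of "-1" n 0 0]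
    by (simp_all only: mult_1_left mult_zero_left add_0_right mult_minus_left)
  ultimately show ?thesis by (simp only:)
qed

lemma chi12_coprime: "chi12 n = 0" if "even n \<or> n mod 3 = 0"
  proof -
  have "n mod 12 \<noteq> 1" "n mod 12 \<noteq> 5" "n mod 12 \<noteq> 7" "n mod 12 \<noteq> 11" using that by presburger+
  then show ?thesis by (simp add: chi12_def)
qed

text \<open>
  The three coefficient identities that follow depend on the residues modulo \<open>12\<close> only, and are checked on these.
\<close>

lemma quintuple_odd:
  assumes "odd m" "odd t"
  shows "kronecker_m4 m * chi12 (2 * t - m) = kronecker_m4 t * chi12 (2 * m - t)"
proof -
  have all: "\<forall>i\<in>{0..<12}. \<forall>j\<in>{0..<12}. odd i \<longrightarrow> odd j \<longrightarrow>
     kronecker_m4 i * chi12 (2 * j - i) = kronecker_m4 j * chi12 (2 * i - j)"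
    unfolding residues_12 by (simp add: chi12_def kronecker_m4_def)
  have "odd (m mod 12)" "odd (t mod 12)" using assms by presburger+
  then have "kronecker_m4 (m mod 12) * chi12 (2 * (t mod 12) - m mod 12)
    = kronecker_m4 (t mod 12) * chi12 (2 * (m mod 12) - t mod 12)" using all by simp
  moreover have "kronecker_m4 (m mod 12) = kronecker_m4 m" "kronecker_m4 (t mod 12) = kronecker_m4 t"
    by (rule kronecker_m4_cong, simp)+
  moreover have "chi12 (2 * (t mod 12) - m mod 12) = chi12 (2 * t - m)" "chi12 (2 * (m mod 12) - t mod 12) = chi12 (2 * m - t)"
    using chi12_lin[of 2 t "-1" m] chi12_lin[of 2 m "-1" t] by simp_all
  ultimately show ?thesis by simp
qed

lemma quintuple_even:
  assumes "even t"
  shows "kronecker_m4 (t - m) * chi12 (2 * t - (t - m)) = - (kronecker_m4 m * chi12 (2 * t - m))"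
proof -
  have all: "\<forall>i\<in>{0..<12}. \<forall>j\<in>{0..<12}. even j \<longrightarrow>
     kronecker_m4 (j - i) * chi12 (2 * j - (j - i)) = - (kronecker_m4 i * chi12 (2 * j - i))"
    unfolding residues_12 by (simp add: chi12_def kronecker_m4_def)
  have "even (t mod 12)" using assms by presburger
  then have "kronecker_m4 (t mod 12 - m mod 12) * chi12 (2 * (t mod 12) - (t mod 12 - m mod 12))
    = - (kronecker_m4 (m mod 12) * chi12 (2 * (t mod 12) - m mod 12))" using all by simp
  moreover have "kronecker_m4 (m mod 12) = kronecker_m4 m" "kronecker_m4 (t mod 12 - m mod 12) = kronecker_m4 (t - m)"
    using kronecker_m4_lin[of 1 m 0 0] kronecker_m4_lin[of 1 t "-1" m] by simp_all
  moreover have "chi12 (2 * (t mod 12) - m mod 12) = chi12 (2 * t - m)"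
     "chi12 (2 * (t mod 12) - (t mod 12 - m mod 12)) = chi12 (2 * t - (t - m))"
    using chi12_lin[of 2 t "-1" m] chi12_lin[of 1 t 1 m] by simp_all
  ultimately show ?thesis by simp
qed

lemma a2_coeff:
  assumes "odd m" "s mod 3 \<noteq> 0"
  shows "(if even s then 1 else - 1) * kronecker_m4 m = - chi3 s * chi12 (3 * m - 2 * s)"
proof -
  have all: "\<forall>i\<in>{0..<12}. \<forall>j\<in>{0..<12}. odd i \<longrightarrow> j mod 3 \<noteq> 0 \<longrightarrow>
     (if even j then 1 else - 1) * kronecker_m4 i = - chi3 j * chi12 (3 * i - 2 * j)"
    unfolding residues_12 by (simp add: chi12_def kronecker_m4_def chi3_def)
  have "odd (m mod 12)" "(s mod 12) mod 3 \<noteq> 0" using assms by presburger+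
  then have "(if even (s mod 12) then 1 else - 1) * kronecker_m4 (m mod 12)
      = - chi3 (s mod 12) * chi12 (3 * (m mod 12) - 2 * (s mod 12))" using all by simp
  moreover have "even (s mod 12) \<longleftrightarrow> even s" by presburger
  moreover have "kronecker_m4 (m mod 12) = kronecker_m4 m" by (rule kronecker_m4_cong) simp
  moreover have "chi3 (s mod 12) = chi3 s" by (rule chi3_cong) simp
  moreover have "chi12 (3 * (m mod 12) - 2 * (s mod 12)) = chi12 (3 * m - 2 * s)"
    using chi12_lin[of 3 m "-2" s] by simp
  ultimately show ?thesis by simp
qed

text \<open>
  The powers \<open>q\<^bsup>u\<^sup>2/24\<^esup>\<close> of the pentagonal series.
\<close>

definition eterm :: "complex \<Rightarrow> int \<Rightarrow> complex" where
  "eterm \<tau> u = e2pi (of_int u ^ 2 / 24 * \<tau>)"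

lemma eterm_minus: "eterm \<tau> (- u) = eterm \<tau> u"
  by (simp add: eterm_def)

lemma eta_has_sum_1:
  assumes \<tau>: "Im \<tau> > 0"
  shows "((\<lambda>u. chi12 u * eterm \<tau> u) has_sum eta \<tau>) {u. u mod 6 = 1}"
proof -
  have "((\<lambda>n::int. (- 1) powi n * e2pi (of_int (6 * n + 1) ^ 2 / 24 * \<tau>)) has_sum eta \<tau>) UNIV \<longleftrightarrow> ?thesis"
  proof (rule has_sum_reindex_bij_witness[of _ "\<lambda>u. u div 6" "\<lambda>n. 6 * n + 1"])
    fix n :: int
    have "chi12 (6 * n + 1) = (- 1) powi n"
    proof (cases "even n")
      case True
      then have "(6 * n + 1) mod 12 = 1" by presburger
      then show ?thesis using True by (simp add: chi12_def minus_one_powi)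
    next
      case False
      then have "(6 * n + 1) mod 12 = 7" by presburger
      then show ?thesis using False by (simp add: chi12_def minus_one_powi)
    qed
    then show "chi12 (6 * n + 1) * eterm \<tau> (6 * n + 1) = (- 1) powi n * e2pi (of_int (6 * n + 1) ^ 2 / 24 * \<tau>)"
      by (simp add: eterm_def)
    show "6 * n + 1 \<in> {u. u mod 6 = 1}" by (simp; presburger)
    show "(6 * n + 1) div 6 = n" by presburger
  next
    fix u :: int assume "u \<in> {u. u mod 6 = 1}"
    then show "6 * (u div 6) + 1 = u" by (simp; presburger)
  qed auto
  then show ?thesis using pentagonal_number_theorem[OF \<tau>] by blast
qed

text \<open>
  The summand of the pentagonal series is even in \<open>u\<close>, so from each pair \<open>\<plusminus>u\<close> of integers prime to
  \<open>6\<close> either member may be summed.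
\<close>

lemma eta_has_sum_select:
  assumes \<tau>: "Im \<tau> > 0"
    and R: "\<And>u. u mod 6 = 1 \<Longrightarrow> \<sigma> u = u \<or> \<sigma> u = - u" "\<And>u. u mod 6 = 1 \<Longrightarrow> \<sigma> u \<in> R"
      "\<And>u. u \<in> R \<Longrightarrow> \<exists>v. v mod 6 = 1 \<and> \<sigma> v = u"
  shows "((\<lambda>u. chi12 u * eterm \<tau> u) has_sum eta \<tau>) R"
proof -
  have inj: "inj_on \<sigma> {u. u mod 6 = 1}"
  proof (rule inj_onI)
    fix u v :: int assume u: "u \<in> {u. u mod 6 = 1}" and v: "v \<in> {u. u mod 6 = 1}" and e: "\<sigma> u = \<sigma> v"
    then have "u = v \<or> u = - v" using R(1)[of u] R(1)[of v] by auto
    moreover have "u \<noteq> - v" using u v by (simp; presburger)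
    ultimately show "u = v" by simp
  qed
  have "bij_betw \<sigma> {u. u mod 6 = 1} R"
    unfolding bij_betw_def using inj R(2,3) by (auto simp: image_iff; metis)
  from has_sum_reindex_bij_betw[OF this, of "\<lambda>u. chi12 u * eterm \<tau> u"]
  have "((\<lambda>u. chi12 u * eterm \<tau> u) has_sum eta \<tau>) R \<longleftrightarrow> ((\<lambda>u. chi12 (\<sigma> u) * eterm \<tau> (\<sigma> u)) has_sum eta \<tau>) {u. u mod 6 = 1}"
    by simp
  also have "\<dots> \<longleftrightarrow> ((\<lambda>u. chi12 u * eterm \<tau> u) has_sum eta \<tau>) {u. u mod 6 = 1}"
    by (rule has_sum_cong) (use R(1) in \<open>metis chi12_minus eterm_minus mem_Collect_eq\<close>)
  finally show ?thesis using eta_has_sum_1[OF \<tau>] by blast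
qed

lemma eta_has_sum_5:
  assumes \<tau>: "Im \<tau> > 0"
  shows "((\<lambda>u. chi12 u * eterm \<tau> u) has_sum eta \<tau>) {u. u mod 6 = 5}"
proof (rule eta_has_sum_select[OF \<tau>, of uminus])
  fix u :: int assume "u \<in> {u. u mod 6 = 5}"
  then have "(- u) mod 6 = 1 \<and> - (- u) = u" by (simp; presburger)
  then show "\<exists>v. v mod 6 = 1 \<and> - v = u" by blast
qed (auto; presburger)+

lemma eta_has_sum_mod4:
  assumes \<tau>: "Im \<tau> > 0" and t: "odd t"
  shows "((\<lambda>u. chi12 u * eterm \<tau> u) has_sum eta \<tau>) {u. (u - t) mod 4 = 0}"
proof -
  have "((\<lambda>u. chi12 u * eterm \<tau> u) has_sum eta \<tau>) {u. (u - t) mod 4 = 0 \<and> u mod 3 \<noteq> 0}"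
  proof (rule eta_has_sum_select[OF \<tau>, of "\<lambda>u. if (u - t) mod 4 = 0 then u else - u"])
    fix u :: int assume "u mod 6 = 1"
    then show "(if (u - t) mod 4 = 0 then u else - u) \<in> {u. (u - t) mod 4 = 0 \<and> u mod 3 \<noteq> 0}"
      using t by (simp; presburger)
  next
    fix u :: int assume u: "u \<in> {u. (u - t) mod 4 = 0 \<and> u mod 3 \<noteq> 0}"
    define v where "v = (if u mod 6 = 1 then u else - u)"
    have "v mod 6 = 1" using u t unfolding v_def by (simp; presburger)
    moreover have "(if (v - t) mod 4 = 0 then v else - v) = u" using u t unfolding v_def by (simp; presburger)
    ultimately show "\<exists>v. v mod 6 = 1 \<and> (if (v - t) mod 4 = 0 then v else - v) = u" by blast
  qed auto
  then show ?thesis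
    by (rule has_sum_cong_neutral[THEN iffD1, rotated -1]) (auto simp: chi12_coprime)
qed

text \<open>
  A summable function that is antisymmetric about a centre \<open>k/2\<close> has sum \<open>0\<close>.
\<close>

lemma has_sum_odd_zero:
  fixes f :: "int \<Rightarrow> complex"
  assumes "f summable_on UNIV" and "\<And>m. f (k - m) = - f m"
  shows "(f has_sum 0) UNIV"
proof -
  obtain S where S: "(f has_sum S) UNIV" using assms(1) by (auto simp: summable_on_def)
  have "((\<lambda>m. f (k - m)) has_sum S) UNIV \<longleftrightarrow> (f has_sum S) UNIV"
    by (rule has_sum_reindex_bij_witness[of _ "\<lambda>m. k - m" "\<lambda>m. k - m"]) auto
  then have "((\<lambda>m. - f m) has_sum S) UNIV" using S assms(2) by simp
  then have "(f has_sum - S) UNIV" by (simp add: has_sum_uminus)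
  then have "- S = S" using S by (rule has_sum_unique)
  then have "S = 0" by simp
  then show ?thesis using S by simp
qed

text \<open>
  The sum over one fibre \<open>m + n = 2 t\<close> in the product of the two series of \<open>quintuple_product\<close>.
\<close>

lemma quintuple_inner:
  assumes \<tau>: "Im \<tau> > 0"
    and sm: "(\<lambda>m. kronecker_m4 m * chi12 (2 * t - m) * eterm \<tau> (2 * m - t)) summable_on UNIV"
  shows "((\<lambda>m. kronecker_m4 m * chi12 (2 * t - m) * eterm \<tau> (2 * m - t)) has_sum (kronecker_m4 t * eta \<tau>)) UNIV"
proof (cases "even t")
  case True
  have "((\<lambda>m. kronecker_m4 m * chi12 (2 * t - m) * eterm \<tau> (2 * m - t)) has_sum 0) UNIV"
  proof (rule has_sum_odd_zero[OF sm, of t])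
    fix m
    have "2 * (t - m) - t = - (2 * m - t)" by simp
    then have "eterm \<tau> (2 * (t - m) - t) = eterm \<tau> (2 * m - t)" using eterm_minus by metis
    then show "kronecker_m4 (t - m) * chi12 (2 * t - (t - m)) * eterm \<tau> (2 * (t - m) - t) =
        - (kronecker_m4 m * chi12 (2 * t - m) * eterm \<tau> (2 * m - t))"
      using quintuple_even[OF True, of m] by simp
  qed
  then show ?thesis using True by (simp add: kronecker_m4_even)
next
  case False
  have "((\<lambda>u. kronecker_m4 t * (chi12 u * eterm \<tau> u)) has_sum (kronecker_m4 t * eta \<tau>)) {u. (u - t) mod 4 = 0}"
    by (intro has_sum_cmult_right eta_has_sum_mod4 \<tau> False)
  also have "?this \<longleftrightarrow> ((\<lambda>m. kronecker_m4 m * chi12 (2 * t - m) * eterm \<tau> (2 * m - t)) has_sum (kronecker_m4 t * eta \<tau>)) {m. odd m}"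
  proof (rule has_sum_reindex_bij_witness[of _ "\<lambda>m. 2 * m - t" "\<lambda>u. (u + t) div 2"])
    fix u assume u: "u \<in> {u. (u - t) mod 4 = 0}"
    then show e: "2 * ((u + t) div 2) - t = u" using False by (simp; presburger)
    have o: "odd ((u + t) div 2)" using u False by (simp; presburger)
    then show "(u + t) div 2 \<in> {m. odd m}" by simp
    show "kronecker_m4 ((u + t) div 2) * chi12 (2 * t - (u + t) div 2) * eterm \<tau> (2 * ((u + t) div 2) - t)
        = kronecker_m4 t * (chi12 u * eterm \<tau> u)"
      using quintuple_odd[OF o False] unfolding e by simp
  next
    fix m :: int assume "m \<in> {m. odd m}"
    then show "2 * m - t \<in> {u. (u - t) mod 4 = 0}" using False by (simp; presburger)
  qed auto
  also have "\<dots> \<longleftrightarrow> ?thesis"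
    by (rule has_sum_cong_neutral) (auto simp: kronecker_m4_even)
  finally show ?thesis .
qed

text \<open>
  The series \<open>\<Sum>n\<in>\<int>. (12/n) q\<^bsup>n\<^sup>2/24\<^esup> \<zeta>\<^bsup>n/2\<^esup>\<close>, which is the entire function \<open>\<vartheta>\<^bsub>3/2\<^esub>\<close> by \<open>theta_3_2_eq\<close>.
\<close>

abbreviation Qsum :: "complex \<Rightarrow> complex \<Rightarrow> complex" where
  "Qsum \<equiv> gsum chi12 24"

text \<open>
  The quintuple product identity without division. With \<open>m + n = 2 t\<close>,
  \<open>m\<^sup>2 / 8 + n\<^sup>2 / 24 = t\<^sup>2 / 8 + (2 m - t)\<^sup>2 / 24\<close>, so the double series splits into a theta series in \<open>t\<close> and,
  for each \<open>t\<close>, a pentagonal series.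
\<close>

theorem quintuple_product:
  assumes \<tau>: "Im \<tau> > 0"
  shows "theta \<tau> z * Qsum \<tau> z = eta \<tau> * theta \<tau> (2 * z)"
proof -
  define F where "F = (\<lambda>(t, m). gterm kronecker_m4 8 m \<tau> z * gterm chi12 24 (2 * t - m) \<tau> z)"
  have "((\<lambda>n. gterm kronecker_m4 8 n \<tau> z) has_sum theta \<tau> z) UNIV"
    unfolding theta_gsum by (rule gsum_has_sum) (auto simp: kronecker_m4_le \<tau>)
  moreover have "((\<lambda>n. gterm chi12 24 n \<tau> z) has_sum Qsum \<tau> z) UNIV"
    by (rule gsum_has_sum) (auto simp: chi12_le \<tau>)
  ultimately have "((\<lambda>(m, n). gterm kronecker_m4 8 m \<tau> z * gterm chi12 24 n \<tau> z) has_sum (theta \<tau> z * Qsum \<tau> z)) (UNIV \<times> UNIV)"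
    by (rule has_sum_times)
  also have "?this \<longleftrightarrow> ((\<lambda>(m, n). gterm kronecker_m4 8 m \<tau> z * gterm chi12 24 n \<tau> z) has_sum (theta \<tau> z * Qsum \<tau> z)) {(m, n). even (m + n)}"
    by (rule has_sum_cong_neutral) (auto simp: gterm_def chi12_coprime kronecker_m4_even)
  also have "\<dots> \<longleftrightarrow> (F has_sum (theta \<tau> z * Qsum \<tau> z)) (UNIV \<times> UNIV)"
    by (rule has_sum_reindex_bij_witness[of _ "\<lambda>(t, m). (m, 2 * t - m)" "\<lambda>(m, n). ((m + n) div 2, m)"])
      (auto simp: F_def)
  finally have hF: "(F has_sum (theta \<tau> z * Qsum \<tau> z)) (UNIV \<times> UNIV)" .
  have Feq: "F (t, m) = e2pi (of_int t ^ 2 / 8 * \<tau> + of_int t / 2 * (2 * z)) * (kronecker_m4 m * chi12 (2 * t - m) * eterm \<tau> (2 * m - t))" for t m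
  proof -
    have "(of_int m ^ 2 / of_real 8 * \<tau> + of_int m / 2 * z) + (of_int (2 * t - m) ^ 2 / of_real 24 * \<tau> + of_int (2 * t - m) / 2 * z)
       = (of_int t ^ 2 / 8 * \<tau> + of_int t / 2 * (2 * z)) + of_int (2 * m - t) ^ 2 / 24 * \<tau>"
      by (simp add: field_simps power2_eq_square)
    then have "e2pi (of_int m ^ 2 / of_real 8 * \<tau> + of_int m / 2 * z) * e2pi (of_int (2 * t - m) ^ 2 / of_real 24 * \<tau> + of_int (2 * t - m) / 2 * z)
       = e2pi (of_int t ^ 2 / 8 * \<tau> + of_int t / 2 * (2 * z)) * eterm \<tau> (2 * m - t)"
      unfolding eterm_def by (simp only: e2pi_add[symmetric])
    then show ?thesis unfolding F_def gterm_def case_prod_conv by (simp only: mult_ac)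
  qed
  have "((\<lambda>t. gterm kronecker_m4 8 t \<tau> (2 * z) * eta \<tau>) has_sum (theta \<tau> z * Qsum \<tau> z)) UNIV"
  proof (rule has_sum_SigmaD[OF hF])
    fix t :: int
    have "(\<lambda>m. F (t, m)) summable_on UNIV"
      by (rule summable_on_SigmaD1[of "\<lambda>t m. F (t, m)" UNIV "\<lambda>_. UNIV"]) (use hF has_sum_imp_summable in auto)
    then have "(\<lambda>m. kronecker_m4 m * chi12 (2 * t - m) * eterm \<tau> (2 * m - t)) summable_on UNIV"
      unfolding Feq using summable_on_cmult_right'[OF e2pi_nonzero] by blast
    from has_sum_cmult_right[OF quintuple_inner[OF \<tau> this], of "e2pi (of_int t ^ 2 / 8 * \<tau> + of_int t / 2 * (2 * z))"]
    show "((\<lambda>m. F (t, m)) has_sum gterm kronecker_m4 8 t \<tau> (2 * z) * eta \<tau>) UNIV"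
      unfolding Feq gterm_def by (simp add: mult_ac)
  qed
  moreover have "((\<lambda>t. gterm kronecker_m4 8 t \<tau> (2 * z) * eta \<tau>) has_sum (theta \<tau> (2 * z) * eta \<tau>)) UNIV"
    unfolding theta_gsum by (intro has_sum_cmult_left gsum_has_sum) (auto simp: kronecker_m4_le \<tau>)
  ultimately show ?thesis using has_sum_unique by (metis mult.commute)
qed

text \<open>
  The sum over \<open>m\<close> in the proof of \<open>a2_product\<close>, for \<open>a + b = s\<close>.
\<close>

lemma a2_inner:
  assumes \<tau>: "Im \<tau> > 0"
    and sm: "(\<lambda>m. kronecker_m4 m * eterm \<tau> (3 * m - 2 * s)) summable_on UNIV"
  shows "((\<lambda>m. (if even s then 1 else - 1) * kronecker_m4 m * eterm \<tau> (3 * m - 2 * s)) has_sum (- chi3 s * eta \<tau>)) UNIV"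
proof (cases "s mod 3 = 0")
  case True
  define r where "r = s div 3"
  have r: "s = 3 * r" using True unfolding r_def by presburger
  have "((\<lambda>m. kronecker_m4 m * eterm \<tau> (3 * m - 2 * s)) has_sum 0) UNIV"
  proof (rule has_sum_odd_zero[OF sm, of "4 * r"])
    fix m
    have "3 * (4 * r - m) - 2 * s = - (3 * m - 2 * s)" using r by simp
    then have "eterm \<tau> (3 * (4 * r - m) - 2 * s) = eterm \<tau> (3 * m - 2 * s)" using eterm_minus by metis
    moreover have "kronecker_m4 (4 * r - m) = - kronecker_m4 m"
      using kronecker_m4_shift[of "- m" "2 * r"] by (simp add: kronecker_m4_minus minus_one_powi algebra_simps)
    ultimately show "kronecker_m4 (4 * r - m) * eterm \<tau> (3 * (4 * r - m) - 2 * s) = - (kronecker_m4 m * eterm \<tau> (3 * m - 2 * s))"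
      by simp
  qed
  from has_sum_cmult_right[OF this, of "if even s then 1 else - 1"] True show ?thesis
    by (simp add: chi3_def mult.assoc)
next
  case False
  define R where "R = {u::int. u mod 6 = (if s mod 3 = 1 then 1 else 5)}"
  have "((\<lambda>u. chi12 u * eterm \<tau> u) has_sum eta \<tau>) R"
    using eta_has_sum_1[OF \<tau>] eta_has_sum_5[OF \<tau>] unfolding R_def by (cases "s mod 3 = 1") auto
  then have "((\<lambda>u. - chi3 s * (chi12 u * eterm \<tau> u)) has_sum (- chi3 s * eta \<tau>)) R"
    by (rule has_sum_cmult_right)
  also have "?this \<longleftrightarrow> ((\<lambda>m. (if even s then 1 else - 1) * kronecker_m4 m * eterm \<tau> (3 * m - 2 * s)) has_sum (- chi3 s * eta \<tau>)) {m. odd m}"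
  proof (rule has_sum_reindex_bij_witness[of _ "\<lambda>m. 3 * m - 2 * s" "\<lambda>u. (u + 2 * s) div 3"])
    fix u assume u: "u \<in> R"
    show e: "3 * ((u + 2 * s) div 3) - 2 * s = u"
    proof (cases "s mod 3 = 1")
      case True
      then have "u mod 6 = 1" using u by (simp add: R_def)
      then show ?thesis using True by presburger
    next
      case c: False
      then have s2: "s mod 3 = 2" using False by presburger
      have "u mod 6 = 5" using u c by (simp add: R_def)
      then show ?thesis using s2 by presburger
    qed
    have "u mod 6 = 1 \<or> u mod 6 = 5" using u by (simp add: R_def split: if_splits)
    then have "odd u" by presburger
    then have o: "odd ((u + 2 * s) div 3)" using e by presburger
    then show "(u + 2 * s) div 3 \<in> {m. odd m}" by simp
    show "(if even s then 1 else - 1) * kronecker_m4 ((u + 2 * s) div 3) * eterm \<tau> (3 * ((u + 2 * s) div 3) - 2 * s)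
        = - chi3 s * (chi12 u * eterm \<tau> u)"
      unfolding a2_coeff[OF o False] e by simp
  next
    fix m :: int assume m: "m \<in> {m. odd m}"
    show "3 * m - 2 * s \<in> R"
    proof (cases "s mod 3 = 1")
      case True
      then have "(3 * m - 2 * s) mod 6 = 1" using m by (simp; presburger)
      then show ?thesis using True by (simp add: R_def)
    next
      case c: False
      then have "s mod 3 = 2" using False by presburger
      then have "(3 * m - 2 * s) mod 6 = 5" using m by (simp; presburger)
      then show ?thesis using c by (simp add: R_def)
    qed
  qed auto
  also have "\<dots> \<longleftrightarrow> ?thesis"
    by (rule has_sum_cong_neutral) (auto simp: kronecker_m4_even)
  finally show ?thesis .
qed

text \<open>
  The denominator identity of the affine root system of type A2. In the triple product of theta series with indices
  \<open>2 a - m\<close>, \<open>2 b - m\<close> and \<open>m\<close>, the exponent of \<open>q\<close> is \<open>(a\<^sup>2 - a b + b\<^sup>2) / 3 + (3 m - 2 (a + b))\<^sup>2 / 24\<close>, and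
  summation over \<open>m\<close> yields \<open>\<eta>\<close> times a sign or \<open>0\<close>. The exponent that remains is half the norm of the vector
  dual to \<open>a z + b w\<close> under the form \<open>z\<^sup>2 + w\<^sup>2 + (z + w)\<^sup>2\<close>.
\<close>

theorem a2_product:
  assumes \<tau>: "Im \<tau> > 0"
  shows "((\<lambda>(a, b). - chi3 (a + b) * e2pi (of_int (a ^ 2 - a * b + b ^ 2) / 3 * \<tau> + of_int a * z + of_int b * w))
     has_sum (theta \<tau> z * theta \<tau> w * theta \<tau> (z + w) / eta \<tau>)) (UNIV \<times> UNIV)"
proof -
  let ?g = "\<lambda>n z. gterm kronecker_m4 8 n \<tau> z"
  let ?T = "theta \<tau> z * theta \<tau> w * theta \<tau> (z + w)"
  define F where "F = (\<lambda>((a, b), m). ?g (2 * a - m) z * ?g (2 * b - m) w * ?g m (z + w))"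
  have g: "((\<lambda>n. ?g n z) has_sum theta \<tau> z) UNIV" for z
    unfolding theta_gsum by (rule gsum_has_sum) (auto simp: kronecker_m4_le \<tau>)
  have "((\<lambda>(p, m). (case p of (k, l) \<Rightarrow> ?g k z * ?g l w) * ?g m (z + w)) has_sum ?T) ((UNIV \<times> UNIV) \<times> UNIV)"
    by (intro has_sum_times g)
  also have "?this \<longleftrightarrow> ((\<lambda>(p, m). (case p of (k, l) \<Rightarrow> ?g k z * ?g l w) * ?g m (z + w)) has_sum ?T) {((k, l), m). even (k + m) \<and> even (l + m)}"
    by (rule has_sum_cong_neutral) (auto simp: gterm_def kronecker_m4_even)
  also have "\<dots> \<longleftrightarrow> (F has_sum ?T) ((UNIV \<times> UNIV) \<times> UNIV)"
    by (rule has_sum_reindex_bij_witness[of _ "\<lambda>((a, b), m). ((2 * a - m, 2 * b - m), m)" "\<lambda>((k, l), m). (((k + m) div 2, (l + m) div 2), m)"])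
      (auto simp: F_def)
  finally have hF: "(F has_sum ?T) ((UNIV \<times> UNIV) \<times> UNIV)" .
  define E where "E = (\<lambda>a b::int. e2pi (of_int (a ^ 2 - a * b + b ^ 2) / 3 * \<tau> + of_int a * z + of_int b * w))"
  have Feq: "F ((a, b), m) = E a b * ((if even (a + b) then 1 else - 1) * kronecker_m4 m * eterm \<tau> (3 * m - 2 * (a + b)))" for a b m
  proof -
    have "(of_int (2 * a - m) ^ 2 / of_real 8 * \<tau> + of_int (2 * a - m) / 2 * z) + (of_int (2 * b - m) ^ 2 / of_real 8 * \<tau> + of_int (2 * b - m) / 2 * w)
        + (of_int m ^ 2 / of_real 8 * \<tau> + of_int m / 2 * (z + w))
       = (of_int (a ^ 2 - a * b + b ^ 2) / 3 * \<tau> + of_int a * z + of_int b * w) + of_int (3 * m - 2 * (a + b)) ^ 2 / 24 * \<tau>"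
      by (simp add: field_simps power2_eq_square)
    then have 1: "e2pi (of_int (2 * a - m) ^ 2 / of_real 8 * \<tau> + of_int (2 * a - m) / 2 * z) * e2pi (of_int (2 * b - m) ^ 2 / of_real 8 * \<tau> + of_int (2 * b - m) / 2 * w)
        * e2pi (of_int m ^ 2 / of_real 8 * \<tau> + of_int m / 2 * (z + w))
       = E a b * eterm \<tau> (3 * m - 2 * (a + b))"
      unfolding eterm_def E_def by (simp only: e2pi_add[symmetric])
    have k: "kronecker_m4 (2 * a - m) = - ((- 1) powi a * kronecker_m4 m)" for a
      using kronecker_m4_shift[of "- m" a] by (simp add: kronecker_m4_minus)
    have k3: "kronecker_m4 m * kronecker_m4 m * kronecker_m4 m = kronecker_m4 m"
      by (simp add: kronecker_m4_def)
    have "kronecker_m4 (2 * a - m) * kronecker_m4 (2 * b - m) * kronecker_m4 m = (if even (a + b) then 1 else - 1) * (kronecker_m4 m * kronecker_m4 m * kronecker_m4 m)"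
      unfolding k by (simp add: minus_one_powi)
    then have 2: "kronecker_m4 (2 * a - m) * kronecker_m4 (2 * b - m) * kronecker_m4 m = (if even (a + b) then 1 else - 1) * kronecker_m4 m"
      unfolding k3 .
    have "F ((a, b), m) = (kronecker_m4 (2 * a - m) * kronecker_m4 (2 * b - m) * kronecker_m4 m) *
       (e2pi (of_int (2 * a - m) ^ 2 / of_real 8 * \<tau> + of_int (2 * a - m) / 2 * z) * e2pi (of_int (2 * b - m) ^ 2 / of_real 8 * \<tau> + of_int (2 * b - m) / 2 * w)
        * e2pi (of_int m ^ 2 / of_real 8 * \<tau> + of_int m / 2 * (z + w)))"
      unfolding F_def gterm_def case_prod_conv by (simp only: mult_ac)
    then show ?thesis unfolding 1 2 by (simp only: mult_ac)
  qed
  have "((\<lambda>(a, b). E a b * (- chi3 (a + b) * eta \<tau>)) has_sum ?T) (UNIV \<times> UNIV)"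
  proof (rule has_sum_SigmaD[OF hF])
    fix p :: "int \<times> int"
    obtain a b where p: "p = (a, b)" by (cases p)
    have "(\<lambda>m. F (p, m)) summable_on UNIV"
      by (rule summable_on_SigmaD1[of "\<lambda>t m. F (t, m)" "UNIV \<times> UNIV" "\<lambda>_. UNIV"]) (use hF has_sum_imp_summable in auto)
    then have s1: "(\<lambda>m. E a b * ((if even (a + b) then 1 else - 1) * kronecker_m4 m * eterm \<tau> (3 * m - 2 * (a + b)))) summable_on UNIV"
      unfolding p Feq .
    have "(\<lambda>m. kronecker_m4 m * eterm \<tau> (3 * m - 2 * (a + b))) summable_on UNIV"
    proof -
      have "(\<lambda>m. (E a b * (if even (a + b) then 1 else - 1)) * (kronecker_m4 m * eterm \<tau> (3 * m - 2 * (a + b)))) summable_on UNIV"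
        using s1 by (simp only: mult.assoc)
      then show ?thesis by (subst (asm) summable_on_cmult_right') (auto simp: E_def)
    qed
    from has_sum_cmult_right[OF a2_inner[OF \<tau> this], of "E a b"]
    show "((\<lambda>m. F (p, m)) has_sum (case p of (a, b) \<Rightarrow> E a b * (- chi3 (a + b) * eta \<tau>))) UNIV"
      unfolding p Feq by simp
  qed
  from has_sum_cmult_left[OF this, of "1 / eta \<tau>"]
  show ?thesis using eta_nonzero[OF \<tau>] by (simp add: case_prod_unfold E_def mult_ac)
qed

lemma theta_eventually_nonzero:
  assumes "Im \<tau> > 0"
  shows "eventually (\<lambda>w. theta \<tau> w \<noteq> 0) (at z)"
proof -
  have "theta \<tau> (1/2) \<noteq> 0"
    using theta_half_periods[OF assms] eta_nonzero[OF assms] by auto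
  then have "\<forall>\<^sub>F w in at z. theta \<tau> w \<noteq> 0 \<and> w \<in> UNIV"
    using theta_holomorphic[OF assms] by (intro non_zero_neighbour_alt[where \<beta> = "1/2"]) auto
  then show ?thesis by simp
qed

text \<open>
  Cancellation of \<open>\<vartheta>\<close> from identities between continuous functions; its zeros are isolated.
\<close>

lemma theta_cancel:
  assumes \<tau>: "Im \<tau> > 0" and "isCont f z" "isCont g z"
    and eq: "\<And>w. theta \<tau> w * f w = theta \<tau> w * g w"
  shows "f z = g z"
proof -
  have L: "f \<midarrow>z\<rightarrow> f z" "g \<midarrow>z\<rightarrow> g z" using assms by (auto simp: isCont_def)
  have "eventually (\<lambda>w. f w = g w) (at z)"
    using theta_eventually_nonzero[OF \<tau>] by eventually_elim (use eq in auto)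
  then have "g \<midarrow>z\<rightarrow> f z" by (rule Lim_transform_eventually[OF L(1)])
  then show ?thesis using L(2) by (rule LIM_unique)
qed

lemma Qsum_isCont: "Im \<tau> > 0 \<Longrightarrow> isCont (Qsum \<tau>) z"
  using gsum_holomorphic[of chi12 24 \<tau> UNIV] holomorphic_on_imp_continuous_on[of "Qsum \<tau>" UNIV]
  by (auto simp: chi12_le continuous_on_eq_continuous_at)

theorem theta_3_2_eq:
  assumes \<tau>: "Im \<tau> > 0"
  shows "theta_3_2 \<tau> z = Qsum \<tau> z"
  unfolding theta_3_2_def
proof (rule remove_sings_eqI)
  have "Qsum \<tau> \<midarrow>z\<rightarrow> Qsum \<tau> z" using Qsum_isCont[OF \<tau>] by (simp add: isCont_def)
  then show "(\<lambda>w. eta \<tau> * theta \<tau> (2 * w) / theta \<tau> w) \<midarrow>z\<rightarrow> Qsum \<tau> z"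
  proof (rule Lim_transform_eventually)
    show "\<forall>\<^sub>F w in at z. Qsum \<tau> w = eta \<tau> * theta \<tau> (2 * w) / theta \<tau> w"
      using theta_eventually_nonzero[OF \<tau>]
      by eventually_elim (use quintuple_product[OF \<tau>] in \<open>simp add: field_simps\<close>)
  qed
qed

section \<open>Transformation laws of the quintuple series\<close>

lemma Im_minus_inverse_pos: "Im \<tau> > 0 \<Longrightarrow> Im (- 1 / \<tau>) > 0"
  by (simp add: Im_divide power2_eq_square[symmetric] add_pos_nonneg add_nonneg_pos divide_pos_pos)

lemma Qsum_S:
  assumes \<tau>: "Im \<tau> > 0" and c: "c \<noteq> 0"
    and eta: "eta (- 1 / \<tau>) = d * eta \<tau>"
    and th: "\<And>z. theta (- 1 / \<tau>) (z / \<tau>) = c * e2pi (z ^ 2 / (2 * \<tau>)) * theta \<tau> z"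
  shows "Qsum (- 1 / \<tau>) (z / \<tau>) = d * e2pi (3 * z ^ 2 / (2 * \<tau>)) * Qsum \<tau> z"
proof (rule theta_cancel[OF \<tau>, where z = z and f = "\<lambda>z. Qsum (- 1 / \<tau>) (z / \<tau>)" and g = "\<lambda>z. d * e2pi (3 * z ^ 2 / (2 * \<tau>)) * Qsum \<tau> z"])
  have t0: "\<tau> \<noteq> 0" using \<tau> by auto
  show "isCont (\<lambda>z. Qsum (- 1 / \<tau>) (z / \<tau>)) z"
    by (rule isCont_o2[OF _ Qsum_isCont[OF Im_minus_inverse_pos[OF \<tau>]]]) (use t0 in \<open>auto intro!: continuous_intros\<close>)
  show "isCont (\<lambda>z. d * e2pi (3 * z ^ 2 / (2 * \<tau>)) * Qsum \<tau> z) z"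
    unfolding e2pi_def by (intro continuous_intros Qsum_isCont[OF \<tau>]) (use t0 in auto)
  fix w
  have "theta (- 1 / \<tau>) (w / \<tau>) * Qsum (- 1 / \<tau>) (w / \<tau>) = eta (- 1 / \<tau>) * theta (- 1 / \<tau>) ((2 * w) / \<tau>)"
    using quintuple_product[OF Im_minus_inverse_pos[OF \<tau>], of "w / \<tau>"] by simp
  also have "\<dots> = d * c * e2pi ((2 * w) ^ 2 / (2 * \<tau>)) * (eta \<tau> * theta \<tau> (2 * w))"
    unfolding th eta by (simp add: mult_ac)
  also have "\<dots> = d * c * e2pi ((2 * w) ^ 2 / (2 * \<tau>)) * (theta \<tau> w * Qsum \<tau> w)"
    unfolding quintuple_product[OF \<tau>] ..
  also have "(2 * w) ^ 2 / (2 * \<tau>) = w ^ 2 / (2 * \<tau>) + 3 * w ^ 2 / (2 * \<tau>)"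
    using t0 by (simp add: field_simps)
  finally have "(c * e2pi (w ^ 2 / (2 * \<tau>))) * (theta \<tau> w * Qsum (- 1 / \<tau>) (w / \<tau>))
     = (c * e2pi (w ^ 2 / (2 * \<tau>))) * (theta \<tau> w * (d * e2pi (3 * w ^ 2 / (2 * \<tau>)) * Qsum \<tau> w))"
    unfolding th e2pi_add by (simp only: mult_ac)
  then show "theta \<tau> w * Qsum (- 1 / \<tau>) (w / \<tau>) = theta \<tau> w * (d * e2pi (3 * w ^ 2 / (2 * \<tau>)) * Qsum \<tau> w)"
    using c by (simp only: mult_cancel_left) simp
qed

lemma Qsum_T:
  assumes \<tau>: "Im \<tau> > 0"
  shows "Qsum (\<tau> + 1) z = e2pi (1 / 24) * Qsum \<tau> z"
proof (rule theta_cancel[OF \<tau>, where z = z and f = "Qsum (\<tau> + 1)" and g = "\<lambda>z. e2pi (1 / 24) * Qsum \<tau> z"])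
  have \<tau>': "Im (\<tau> + 1) > 0" using \<tau> by simp
  show "isCont (Qsum (\<tau> + 1)) z" by (rule Qsum_isCont[OF \<tau>'])
  show "isCont (\<lambda>z. e2pi (1 / 24) * Qsum \<tau> z) z" by (intro continuous_intros Qsum_isCont[OF \<tau>])
  fix w
  have "e2pi (1 / 8) * (theta \<tau> w * Qsum (\<tau> + 1) w) = e2pi (1 / 8) * (e2pi (1 / 24) * (eta \<tau> * theta \<tau> (2 * w)))"
    using quintuple_product[OF \<tau>', of w] unfolding theta_T eta_T by (simp add: mult_ac)
  also have "\<dots> = e2pi (1 / 8) * (theta \<tau> w * (e2pi (1 / 24) * Qsum \<tau> w))"
    unfolding quintuple_product[OF \<tau>, symmetric] by (simp only: mult_ac)
  finally show "theta \<tau> w * Qsum (\<tau> + 1) w = theta \<tau> w * (e2pi (1 / 24) * Qsum \<tau> w)" by simp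
qed

lemma Qsum_elliptic:
  fixes a b :: int
  assumes \<tau>: "Im \<tau> > 0"
  shows "Qsum \<tau> (z + of_int a * \<tau> + of_int b)
       = (- 1) powi (a + b) * e2pi (- (3 * (of_int a ^ 2 / 2 * \<tau> + of_int a * z))) * Qsum \<tau> z"
proof (rule theta_cancel[OF \<tau>, where z = z and f = "\<lambda>z. Qsum \<tau> (z + of_int a * \<tau> + of_int b)"
      and g = "\<lambda>z. (- 1) powi (a + b) * e2pi (- (3 * (of_int a ^ 2 / 2 * \<tau> + of_int a * z))) * Qsum \<tau> z"])
  show "isCont (\<lambda>z. Qsum \<tau> (z + of_int a * \<tau> + of_int b)) z"
    by (rule isCont_o2[OF _ Qsum_isCont[OF \<tau>]]) (intro continuous_intros)
  show "isCont (\<lambda>z. (- 1) powi (a + b) * e2pi (- (3 * (of_int a ^ 2 / 2 * \<tau> + of_int a * z))) * Qsum \<tau> z) z"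
    unfolding e2pi_def by (intro continuous_intros Qsum_isCont[OF \<tau>])
  fix w
  let ?X = "of_int a ^ 2 / 2 * \<tau> + of_int a * w" and ?s = "(- 1) powi (a + b) :: complex"
  have s1: "?s * ?s = 1" by (simp add: minus_one_powi)
  have "2 * (w + of_int a * \<tau> + of_int b) = 2 * w + of_int (2 * a) * \<tau> + of_int (2 * b)" by (simp add: algebra_simps)
  moreover have "of_int (2 * a) ^ 2 / 2 * \<tau> + of_int (2 * a) * (2 * w) = 4 * ?X" by (simp add: field_simps power2_eq_square)
  ultimately have th2: "theta \<tau> (2 * (w + of_int a * \<tau> + of_int b)) = e2pi (- (4 * ?X)) * theta \<tau> (2 * w)"
    by (simp only: theta_elliptic) (simp add: minus_one_powi)
  have "(?s * e2pi (- ?X)) * (theta \<tau> w * Qsum \<tau> (w + of_int a * \<tau> + of_int b)) = eta \<tau> * theta \<tau> (2 * (w + of_int a * \<tau> + of_int b))"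
    unfolding quintuple_product[OF \<tau>, symmetric] theta_elliptic by (simp only: mult_ac)
  also have "\<dots> = (?s * ?s) * e2pi (- (4 * ?X)) * (theta \<tau> w * Qsum \<tau> w)"
    unfolding th2 quintuple_product[OF \<tau>] s1 by (simp only: mult_ac mult_1_left)
  also have "- (4 * ?X) = - ?X + - (3 * ?X)" by simp
  finally have "(?s * e2pi (- ?X)) * (theta \<tau> w * Qsum \<tau> (w + of_int a * \<tau> + of_int b))
     = (?s * e2pi (- ?X)) * (theta \<tau> w * (?s * e2pi (- (3 * ?X)) * Qsum \<tau> w))"
    unfolding e2pi_add by (simp only: mult_ac)
  moreover have "?s * e2pi (- ?X) \<noteq> 0" by (simp add: minus_one_powi)
  ultimately show "theta \<tau> w * Qsum \<tau> (w + of_int a * \<tau> + of_int b) = theta \<tau> w * (?s * e2pi (- (3 * ?X)) * Qsum \<tau> w)"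
    by (simp only: mult_cancel_left) simp
qed

lemma Qsum_0:
  assumes \<tau>: "Im \<tau> > 0"
  shows "Qsum \<tau> 0 = 2 * eta \<tau>"
proof -
  have "((\<lambda>u. chi12 u * eterm \<tau> u) has_sum (eta \<tau> + eta \<tau>)) ({u. u mod 6 = 1} \<union> {u. u mod 6 = 5})"
    by (rule has_sum_Un_disjoint[OF eta_has_sum_1[OF \<tau>] eta_has_sum_5[OF \<tau>]]) auto
  also have "?this \<longleftrightarrow> ((\<lambda>n. gterm chi12 24 n \<tau> 0) has_sum (2 * eta \<tau>)) UNIV"
  proof (subst mult_2, rule has_sum_cong_neutral)
    fix u :: int assume "u \<in> UNIV - ({u. u mod 6 = 1} \<union> {u. u mod 6 = 5})"
    then have "u mod 6 \<noteq> 1 \<and> u mod 6 \<noteq> 5" by simp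
    then have "even u \<or> u mod 3 = 0" by presburger
    then show "gterm chi12 24 u \<tau> 0 = 0" by (simp add: gterm_def chi12_coprime)
  qed (auto simp: gterm_def eterm_def)
  finally show ?thesis unfolding gsum_def by (rule infsumI)
qed

section \<open>The modular law from its generators\<close>

lemma Im_moebius_pos:
  fixes a b c d :: int
  assumes "a * d - b * c = 1" and \<tau>: "Im \<tau> > 0"
  shows "of_int c * \<tau> + of_int d \<noteq> 0"
    and "Im ((of_int a * \<tau> + of_int b) / (of_int c * \<tau> + of_int d)) > 0"
proof -
  show nz: "of_int c * \<tau> + of_int d \<noteq> 0"
  proof
    assume 0: "of_int c * \<tau> + of_int d = 0"
    then have "Im (of_int c * \<tau> + of_int d) = 0" "Re (of_int c * \<tau> + of_int d) = 0" by (simp_all only: zero_complex.simps)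
    then have "c = 0" "d = 0" using \<tau> by auto
    then show False using assms(1) by simp
  qed
  have det: "real_of_int a * of_int d - of_int b * of_int c = 1"
    using assms(1) by (metis of_int_1 of_int_diff of_int_mult)
  let ?y = "of_int c * \<tau> + of_int d"
  have pos: "(Re ?y)\<^sup>2 + (Im ?y)\<^sup>2 > 0" using nz by (metis complex_neq_0)
  have "Im (of_int a * \<tau> + of_int b) * Re ?y - Re (of_int a * \<tau> + of_int b) * Im ?y
     = Im \<tau> * (real_of_int a * of_int d - of_int b * of_int c)"
    by (simp add: algebra_simps)
  also have "\<dots> > 0" unfolding det using \<tau> by simp
  finally show "Im ((of_int a * \<tau> + of_int b) / ?y) > 0"
    unfolding Im_divide using pos by (intro divide_pos_pos)
qed

text \<open>
  The modular law for all of \<open>SL\<^sub>2(\<int>)\<close> follows from those for \<open>\<tau> + 1\<close> and \<open>- 1 / \<tau>\<close>. The set of matrices that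
  satisfy the law is stable under left multiplication by both generators, and the Euclidean algorithm on the left column
  reduces every matrix to \<open>\<plusminus>1\<close> times a translation.
\<close>

lemma modular_law_from_S_T:
  fixes \<phi> :: "complex \<Rightarrow> complex ^ 'n \<Rightarrow> complex" and q :: "complex ^ 'n \<Rightarrow> complex" and k :: int
  assumes q: "\<And>u Z. q (u *s Z) = u ^ 2 * q Z"
    and T: "\<And>\<tau> Z. Im \<tau> > 0 \<Longrightarrow> \<phi> (\<tau> + 1) Z = \<phi> \<tau> Z"
    and S: "\<And>\<tau> Z. Im \<tau> > 0 \<Longrightarrow> \<phi> (- 1 / \<tau>) ((1 / \<tau>) *s Z) = \<tau> powi k * exp (of_real pi * \<i> * (q Z / \<tau>)) * \<phi> \<tau> Z"
    and det: "a * d - b * c = (1::int)" and \<tau>: "Im \<tau> > 0"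
  shows "\<phi> ((of_int a * \<tau> + of_int b) / (of_int c * \<tau> + of_int d)) ((1 / (of_int c * \<tau> + of_int d)) *s Z)
        = (of_int c * \<tau> + of_int d) powi k * exp (of_real pi * \<i> * (of_int c * q Z / (of_int c * \<tau> + of_int d))) * \<phi> \<tau> Z"
proof -
  define law where "law = (\<lambda>a b c d :: int. \<forall>\<tau> Z. Im \<tau> > 0 \<longrightarrow>
     \<phi> ((of_int a * \<tau> + of_int b) / (of_int c * \<tau> + of_int d)) ((1 / (of_int c * \<tau> + of_int d)) *s Z)
        = (of_int c * \<tau> + of_int d) powi k * exp (of_real pi * \<i> * (of_int c * q Z / (of_int c * \<tau> + of_int d))) * \<phi> \<tau> Z)"
  have Tn: "\<phi> (\<tau> + of_nat n) Z = \<phi> \<tau> Z" if "Im \<tau> > 0" for \<tau> Z n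
  proof (induction n)
    case (Suc n)
    have "\<phi> (\<tau> + of_nat (Suc n)) Z = \<phi> ((\<tau> + of_nat n) + 1) Z" by (simp add: add_ac)
    also have "\<dots> = \<phi> (\<tau> + of_nat n) Z" by (rule T) (use that in simp)
    finally show ?case using Suc by simp
  qed simp
  have Ti: "\<phi> (\<tau> + of_int n) Z = \<phi> \<tau> Z" if "Im \<tau> > 0" for \<tau> Z n
  proof (cases "n \<ge> 0")
    case True
    then show ?thesis using Tn[OF that, of "nat n" Z] by simp
  next
    case False
    have "\<phi> ((\<tau> + of_int n) + of_nat (nat (- n))) Z = \<phi> (\<tau> + of_int n) Z" by (rule Tn) (use that in simp)
    then show ?thesis using False by simp
  qed
  have lawT: "law (a + n * c) (b + n * d) c d" if l: "law a b c d" and det: "a * d - b * c = 1" for a b c d n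
    unfolding law_def
  proof (intro allI impI)
    fix \<tau> :: complex and Z :: "complex ^ 'n" assume \<tau>: "Im \<tau> > 0"
    let ?y = "of_int c * \<tau> + of_int d"
    have y: "?y \<noteq> 0" by (rule Im_moebius_pos[OF det \<tau>])
    have "(of_int (a + n * c) * \<tau> + of_int (b + n * d)) / ?y = (of_int a * \<tau> + of_int b) / ?y + of_int n"
      using y by (simp add: field_simps)
    then show "\<phi> ((of_int (a + n * c) * \<tau> + of_int (b + n * d)) / ?y) ((1 / ?y) *s Z)
      = ?y powi k * exp (of_real pi * \<i> * (of_int c * q Z / ?y)) * \<phi> \<tau> Z"
      using l \<tau> Im_moebius_pos(2)[OF det \<tau>] by (simp only: Ti law_def)
  qed
  have lawS: "law (- c) (- d) a b" if l: "law a b c d" and det: "a * d - b * c = 1" for a b c d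
    unfolding law_def
  proof (intro allI impI)
    fix \<tau> :: complex and Z :: "complex ^ 'n" assume \<tau>: "Im \<tau> > 0"
    let ?y = "of_int c * \<tau> + of_int d" and ?x = "of_int a * \<tau> + of_int b"
    have y: "?y \<noteq> 0" by (rule Im_moebius_pos[OF det \<tau>])
    have g: "Im (?x / ?y) > 0" by (rule Im_moebius_pos[OF det \<tau>])
    have x: "?x \<noteq> 0" using g by auto
    have dc: "of_int a * of_int d - of_int b * of_int c = (1 :: complex)"
      using det by (metis of_int_1 of_int_diff of_int_mult)
    have e1: "(of_int (- c) * \<tau> + of_int (- d)) / ?x = - 1 / (?x / ?y)" using x y by (simp add: field_simps)
    have e2: "(1 / ?x) *s Z = (1 / (?x / ?y)) *s ((1 / ?y) *s Z)" using x y by (simp add: vector_smult_assoc)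
    have ex: "q ((1 / ?y) *s Z) / (?x / ?y) + of_int c * q Z / ?y = of_int a * q Z / ?x"
    proof -
      have "1 + of_int c * ?x = of_int a * ?y"
        unfolding dc[symmetric] by (simp add: algebra_simps)
      then have "q Z * (1 + of_int c * ?x) = q Z * (of_int a * ?y)" by simp
      moreover have "q ((1 / ?y) *s Z) / (?x / ?y) + of_int c * q Z / ?y = q Z * (1 + of_int c * ?x) / (?x * ?y)"
        unfolding q using x y by (simp add: divide_simps power2_eq_square) (simp add: algebra_simps)
      ultimately show ?thesis using x y by (simp add: divide_simps mult_ac)
    qed
    have "\<phi> ((of_int (- c) * \<tau> + of_int (- d)) / ?x) ((1 / ?x) *s Z)
        = (?x / ?y) powi k * exp (of_real pi * \<i> * (q ((1 / ?y) *s Z) / (?x / ?y))) * \<phi> (?x / ?y) ((1 / ?y) *s Z)"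
      unfolding e1 e2 by (rule S[OF g])
    also have "\<phi> (?x / ?y) ((1 / ?y) *s Z) = ?y powi k * exp (of_real pi * \<i> * (of_int c * q Z / ?y)) * \<phi> \<tau> Z"
      using l \<tau> unfolding law_def by blast
    also have "(?x / ?y) powi k * exp (of_real pi * \<i> * (q ((1 / ?y) *s Z) / (?x / ?y))) * (?y powi k * exp (of_real pi * \<i> * (of_int c * q Z / ?y)) * \<phi> \<tau> Z)
       = ((?x / ?y) powi k * ?y powi k) * (exp (of_real pi * \<i> * (q ((1 / ?y) *s Z) / (?x / ?y))) * exp (of_real pi * \<i> * (of_int c * q Z / ?y))) * \<phi> \<tau> Z"
      by (simp only: mult_ac)
    also have "(?x / ?y) powi k * ?y powi k = ?x powi k" using y by (simp flip: power_int_mult_distrib)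
    also have "exp (of_real pi * \<i> * (q ((1 / ?y) *s Z) / (?x / ?y))) * exp (of_real pi * \<i> * (of_int c * q Z / ?y)) = exp (of_real pi * \<i> * (of_int a * q Z / ?x))"
      unfolding exp_add[symmetric] distrib_left[symmetric] ex ..
    finally show "\<phi> ((of_int (- c) * \<tau> + of_int (- d)) / ?x) ((1 / ?x) *s Z)
      = ?x powi k * exp (of_real pi * \<i> * (of_int a * q Z / ?x)) * \<phi> \<tau> Z" .
  qed
  have law1: "law 1 0 0 1" unfolding law_def by simp
  have law2: "law (- 1) 0 0 (- 1)" using lawS[OF lawS[OF law1]] by simp
  have "law a b c d" if "a * d - b * c = 1" for a b c d
    using that
  proof (induction "nat \<bar>c\<bar>" arbitrary: a b c d rule: less_induct)
    case less
    show ?case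
    proof (cases "c = 0")
      case True
      then have "a * d = 1" using less.prems by simp
      then have "a = 1 \<and> d = 1 \<or> a = - 1 \<and> d = - 1" by (simp add: zmult_eq_1_iff)
      then show ?thesis using lawT[OF law1, of b] lawT[OF law2, of "- b"] True by auto
    next
      case False
      define n where "n = a div c"
      define a' where "a' = a - n * c"
      define b' where "b' = b - n * d"
      have "a' = a mod c" unfolding a'_def n_def by (simp add: minus_div_mult_eq_mod)
      then have small: "nat \<bar>- a'\<bar> < nat \<bar>c\<bar>" using False abs_mod_less[of c a] by simp
      have det': "c * (- b') - d * (- a') = 1" using less.prems unfolding a'_def b'_def by (simp add: algebra_simps)
      have "law c d (- a') (- b')" by (rule less.hyps[OF small det'])
      from lawS[OF this det'] have "law a' b' c d" by simp
      moreover have "a' * d - b' * c = 1" using det' by (simp add: algebra_simps)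
      ultimately have "law (a' + n * c) (b' + n * d) c d" by (rule lawT)
      then show ?thesis by (simp add: a'_def b'_def)
    qed
  qed
  then show ?thesis using det \<tau> unfolding law_def by blast
qed

section \<open>Theta-products attached to integral linear forms\<close>

text \<open>
  The linear form with integer coefficients \<open>a\<close>, on complex and on real vectors.
\<close>

definition lform :: "('n::finite \<Rightarrow> int) \<Rightarrow> complex ^ 'n \<Rightarrow> complex" where
  "lform a Z = (\<Sum>i\<in>UNIV. of_int (a i) * Z $ i)"

definition rform :: "('n::finite \<Rightarrow> int) \<Rightarrow> real ^ 'n \<Rightarrow> real" where
  "rform a x = (\<Sum>i\<in>UNIV. of_int (a i) * x $ i)"

lemma lform_add: "lform a (Z + W) = lform a Z + lform a W"
  by (simp add: lform_def sum.distrib algebra_simps)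

lemma lform_scale: "lform a (c *s Z) = c * lform a Z"
  by (simp add: lform_def sum_distrib_left mult_ac)

lemma linear_form_lform: "linear_form (lform a)"
proof -
  have "lform a (Z + W) = lform a Z + lform a W" "lform a (c *s Z) = c * lform a Z" for Z W c
    by (rule lform_add lform_scale)+
  then show ?thesis unfolding linear_form_def
    by unfold_locales (auto simp: vector_add_ldistrib vector_sadd_rdistrib vector_smult_assoc algebra_simps)
qed

lemma rform_add: "rform a (x + y) = rform a x + rform a y"
  by (simp add: rform_def sum.distrib algebra_simps)

lemma rform_scale: "rform a (c *\<^sub>R x) = c * rform a x"
  by (simp add: rform_def sum_distrib_left mult_ac)

lemma lform_cvec: "lform a (cvec x) = of_real (rform a x)"
  by (simp add: lform_def rform_def cvec_def)

lemma rform_axis: "rform a (axis i 1) = of_int (a i)"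
  by (simp add: rform_def axis_def if_distrib[of "\<lambda>x. _ * x"] cong: if_cong)

text \<open>
  The bilinear form for which the theta-product with the forms \<open>ls\<close> in \<open>\<vartheta>\<close> and \<open>ms\<close> in \<open>\<vartheta>\<^bsub>3/2\<^esub>\<close> has index
  one; the weights \<open>1\<close> and \<open>3\<close> are twice the indices of the two functions.
\<close>

definition prod_form :: "('n::finite \<Rightarrow> int) list \<Rightarrow> ('n \<Rightarrow> int) list \<Rightarrow> real ^ 'n \<Rightarrow> real ^ 'n \<Rightarrow> real" where
  "prod_form ls ms x y = (\<Sum>a\<leftarrow>ls. rform a x * rform a y) + 3 * (\<Sum>a\<leftarrow>ms. rform a x * rform a y)"

lemma bilinear_sum_list_rform: "bilinear (\<lambda>x y. \<Sum>a\<leftarrow>ls. rform a x * rform a y)"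
  unfolding bilinear_def
  by (auto intro!: linearI simp: rform_add rform_scale algebra_simps sum_list_addf sum_list_const_mult)

lemma bilinear_prod_form: "bilinear (prod_form ls ms)"
proof -
  note b = bilinear_sum_list_rform
  show ?thesis unfolding prod_form_def bilinear_def
    by (auto intro!: linearI simp: bilinear_ladd[OF b] bilinear_radd[OF b] bilinear_lmul[OF b] bilinear_rmul[OF b] algebra_simps)
qed

lemma prod_form_sym: "prod_form ls ms x y = prod_form ls ms y x"
  by (simp add: prod_form_def mult.commute)

lemma cform_add: "cform (\<lambda>x y. B x y + C x y) Z W = cform B Z W + cform C Z W"
  by (simp add: cform_def sum.distrib algebra_simps)

lemma cform_scale: "cform (\<lambda>x y. c * B x y) Z W = of_real c * cform B Z W"
  by (simp add: cform_def sum_distrib_left mult_ac)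

lemma cform_rform: "cform (\<lambda>x y. rform a x * rform a y) Z W = lform a Z * lform a W"
  unfolding cform_def rform_axis lform_def sum_product by (intro sum.cong refl) simp

lemma cform_prod_form:
  "cform (prod_form ls ms) Z W = (\<Sum>a\<leftarrow>ls. lform a Z * lform a W) + 3 * (\<Sum>a\<leftarrow>ms. lform a Z * lform a W)"
proof -
  have s: "cform (\<lambda>x y. \<Sum>a\<leftarrow>ls. rform a x * rform a y) Z W = (\<Sum>a\<leftarrow>ls. lform a Z * lform a W)" for ls
  proof (induction ls)
    case Nil show ?case by (simp add: cform_def)
  next
    case (Cons a ls)
    then show ?case
      using cform_add[of "\<lambda>x y. rform a x * rform a y" "\<lambda>x y. \<Sum>a\<leftarrow>ls. rform a x * rform a y" Z W]
      by (simp add: cform_rform)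
  qed
  have "prod_form ls ms = (\<lambda>x y. (\<Sum>a\<leftarrow>ls. rform a x * rform a y) + 3 * (\<Sum>a\<leftarrow>ms. rform a x * rform a y))"
    by (simp add: fun_eq_iff prod_form_def)
  then show ?thesis by (simp add: cform_add cform_scale s)
qed

text \<open>
  The theta-product with \<open>\<eta>\<close>-exponent \<open>m\<close>.
\<close>

definition theta_prod :: "int \<Rightarrow> ('n::finite \<Rightarrow> int) list \<Rightarrow> ('n \<Rightarrow> int) list \<Rightarrow> complex \<Rightarrow> complex ^ 'n \<Rightarrow> complex" where
  "theta_prod m ls ms \<tau> Z = eta \<tau> powi m * (\<Prod>a\<leftarrow>ls. theta \<tau> (lform a Z)) * (\<Prod>a\<leftarrow>ms. theta_3_2 \<tau> (lform a Z))"

lemma theta_product_theta_prod: "theta_product (theta_prod m ls ms)"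
  unfolding theta_product_def theta_prod_def
  by (rule exI[of _ "map lform ls"], rule exI[of _ "map lform ms"], rule exI[of _ m])
     (auto simp: linear_form_lform o_def)

lemma theta_prod_Qsum:
  "Im \<tau> > 0 \<Longrightarrow> theta_prod m ls ms \<tau> Z = eta \<tau> powi m * (\<Prod>a\<leftarrow>ls. theta \<tau> (lform a Z)) * (\<Prod>a\<leftarrow>ms. Qsum \<tau> (lform a Z))"
  by (simp add: theta_prod_def theta_3_2_eq)

text \<open>
  The characters of \<open>\<vartheta>\<close>, \<open>\<vartheta>\<^bsub>3/2\<^esub>\<close> and \<open>\<eta>\<close> at the translation are \<open>e2pi\<close> of \<open>1/8\<close>, \<open>1/24\<close> and \<open>1/24\<close>. The two
  hypotheses on \<open>r\<close> and \<open>s\<close> make the total exponent the integer \<open>s\<close>.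
\<close>

lemma theta_prod_T:
  assumes \<tau>: "Im \<tau> > 0" and r: "int (length ls) + r = 8 * s" "m + int (length ms) = 3 * r"
  shows "theta_prod m ls ms (\<tau> + 1) Z = theta_prod m ls ms \<tau> Z"
proof -
  have \<tau>': "Im (\<tau> + 1) > 0" using \<tau> by simp
  have 1: "(\<Prod>a\<leftarrow>ls. theta (\<tau> + 1) (lform a Z)) = e2pi (of_nat (length ls) / 8) * (\<Prod>a\<leftarrow>ls. theta \<tau> (lform a Z))"
    by (induction ls) (auto simp: theta_T e2pi_add add_divide_distrib)
  have 2: "(\<Prod>a\<leftarrow>ms. Qsum (\<tau> + 1) (lform a Z)) = e2pi (of_nat (length ms) / 24) * (\<Prod>a\<leftarrow>ms. Qsum \<tau> (lform a Z))"
    by (induction ms) (auto simp: Qsum_T[OF \<tau>] e2pi_add add_divide_distrib)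
  have 3: "eta (\<tau> + 1) powi m = e2pi (of_int m / 24) * eta \<tau> powi m"
    unfolding eta_T power_int_mult_distrib e2pi_powi by simp
  have "e2pi (of_int m / 24) * e2pi (of_nat (length ls) / 8) * e2pi (of_nat (length ms) / 24)
      = e2pi (of_int (m + 3 * int (length ls) + int (length ms)) / 24)"
    unfolding e2pi_add[symmetric] by (simp add: add_divide_distrib)
  also have "m + 3 * int (length ls) + int (length ms) = 24 * s" using r by simp
  also have "e2pi (of_int (24 * s) / 24) = 1" by simp
  finally have 4: "e2pi (of_int m / 24) * e2pi (of_nat (length ls) / 8) * e2pi (of_nat (length ms) / 24) = 1" .
  have "theta_prod m ls ms (\<tau> + 1) Z = (e2pi (of_int m / 24) * e2pi (of_nat (length ls) / 8) * e2pi (of_nat (length ms) / 24)) * theta_prod m ls ms \<tau> Z"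
    unfolding theta_prod_Qsum[OF \<tau>] theta_prod_Qsum[OF \<tau>'] 1 2 3 by (simp only: mult_ac)
  then show ?thesis unfolding 4 by simp
qed

text \<open>
  The total factor is \<open>d\<^bsup>3r\<^esup> c\<^bsup>8s-r\<^esup> = (\<tau> c)\<^bsup>r\<^esup> c\<^bsup>8s-r\<^esup> = \<tau>\<^bsup>4s+r\<^esup>\<close>, because \<open>c\<^sup>8 = \<tau>\<^sup>4\<close>. In particular the
  weight is \<open>4 s + r\<close>.
\<close>

lemma theta_prod_S:
  assumes \<tau>: "Im \<tau> > 0" and r: "int (length ls) + r = 8 * s" "m + int (length ms) = 3 * r"
  shows "theta_prod m ls ms (- 1 / \<tau>) ((1 / \<tau>) *s Z)
    = \<tau> powi (4 * s + r) * exp (of_real pi * \<i> * (cform (prod_form ls ms) Z Z / \<tau>)) * theta_prod m ls ms \<tau> Z"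
proof -
  have t0: "\<tau> \<noteq> 0" using \<tau> by auto
  obtain c d where c0: "c \<noteq> 0" and d0: "d \<noteq> 0" and c2: "c ^ 2 = \<i> * \<tau>" and d3: "d ^ 3 = \<tau> * c"
    and e: "eta (- 1 / \<tau>) = d * eta \<tau>"
    and th: "\<And>z. theta (- 1 / \<tau>) (z / \<tau>) = c * e2pi (z ^ 2 / (2 * \<tau>)) * theta \<tau> z"
    using theta_eta_S[OF \<tau>] by metis
  note Q = Qsum_S[OF \<tau> c0 e th]
  define A where "A = (\<Sum>a\<leftarrow>ls. lform a Z * lform a Z)"
  define B where "B = (\<Sum>a\<leftarrow>ms. lform a Z * lform a Z)"
  have sc: "lform a ((1 / \<tau>) *s Z) = lform a Z / \<tau>" for a by (simp add: lform_scale)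
  have 1: "(\<Prod>a\<leftarrow>ls. theta (- 1 / \<tau>) (lform a Z / \<tau>)) = c ^ length ls * e2pi (A / (2 * \<tau>)) * (\<Prod>a\<leftarrow>ls. theta \<tau> (lform a Z))"
    unfolding A_def
  proof (induction ls)
    case (Cons a ls)
    show ?case
      unfolding list.map prod_list.Cons sum_list.Cons length_Cons power_Suc Cons.IH
      unfolding th[of "lform a Z"] power2_eq_square
        add_divide_distrib e2pi_add
      by (simp only: mult_ac)
  qed simp
  have 2: "(\<Prod>a\<leftarrow>ms. Qsum (- 1 / \<tau>) (lform a Z / \<tau>)) = d ^ length ms * e2pi (3 * B / (2 * \<tau>)) * (\<Prod>a\<leftarrow>ms. Qsum \<tau> (lform a Z))"
    unfolding B_def
  proof (induction ms)
    case (Cons a ms)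
    show ?case
      unfolding list.map prod_list.Cons sum_list.Cons length_Cons power_Suc Cons.IH
      unfolding Q[of "lform a Z"] power2_eq_square
        distrib_left add_divide_distrib e2pi_add
      by (simp only: mult_ac)
  qed simp
  have 3: "eta (- 1 / \<tau>) powi m = d powi m * eta \<tau> powi m" unfolding e by (simp add: power_int_mult_distrib)
  have c8: "c ^ 8 = \<tau> ^ 4"
  proof -
    have "c ^ 8 = (c ^ 2) ^ 4" by (simp flip: power_mult)
    then show ?thesis unfolding c2 power_mult_distrib by simp
  qed
  have "d powi m * d ^ length ms = d powi (3 * r)"
    using d0 by (simp add: power_int_add flip: r(2))
  also have "\<dots> = (\<tau> * c) powi r" unfolding d3[symmetric] by (simp add: power_int_mult)
  finally have "d powi m * c ^ length ls * d ^ length ms = \<tau> powi r * (c powi int (length ls) * c powi r)"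
    by (simp add: power_int_mult_distrib mult_ac)
  also have "c powi int (length ls) * c powi r = c powi (8 * s)" using power_int_add[of c "int (length ls)" r] c0 unfolding r(1) by simp
  also have "\<dots> = (\<tau> ^ 4) powi s" unfolding c8[symmetric] by (simp add: power_int_mult)
  also have "\<tau> powi r * (\<tau> ^ 4) powi s = \<tau> powi (4 * s + r)"
  proof -
    have "\<tau> powi (4 * s) = (\<tau> ^ 4) powi s" unfolding power_int_mult by simp
    then show ?thesis by (simp only: power_int_add[OF disjI1[OF t0]] mult.commute)
  qed
  finally have 4: "d powi m * c ^ length ls * d ^ length ms = \<tau> powi (4 * s + r)" .
  have "e2pi (A / (2 * \<tau>)) * e2pi (3 * B / (2 * \<tau>)) = e2pi ((A + 3 * B) / (2 * \<tau>))"
    by (simp add: e2pi_add add_divide_distrib)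
  also have "\<dots> = exp (of_real pi * \<i> * ((A + 3 * B) / \<tau>))"
  proof -
    have "2 * of_real pi * \<i> * (X / (2 * \<tau>)) = of_real pi * \<i> * (X / \<tau>)" for X by simp
    then show ?thesis unfolding e2pi_def by (simp only:)
  qed
  finally have 5: "e2pi (A / (2 * \<tau>)) * e2pi (3 * B / (2 * \<tau>)) = exp (of_real pi * \<i> * (cform (prod_form ls ms) Z Z / \<tau>))"
    unfolding cform_prod_form A_def B_def .
  have "theta_prod m ls ms (- 1 / \<tau>) ((1 / \<tau>) *s Z)
     = (d powi m * c ^ length ls * d ^ length ms) * (e2pi (A / (2 * \<tau>)) * e2pi (3 * B / (2 * \<tau>))) * theta_prod m ls ms \<tau> Z"
    unfolding theta_prod_Qsum[OF \<tau>] theta_prod_Qsum[OF Im_minus_inverse_pos[OF \<tau>]] sc 1 2 3 by (simp only: mult_ac)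
  then show ?thesis unfolding 4 5 .
qed

lemma rform_even:
  fixes x :: "real ^ 'n::finite"
  assumes "\<And>i. \<exists>k::int. x $ i = 2 * of_int k"
  shows "\<exists>k::int. rform a x = 2 * of_int k"
proof -
  obtain k where "\<And>i. x $ i = 2 * of_int (k i :: int)" using assms by metis
  then have "rform a x = 2 * of_int (\<Sum>i\<in>UNIV. a i * k i)"
    by (simp add: rform_def sum_distrib_left mult_ac)
  then show ?thesis by blast
qed

lemma theta_elliptic_even:
  fixes a b :: int
  shows "theta \<tau> (z + \<tau> * (2 * of_int a) + 2 * of_int b)
       = exp (- (of_real pi * \<i> * ((2 * of_int a) * (2 * of_int a) * \<tau> + 2 * ((2 * of_int a) * z)))) * theta \<tau> z"
proof -
  have 1: "z + \<tau> * (2 * of_int a) + 2 * of_int b = z + of_int (2 * a) * \<tau> + of_int (2 * b)" by simp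
  show ?thesis unfolding 1 theta_elliptic e2pi_def by (simp add: minus_one_powi field_simps power2_eq_square)
qed

lemma Qsum_elliptic_even:
  fixes a b :: int
  assumes "Im \<tau> > 0"
  shows "Qsum \<tau> (z + \<tau> * (2 * of_int a) + 2 * of_int b)
       = exp (- (of_real pi * \<i> * (3 * ((2 * of_int a) * (2 * of_int a)) * \<tau> + 2 * (3 * ((2 * of_int a) * z))))) * Qsum \<tau> z"
proof -
  have 1: "z + \<tau> * (2 * of_int a) + 2 * of_int b = z + of_int (2 * a) * \<tau> + of_int (2 * b)" by simp
  show ?thesis unfolding 1 Qsum_elliptic[OF assms] e2pi_def by (simp add: minus_one_powi field_simps power2_eq_square)
qed

text \<open>
  Translations by vectors with even coordinates produce no sign, since every integral linear form takes even values
  on them.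
\<close>

lemma theta_prod_elliptic:
  fixes x y :: "real ^ 'n::finite"
  assumes \<tau>: "Im \<tau> > 0"
    and x: "\<And>i. \<exists>k::int. x $ i = 2 * of_int k" and y: "\<And>i. \<exists>k::int. y $ i = 2 * of_int k"
  shows "theta_prod m ls ms \<tau> (Z + \<tau> *s cvec x + cvec y)
    = exp (- (of_real pi * \<i> * (of_real (prod_form ls ms x x) * \<tau> + 2 * cform (prod_form ls ms) (cvec x) Z))) * theta_prod m ls ms \<tau> Z"
proof -
  have l: "lform a (Z + \<tau> *s cvec x + cvec y) = lform a Z + \<tau> * of_real (rform a x) + of_real (rform a y)" for a
    by (simp add: lform_add lform_scale lform_cvec)
  have th: "theta \<tau> (lform a (Z + \<tau> *s cvec x + cvec y))
     = exp (- (of_real pi * \<i> * (of_real (rform a x * rform a x) * \<tau> + 2 * (lform a (cvec x) * lform a Z)))) * theta \<tau> (lform a Z)" for a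
  proof -
    obtain k j :: int where "rform a x = 2 * of_int k" "rform a y = 2 * of_int j" using rform_even x y by metis
    then show ?thesis using theta_elliptic_even[of \<tau> "lform a Z" k j] unfolding l by (simp add: lform_cvec)
  qed
  have q: "Qsum \<tau> (lform a (Z + \<tau> *s cvec x + cvec y))
     = exp (- (of_real pi * \<i> * (3 * of_real (rform a x * rform a x) * \<tau> + 2 * (3 * (lform a (cvec x) * lform a Z))))) * Qsum \<tau> (lform a Z)" for a
  proof -
    obtain k j :: int where "rform a x = 2 * of_int k" "rform a y = 2 * of_int j" using rform_even x y by metis
    then show ?thesis using Qsum_elliptic_even[OF \<tau>, of "lform a Z" k j] unfolding l by (simp add: lform_cvec)
  qed
  have 1: "(\<Prod>a\<leftarrow>ls. theta \<tau> (lform a (Z + \<tau> *s cvec x + cvec y))) =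
    exp (- (of_real pi * \<i> * (of_real (\<Sum>a\<leftarrow>ls. rform a x * rform a x) * \<tau> + 2 * (\<Sum>a\<leftarrow>ls. lform a (cvec x) * lform a Z)))) * (\<Prod>a\<leftarrow>ls. theta \<tau> (lform a Z))"
  proof (induction ls)
    case (Cons a ls)
    have ex: "- (of_real pi * \<i> * (of_real (u + U) * \<tau> + 2 * (v + V)))
        = - (of_real pi * \<i> * (of_real u * \<tau> + 2 * v)) + - (of_real pi * \<i> * (of_real U * \<tau> + 2 * V))"
      for u U :: real and v V :: complex by (simp add: algebra_simps)
    show ?case unfolding list.map prod_list.Cons sum_list.Cons Cons.IH ex exp_add unfolding th[of a]
      by (simp only: mult_ac)
  qed simp
  have 2: "(\<Prod>a\<leftarrow>ms. Qsum \<tau> (lform a (Z + \<tau> *s cvec x + cvec y))) =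
    exp (- (of_real pi * \<i> * (3 * of_real (\<Sum>a\<leftarrow>ms. rform a x * rform a x) * \<tau> + 2 * (3 * (\<Sum>a\<leftarrow>ms. lform a (cvec x) * lform a Z))))) * (\<Prod>a\<leftarrow>ms. Qsum \<tau> (lform a Z))"
  proof (induction ms)
    case (Cons a ms)
    have ex: "- (of_real pi * \<i> * (3 * of_real (u + U) * \<tau> + 2 * (3 * (v + V))))
        = - (of_real pi * \<i> * (3 * of_real u * \<tau> + 2 * (3 * v))) + - (of_real pi * \<i> * (3 * of_real U * \<tau> + 2 * (3 * V)))"
      for u U :: real and v V :: complex by (simp add: algebra_simps)
    show ?case unfolding list.map prod_list.Cons sum_list.Cons Cons.IH ex exp_add unfolding q[of a]
      by (simp only: mult_ac)
  qed simp
  have 3: "exp (- (of_real pi * \<i> * (of_real (\<Sum>a\<leftarrow>ls. rform a x * rform a x) * \<tau> + 2 * (\<Sum>a\<leftarrow>ls. lform a (cvec x) * lform a Z))))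
     * exp (- (of_real pi * \<i> * (3 * of_real (\<Sum>a\<leftarrow>ms. rform a x * rform a x) * \<tau> + 2 * (3 * (\<Sum>a\<leftarrow>ms. lform a (cvec x) * lform a Z)))))
     = exp (- (of_real pi * \<i> * (of_real (prod_form ls ms x x) * \<tau> + 2 * cform (prod_form ls ms) (cvec x) Z)))"
    unfolding exp_add[symmetric] cform_prod_form prod_form_def by (simp add: algebra_simps)
  show ?thesis
    unfolding theta_prod_Qsum[OF \<tau>] 1 2 3[symmetric] by (simp only: mult_ac)
qed

section \<open>Holomorphy of theta-products\<close>

text \<open>
  Complex differentiability of a function of \<open>\<tau>\<close> and \<open>Z\<close> at one point: the total derivative exists and is complex linear.
\<close>

definition hol_at :: "(complex \<Rightarrow> complex ^ 'n \<Rightarrow> complex) \<Rightarrow> complex \<Rightarrow> complex ^ 'n \<Rightarrow> bool" where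
  "hol_at F \<tau> Z \<longleftrightarrow> (\<exists>D. ((\<lambda>(t, w). F t w) has_derivative D) (at (\<tau>, Z)) \<and> (\<forall>c t w. D (c * t, c *s w) = c * D (t, w)))"

lemma hol_at_const: "hol_at (\<lambda>t w. c) \<tau> Z"
  unfolding hol_at_def by (rule exI[of _ "\<lambda>_. 0"]) (simp add: case_prod_unfold)

lemma hol_at_mult:
  assumes "hol_at F \<tau> Z" "hol_at G \<tau> Z"
  shows "hol_at (\<lambda>t w. F t w * G t w) \<tau> Z"
proof -
  obtain D E where D: "((\<lambda>(t, w). F t w) has_derivative D) (at (\<tau>, Z))" "\<And>c t w. D (c * t, c *s w) = c * D (t, w)"
    and E: "((\<lambda>(t, w). G t w) has_derivative E) (at (\<tau>, Z))" "\<And>c t w. E (c * t, c *s w) = c * E (t, w)"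
    using assms unfolding hol_at_def by metis
  have "((\<lambda>x. (case x of (t, w) \<Rightarrow> F t w) * (case x of (t, w) \<Rightarrow> G t w)) has_derivative
      (\<lambda>h. F \<tau> Z * E h + D h * G \<tau> Z)) (at (\<tau>, Z))"
    using has_derivative_mult[OF D(1) E(1)] by simp
  then show ?thesis unfolding hol_at_def
    by (intro exI[of _ "\<lambda>h. F \<tau> Z * E h + D h * G \<tau> Z"]) (auto simp: case_prod_unfold D(2) E(2) algebra_simps)
qed

lemma hol_at_power:
  assumes "hol_at F \<tau> Z"
  shows "hol_at (\<lambda>t w. F t w ^ n) \<tau> Z"
  by (induction n) (auto intro: hol_at_const hol_at_mult assms)

lemma hol_at_prod_list:
  assumes "\<And>a. a \<in> set xs \<Longrightarrow> hol_at (F a) \<tau> Z"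
  shows "hol_at (\<lambda>t w. \<Prod>a\<leftarrow>xs. F a t w) \<tau> Z"
  using assms by (induction xs) (auto intro: hol_at_const hol_at_mult)

lemma hol_at_inverse:
  assumes "hol_at F \<tau> Z" "F \<tau> Z \<noteq> 0"
  shows "hol_at (\<lambda>t w. inverse (F t w)) \<tau> Z"
proof -
  obtain D where D: "((\<lambda>(t, w). F t w) has_derivative D) (at (\<tau>, Z))" "\<And>c t w. D (c * t, c *s w) = c * D (t, w)"
    using assms unfolding hol_at_def by metis
  have "((\<lambda>x. inverse (case x of (t, w) \<Rightarrow> F t w)) has_derivative
      (\<lambda>h. - (inverse (F \<tau> Z) * D h * inverse (F \<tau> Z)))) (at (\<tau>, Z))"
    using Deriv.has_derivative_inverse[OF _ D(1)] assms(2) by simp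
  then show ?thesis unfolding hol_at_def
    by (intro exI[of _ "\<lambda>h. - (inverse (F \<tau> Z) * D h * inverse (F \<tau> Z))"]) (auto simp: case_prod_unfold D(2) algebra_simps)
qed

lemma hol_at_power_int:
  assumes "hol_at F \<tau> Z" "F \<tau> Z \<noteq> 0"
  shows "hol_at (\<lambda>t w. F t w powi n) \<tau> Z"
proof (cases "n \<ge> 0")
  case True
  then show ?thesis using hol_at_power[OF assms(1), of "nat n"] by (simp add: power_int_def)
next
  case False
  then show ?thesis using hol_at_power[OF hol_at_inverse[OF assms], of "nat (- n)"] by (simp add: power_int_def)
qed

lemma hol_at_cong:
  assumes "hol_at F \<tau> Z" "Im \<tau> > 0" "\<And>t w. Im t > 0 \<Longrightarrow> F t w = G t w"
  shows "hol_at G \<tau> Z"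
proof -
  obtain D where D: "((\<lambda>(t, w). F t w) has_derivative D) (at (\<tau>, Z))" "\<And>c t w. D (c * t, c *s w) = c * D (t, w)"
    using assms unfolding hol_at_def by metis
  have "open ({t. Im t > 0} \<times> (UNIV :: (complex ^ 'a) set))"
    by (intro open_Times open_halfspace_Im_gt open_UNIV)
  then have "((\<lambda>(t, w). G t w) has_derivative D) (at (\<tau>, Z))"
    by (rule has_derivative_transform_within_open[OF D(1)]) (use assms in auto)
  then show ?thesis using D(2) unfolding hol_at_def by blast
qed

lemma bounded_linear_lform: "bounded_linear (lform a)"
  unfolding lform_def
  by (intro bounded_linear_sum bounded_linear_const_mult bounded_linear_vec_nth)

lemma hol_at_gsum:
  assumes "\<And>n. norm (c n) \<le> 1" "D > 0" "Im \<tau> > 0"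
  shows "hol_at (\<lambda>t w. gsum c D t (lform a w)) \<tau> Z"
proof -
  obtain A B where AB: "((\<lambda>(t, w). gsum c D t w) has_derivative (\<lambda>(h, k). A * h + B * k)) (at (\<tau>, lform a Z))"
    using gsum_has_derivative[of c D \<tau> "lform a Z"] assms by blast
  have "((\<lambda>x. (fst x, lform a (snd x))) has_derivative (\<lambda>h. (fst h, lform a (snd h)))) (at (\<tau>, Z))"
    by (intro has_derivative_Pair has_derivative_fst has_derivative_ident
        bounded_linear.has_derivative[OF bounded_linear_lform] has_derivative_snd)
  moreover have "((\<lambda>(t, w). gsum c D t w) has_derivative (\<lambda>(h, k). A * h + B * k)) (at (fst (\<tau>, Z), lform a (snd (\<tau>, Z))))"
    using AB by simp
  ultimately have "((\<lambda>x. (\<lambda>(t, w). gsum c D t w) (fst x, lform a (snd x))) has_derivative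
      (\<lambda>h. (\<lambda>(h, k). A * h + B * k) (fst h, lform a (snd h)))) (at (\<tau>, Z))"
    by (rule has_derivative_compose)
  then
  have "((\<lambda>(t, w). gsum c D t (lform a w)) has_derivative (\<lambda>h. A * fst h + B * lform a (snd h))) (at (\<tau>, Z))"
    by (simp add: case_prod_unfold)
  then show ?thesis unfolding hol_at_def
    by (intro exI[of _ "\<lambda>h. A * fst h + B * lform a (snd h)"]) (auto simp: lform_scale algebra_simps)
qed

lemma theta_prod_holomorphic:
  fixes ls ms :: "('n::finite \<Rightarrow> int) list"
  shows "holomorphic_on_upper (theta_prod m ls ms)"
  unfolding holomorphic_on_upper_def hol_at_def[symmetric]
proof (intro allI impI)
  fix \<tau> :: complex and Z :: "complex ^ 'n"
  assume \<tau>: "Im \<tau> > 0"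
  have th: "hol_at (\<lambda>t w. theta t (lform a w)) \<tau> Z" for a
    unfolding theta_gsum by (rule hol_at_gsum) (auto simp: kronecker_m4_le \<tau>)
  have Q: "hol_at (\<lambda>t w. Qsum t (lform a w)) \<tau> Z" for a
    by (rule hol_at_gsum) (auto simp: chi12_le \<tau>)
  have "hol_at (\<lambda>t w. (1/2) * Qsum t (lform (\<lambda>_. 0) w)) \<tau> Z" by (intro hol_at_mult hol_at_const Q)
  then have e: "hol_at (\<lambda>t w. eta t) \<tau> Z"
    by (rule hol_at_cong[OF _ \<tau>]) (simp add: Qsum_0 lform_def)
  have "hol_at (\<lambda>t w. eta t powi m * (\<Prod>a\<leftarrow>ls. theta t (lform a w)) * (\<Prod>a\<leftarrow>ms. Qsum t (lform a w))) \<tau> Z"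
    by (intro hol_at_mult hol_at_prod_list hol_at_power_int e th Q eta_nonzero[OF \<tau>])
  then show "hol_at (theta_prod m ls ms) \<tau> Z"
    by (rule hol_at_cong[OF _ \<tau>]) (simp add: theta_prod_Qsum)
qed

lemma theta_prod_nonzero:
  assumes \<tau>: "Im \<tau> > 0" "\<And>a. a \<in> set ls \<Longrightarrow> theta \<tau> (lform a Z) \<noteq> 0" "\<And>a. a \<in> set ms \<Longrightarrow> theta \<tau> (2 * lform a Z) \<noteq> 0"
  shows "theta_prod m ls ms \<tau> Z \<noteq> 0"
proof -
  have "Qsum \<tau> (lform a Z) \<noteq> 0" if "a \<in> set ms" for a
    using quintuple_product[OF \<tau>(1), of "lform a Z"] assms(3)[OF that] eta_nonzero[OF \<tau>(1)] by auto
  then show ?thesis using assms eta_nonzero[OF \<tau>(1)]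
    unfolding theta_prod_Qsum[OF \<tau>(1)] by (auto simp: prod_list_zero_iff)
qed

section \<open>The lattice and Fourier expansions\<close>

text \<open>
  The lattice \<open>(2\<int>)\<^sup>n\<close>. It is even for every form \<open>prod_form ls ms\<close>, and the elliptic law has no sign on it.
\<close>

definition even_lattice :: "(real ^ 'n::finite) set" where
  "even_lattice = {x. \<forall>i. \<exists>k::int. x $ i = 2 * of_int k}"

lemma prod_form_nonneg: "prod_form ls ms x x \<ge> 0"
  unfolding prod_form_def by (intro add_nonneg_nonneg mult_nonneg_nonneg sum_list_nonneg) auto

lemma prod_form_pos:
  assumes sep: "\<And>x. (\<And>a. a \<in> set ls \<union> set ms \<Longrightarrow> rform a x = 0) \<Longrightarrow> x = 0" and x: "x \<noteq> 0"
  shows "prod_form ls ms x x > 0"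
proof (rule ccontr)
  assume "\<not> prod_form ls ms x x > 0"
  moreover have nn: "(\<Sum>a\<leftarrow>ls. rform a x * rform a x) \<ge> 0" for ls by (rule sum_list_nonneg) auto
  ultimately have "(\<Sum>a\<leftarrow>ls. rform a x * rform a x) = 0" "(\<Sum>a\<leftarrow>ms. rform a x * rform a x) = 0"
    using nn[of ls] nn[of ms] unfolding prod_form_def by linarith+
  then have "\<forall>v\<in>set (map (\<lambda>a. rform a x * rform a x) ls). v = 0" "\<forall>v\<in>set (map (\<lambda>a. rform a x * rform a x) ms). v = 0"
    by (subst sum_list_nonneg_eq_0_iff[symmetric]; auto)+
  then have "rform a x = 0" if "a \<in> set ls \<union> set ms" for a using that by auto
  then show False using sep x by blast
qed

lemma pos_def_even_lattice_prod_form: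
  fixes ls ms :: "('n::finite \<Rightarrow> int) list"
  assumes sep: "\<And>x. (\<And>a. a \<in> set ls \<union> set ms \<Longrightarrow> rform a x = 0) \<Longrightarrow> x = 0"
  shows "pos_def_even_lattice even_lattice (prod_form ls ms)"
proof -
  define b :: "'n \<Rightarrow> real ^ 'n" where "b = (\<lambda>i. 2 *\<^sub>R axis i 1)"
  have inj: "inj b" by (auto simp: inj_def b_def axis_eq_axis)
  have ind: "independent (range b)"
  proof -
    have "range (\<lambda>i. axis i (1::real)) \<subseteq> (Basis :: (real ^ 'n) set)" by (auto simp: Basis_vec_def)
    then have "independent (range (\<lambda>i. axis i (1::real)) :: (real ^ 'n) set)"
      using independent_Basis independent_mono by blast
    then have "independent ((\<lambda>x. 2 *\<^sub>R x) ` range (\<lambda>i. axis i (1::real) :: real ^ 'n))"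
      by (rule linear_independent_injective_image[rotated]) (auto intro!: linearI inj_onI simp: algebra_simps)
    then show ?thesis by (simp add: b_def image_image)
  qed
  have comp: "(\<Sum>i\<in>UNIV. of_int (c i) *\<^sub>R b i) $ j = 2 * of_int (c j)" for c :: "'n \<Rightarrow> int" and j
    by (simp add: b_def axis_def if_distrib[of "\<lambda>x. _ * x"] cong: if_cong)
  have L: "even_lattice = {\<Sum>i\<in>UNIV. of_int (c i) *\<^sub>R b i | c :: 'n \<Rightarrow> int. True}"
  proof (intro set_eqI iffI)
    fix x :: "real ^ 'n" assume "x \<in> even_lattice"
    then obtain c where c: "\<And>i. x $ i = 2 * of_int (c i :: int)" unfolding even_lattice_def by (simp; metis)
    then have "x = (\<Sum>i\<in>UNIV. of_int (c i) *\<^sub>R b i)" unfolding vec_eq_iff comp by simp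
    then show "x \<in> {\<Sum>i\<in>UNIV. of_int (c i) *\<^sub>R b i | c :: 'n \<Rightarrow> int. True}" by blast
  next
    fix x :: "real ^ 'n" assume "x \<in> {\<Sum>i\<in>UNIV. of_int (c i) *\<^sub>R b i | c :: 'n \<Rightarrow> int. True}"
    then obtain c :: "'n \<Rightarrow> int" where "x = (\<Sum>i\<in>UNIV. of_int (c i) *\<^sub>R b i)" by blast
    then show "x \<in> even_lattice" unfolding even_lattice_def using comp by auto
  qed
  have even: "\<exists>k::int. prod_form ls ms x y = 2 * of_int k" if xy: "x \<in> even_lattice" "y \<in> even_lattice" for x y
  proof -
    have re: "\<exists>k::int. rform a z = 2 * of_int k" if "z \<in> even_lattice" for a and z :: "real ^ 'n"
      by (rule rform_even) (use that in \<open>simp add: even_lattice_def\<close>)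
    have s: "\<exists>k::int. (\<Sum>a\<leftarrow>ls. rform a x * rform a y) = 2 * of_int k" for ls :: "('n \<Rightarrow> int) list"
    proof (induction ls)
      case (Cons a ls)
      obtain k where k: "(\<Sum>a\<leftarrow>ls. rform a x * rform a y) = 2 * of_int (k :: int)" using Cons by blast
      obtain i j where "rform a x = 2 * of_int (i :: int)" "rform a y = 2 * of_int (j :: int)" using re[OF xy(1)] re[OF xy(2)] by blast
      then show ?case using k by (intro exI[of _ "2 * i * j + k"]) (simp add: algebra_simps)
    qed (auto intro: exI[of _ 0])
    obtain i j where "(\<Sum>a\<leftarrow>ls. rform a x * rform a y) = 2 * of_int (i :: int)" "(\<Sum>a\<leftarrow>ms. rform a x * rform a y) = 2 * of_int (j :: int)"
      using s[of ls] s[of ms] by blast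
    then show ?thesis unfolding prod_form_def by (intro exI[of _ "i + 3 * j"]) simp
  qed
  have int: "prod_form ls ms x y \<in> \<int>" if xy: "x \<in> even_lattice" "y \<in> even_lattice" for x y
  proof -
    obtain k :: int where k: "prod_form ls ms x y = 2 * of_int k" using even[OF xy] by blast
    show ?thesis unfolding k by simp
  qed
  show ?thesis unfolding pos_def_even_lattice_def
    by (intro conjI exI[of _ b] inj ind L bilinear_prod_form allI impI ballI prod_form_sym prod_form_pos[OF sep] int even)
qed

text \<open>
  An expansion over any index set \<open>K\<close> whose exponents \<open>(N k, l k)\<close> lie on the paraboloid \<open>2 n = (l, l)\<close> is a Fourier
  expansion of the required kind: it is extended by zero coefficients. The coefficient at \<open>(n, l)\<close> is well
  defined because \<open>l\<close> is injective on \<open>K\<close>.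
\<close>

lemma fourier_clause:
  fixes l :: "'k \<Rightarrow> real ^ 'n::finite" and N :: "'k \<Rightarrow> int"
  assumes inj: "inj_on l K" and dual: "\<And>k. k \<in> K \<Longrightarrow> l k \<in> dual_lattice L B"
    and N: "\<And>k. k \<in> K \<Longrightarrow> 2 * of_int (N k) = B (l k) (l k)" and nn: "\<And>x. B x x \<ge> 0"
    and hs: "\<And>\<tau> Z. Im \<tau> > 0 \<Longrightarrow> ((\<lambda>k. c k * exp (2 * of_real pi * \<i> * (of_int (N k) * \<tau> + cform B (cvec (l k)) Z))) has_sum \<phi> \<tau> Z) K"
  shows "\<exists>f :: int \<Rightarrow> real ^ 'n \<Rightarrow> complex. \<forall>\<tau> Z. Im \<tau> > 0 \<longrightarrow>
        ((\<lambda>(n, l). f n l * exp (2 * of_real pi * \<i> * (of_int n * \<tau> + cform B (cvec l) Z)))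
           has_sum \<phi> \<tau> Z)
          {(n, l). n \<ge> 0 \<and> l \<in> dual_lattice L B \<and> 2 * of_int n - B l l \<ge> 0}"
proof -
  define g where "g = (\<lambda>k. (N k, l k))"
  have ig: "inj_on g K" using inj by (auto simp: g_def inj_on_def)
  define f where "f = (\<lambda>n v. if (n, v) \<in> g ` K then c (inv_into K g (n, v)) else 0)"
  have sub: "g ` K \<subseteq> {(n, l). n \<ge> 0 \<and> l \<in> dual_lattice L B \<and> 2 * of_int n - B l l \<ge> 0}"
  proof clarify
    fix n v k assume "(n, v) = g k" and k: "k \<in> K"
    then have e: "n = N k" "v = l k" by (auto simp: g_def)
    have "2 * real_of_int (N k) \<ge> 0" unfolding N[OF k] by (rule nn)
    then show "0 \<le> n \<and> v \<in> dual_lattice L B \<and> 0 \<le> 2 * of_int n - B v v"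
      using N[OF k] dual[OF k] by (simp add: e)
  qed
  have "((\<lambda>(n, l). f n l * exp (2 * of_real pi * \<i> * (of_int n * \<tau> + cform B (cvec l) Z))) has_sum \<phi> \<tau> Z)
          {(n, l). n \<ge> 0 \<and> l \<in> dual_lattice L B \<and> 2 * of_int n - B l l \<ge> 0}" if "Im \<tau> > 0" for \<tau> Z
  proof -
    let ?F = "\<lambda>(n, l). f n l * exp (2 * of_real pi * \<i> * (of_int n * \<tau> + cform B (cvec l) Z))"
    have "(?F \<circ> g) k = c k * exp (2 * of_real pi * \<i> * (of_int (N k) * \<tau> + cform B (cvec (l k)) Z))" if "k \<in> K" for k
    proof -
      have "inv_into K g (g k) = k" by (rule inv_into_f_f[OF ig that])
      then have "f (N k) (l k) = c k" using that unfolding f_def g_def by auto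
      then show ?thesis by (simp add: g_def)
    qed
    then have "((?F \<circ> g) has_sum \<phi> \<tau> Z) K"
      using hs[OF that, of Z] by (subst has_sum_cong) auto
    then have "(?F has_sum \<phi> \<tau> Z) (g ` K)" by (subst has_sum_reindex[OF ig])
    also have "?this \<longleftrightarrow> (?F has_sum \<phi> \<tau> Z) {(n, l). n \<ge> 0 \<and> l \<in> dual_lattice L B \<and> 2 * of_int n - B l l \<ge> 0}"
      by (rule has_sum_cong_neutral) (use sub in \<open>auto simp: f_def\<close>)
    finally show ?thesis .
  qed
  then show ?thesis by blast
qed

text \<open>
  A theta-product with trivial character that has an expansion supported on \<open>2 n = (l, l)\<close> is a Jacobi form; these are
  exactly the expansions that occur in singular weight.
\<close>

lemma theta_prod_jacobi:
  fixes ls ms :: "('n::finite \<Rightarrow> int) list" and l :: "'k \<Rightarrow> real ^ 'n" and N :: "'k \<Rightarrow> int"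
  assumes r: "int (length ls) + r = 8 * s" "m + int (length ms) = 3 * r"
    and inj: "inj_on l K" and dual: "\<And>k. k \<in> K \<Longrightarrow> l k \<in> dual_lattice even_lattice (prod_form ls ms)"
    and N: "\<And>k. k \<in> K \<Longrightarrow> 2 * of_int (N k) = prod_form ls ms (l k) (l k)"
    and hs: "\<And>\<tau> Z. Im \<tau> > 0 \<Longrightarrow> ((\<lambda>k. c k * e2pi (of_int (N k) * \<tau> + cform (prod_form ls ms) (cvec (l k)) Z)) has_sum theta_prod m ls ms \<tau> Z) K"
  shows "theta_prod m ls ms \<in> jacobi_forms (4 * s + r) even_lattice (prod_form ls ms)"
  unfolding jacobi_forms_def mem_Collect_eq
proof (intro conjI allI ballI impI)
  show "holomorphic_on_upper (theta_prod m ls ms)" by (rule theta_prod_holomorphic)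
next
  fix a b c d :: int and \<tau> :: complex and Z :: "complex ^ 'n"
  assume det: "a * d - b * c = 1" and \<tau>: "Im \<tau> > 0"
  show "theta_prod m ls ms ((of_int a * \<tau> + of_int b) / (of_int c * \<tau> + of_int d)) ((1 / (of_int c * \<tau> + of_int d)) *s Z)
        = (of_int c * \<tau> + of_int d) powi (4 * s + r)
          * exp (of_real pi * \<i> * (of_int c * cform (prod_form ls ms) Z Z / (of_int c * \<tau> + of_int d))) * theta_prod m ls ms \<tau> Z"
  proof (rule modular_law_from_S_T[where q = "\<lambda>Z. cform (prod_form ls ms) Z Z", OF _ _ _ det \<tau>])
    fix u :: complex and Z :: "complex ^ 'n"
    show "cform (prod_form ls ms) (u *s Z) (u *s Z) = u ^ 2 * cform (prod_form ls ms) Z Z"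
      unfolding cform_prod_form lform_scale
      by (simp add: power2_eq_square distrib_left sum_list_const_mult[symmetric] mult_ac)
  qed (rule theta_prod_T theta_prod_S; use r in auto)+
next
  fix x y :: "real ^ 'n" and \<tau> :: complex and Z :: "complex ^ 'n"
  assume "x \<in> even_lattice" "y \<in> even_lattice" and \<tau>: "Im \<tau> > 0"
  then show "theta_prod m ls ms \<tau> (Z + \<tau> *s cvec x + cvec y)
      = exp (- (of_real pi * \<i> * (of_real (prod_form ls ms x x) * \<tau> + 2 * cform (prod_form ls ms) (cvec x) Z))) * theta_prod m ls ms \<tau> Z"
    by (intro theta_prod_elliptic) (auto simp: even_lattice_def)
next
  show "\<exists>f :: int \<Rightarrow> real ^ 'n \<Rightarrow> complex. \<forall>\<tau> Z. Im \<tau> > 0 \<longrightarrow>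
        ((\<lambda>(n, l). f n l * exp (2 * of_real pi * \<i> * (of_int n * \<tau> + cform (prod_form ls ms) (cvec l) Z)))
           has_sum theta_prod m ls ms \<tau> Z)
          {(n, l). n \<ge> 0 \<and> l \<in> dual_lattice even_lattice (prod_form ls ms) \<and> 2 * of_int n - prod_form ls ms l l \<ge> 0}"
    by (rule fourier_clause[OF inj dual N prod_form_nonneg]) (use hs in \<open>auto simp: e2pi_def\<close>)
qed

lemma has_sum_prod_PiE:
  fixes f :: "'a \<Rightarrow> 'b \<Rightarrow> complex"
  assumes "finite A" "\<And>x. x \<in> A \<Longrightarrow> (f x has_sum S x) (B x)"
  shows "((\<lambda>g. \<Prod>x\<in>A. f x (g x)) has_sum (\<Prod>x\<in>A. S x)) (PiE A B)"
  using assms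
proof (induction A rule: finite_induct)
  case empty
  show ?case by (auto intro!: has_sum_finiteI)
next
  case (insert a A)
  have "((\<lambda>(y, g). f a y * (\<Prod>x\<in>A. f x (g x))) has_sum (S a * (\<Prod>x\<in>A. S x))) (B a \<times> PiE A B)"
    by (rule has_sum_times) (use insert in auto)
  also have "?this \<longleftrightarrow> ((\<lambda>g. \<Prod>x\<in>insert a A. f x (g x)) has_sum (\<Prod>x\<in>insert a A. S x)) (PiE (insert a A) B)"
  proof (rule has_sum_reindex_bij_witness[of _ "\<lambda>g. (g a, g(a := undefined))" "\<lambda>(y, g). g(a := y)"])
    fix p assume p: "p \<in> B a \<times> PiE A B"
    obtain y g where [simp]: "p = (y, g)" by (cases p)
    have "g a = undefined" using p insert.hyps by (auto simp: PiE_def extensional_def)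
    then show "(((\<lambda>(y, g). g(a := y)) p) a, ((\<lambda>(y, g). g(a := y)) p)(a := undefined)) = p" by (simp add: fun_upd_idem)
    show "(\<lambda>(y, g). g(a := y)) p \<in> PiE (insert a A) B" using p by (auto simp: PiE_def extensional_def)
    have "(\<Prod>x\<in>A. f x ((g(a := y)) x)) = (\<Prod>x\<in>A. f x (g x))" using insert.hyps by (intro prod.cong) auto
    then show "(\<Prod>x\<in>insert a A. f x ((\<lambda>(y, g). g(a := y)) p x)) = (\<lambda>(y, g). f a y * (\<Prod>x\<in>A. f x (g x))) p"
      using insert.hyps by simp
  next
    fix g assume "g \<in> PiE (insert a A) B"
    then show "(g a, g(a := undefined)) \<in> B a \<times> PiE A B" using insert.hyps by (auto simp: PiE_def extensional_def)
  qed (use insert.hyps in auto)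
  finally show ?case .
qed

lemma e2pi_sum: "finite A \<Longrightarrow> (\<Prod>x\<in>A. e2pi (f x)) = e2pi (\<Sum>x\<in>A. f x)"
  by (induction A rule: finite_induct) (auto simp: e2pi_add)

lemma theta_ii_nonzero:
  assumes "x \<notin> (\<int> :: real set)"
  shows "theta \<i> (of_real x) \<noteq> 0"
proof
  assume "theta \<i> (of_real x) = 0"
  then obtain a b :: int where "complex_of_real x = of_int a * \<i> + of_int b" using theta_eq_0_iff[of \<i>] by auto
  then have "x = of_int b" by (simp add: complex_eq_iff)
  then show False using assms by simp
qed

lemma quarter_half_not_int: "1 / 4 \<notin> (\<int> :: real set)" "1 / 2 \<notin> (\<int> :: real set)"
proof -
  have "4 * k \<noteq> (1::int)" "2 * k \<noteq> (1::int)" for k by presburger+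
  then have "4 * real_of_int k \<noteq> 1" "2 * real_of_int k \<noteq> 1" for k
    by (metis of_int_1 of_int_eq_iff of_int_mult of_int_numeral)+
  then show "1 / 4 \<notin> (\<int> :: real set)" "1 / 2 \<notin> (\<int> :: real set)" by (auto elim!: Ints_cases simp: field_simps)
qed

text \<open>
  The coordinate form \<open>Z \<mapsto> Z\<^sub>i\<close>.
\<close>

definition unit_form :: "'n \<Rightarrow> 'n \<Rightarrow> int" where
  "unit_form i = (\<lambda>j. if j = i then 1 else 0)"

lemma lform_unit [simp]: "lform (unit_form i) Z = Z $ i"
  by (simp add: lform_def unit_form_def if_distrib[of "\<lambda>x. of_int x * _"] cong: if_cong)

lemma rform_unit [simp]: "rform (unit_form i) x = x $ i"
  by (simp add: rform_def unit_form_def if_distrib[of "\<lambda>x. of_int x * _"] cong: if_cong)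

lemma sum_list_distinct: "distinct xs \<Longrightarrow> (\<Sum>x\<leftarrow>xs. f x) = (\<Sum>x\<in>set xs. f x)" for f :: "'a \<Rightarrow> 'b::comm_monoid_add"
  by (simp add: sum_list_distinct_conv_sum_set)

lemma odd_square_mod_24:
  assumes "odd k"
  shows "(3 * k ^ 2 - 3) mod 24 = (0 :: int)"
proof -
  obtain m where m: "k = 2 * m + 1" using assms by (elim oddE)
  have "even (m * (m + 1))" by simp
  then obtain j where j: "m * (m + 1) = 2 * j" by (elim evenE)
  have "3 * k ^ 2 - 3 = 24 * j" using j by (simp add: m power2_eq_square algebra_simps)
  then show ?thesis by simp
qed

lemma coprime_square_mod_24:
  assumes "chi12 k \<noteq> 0"
  shows "(k ^ 2 - 1) mod 24 = (0 :: int)"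
proof -
  have o: "odd k" "k mod 3 \<noteq> 0" using assms chi12_coprime[of k] by auto
  then have "k mod 3 = 1 \<or> k mod 3 = 2" by presburger
  then have "(k - 1) mod 3 = 0 \<or> (k + 1) mod 3 = 0" by presburger
  then have "3 dvd (k - 1) * (k + 1)" by (auto simp: mod_eq_0_iff_dvd)
  moreover have "(k - 1) * (k + 1) = k ^ 2 - 1" by (simp add: power2_eq_square algebra_simps)
  ultimately have "3 dvd k ^ 2 - 1" by simp
  moreover have "24 dvd 3 * (k ^ 2 - 1)" using odd_square_mod_24[OF o(1)] by (simp add: mod_eq_0_iff_dvd algebra_simps)
  ultimately have "24 dvd k ^ 2 - 1" by presburger
  then show ?thesis by (simp add: mod_eq_0_iff_dvd)
qed

section \<open>Construction in every even rank\<close>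

text \<open>
  One function of each coordinate: \<open>\<vartheta>\<close> for the coordinates in \<open>A\<close> and \<open>\<vartheta>\<^bsub>3/2\<^esub>\<close> for the others. The character
  is trivial if \<open>3 a + (n - a) = n + 2 a\<close> is divisible by \<open>24\<close>, where \<open>a\<close> is the size of \<open>A\<close>, and then the weight is
  \<open>12 s - a = n / 2\<close>.
\<close>

lemma diagonal_theta_product:
  fixes A :: "'n::finite set"
  assumes s: "int (CARD('n)) + 2 * int (card A) = 24 * s"
  shows "\<exists>(L :: (real ^ 'n) set) B \<phi>.
           pos_def_even_lattice L B \<and>
           \<phi> \<in> jacobi_forms (12 * s - int (card A)) L B \<and>
           (\<exists>\<tau> Z. Im \<tau> > 0 \<and> \<phi> \<tau> Z \<noteq> 0) \<and>
           theta_product \<phi>"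
proof -
  obtain xs where xs: "set xs = A" "distinct xs" using finite_distinct_list[of A] by auto
  obtain ys where ys: "set ys = - A" "distinct ys" using finite_distinct_list[of "- A"] by auto
  define ls where "ls = map unit_form xs"
  define ms where "ms = map unit_form ys"
  \<comment> \<open>Coordinate \<open>i\<close> contributes \<open>w i (Z\<^sub>i)\<^sup>2\<close> to the form and \<open>v i\<close> twenty-fourths to the character; \<open>v i * w i = 3\<close>.\<close>
  define w :: "'n \<Rightarrow> int" where "w = (\<lambda>i. if i \<in> A then 1 else 3)"
  define v :: "'n \<Rightarrow> int" where "v = (\<lambda>i. if i \<in> A then 3 else 1)"
  define ch where "ch = (\<lambda>i. if i \<in> A then kronecker_m4 else chi12)"
  define r where "r = 8 * s - int (card A)"
  have cA: "int (card (- A)) = int (CARD('n)) - int (card A)"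
    by (simp add: Compl_eq_Diff_UNIV card_Diff_subset of_nat_diff card_mono)
  have card: "int (length ls) = int (card A)" "int (length ms) = int (CARD('n)) - int (card A)"
    using distinct_card[OF xs(2)] distinct_card[OF ys(2)] xs(1) ys(1) cA
    by (simp_all add: ls_def ms_def)
  have r1: "int (length ls) + r = 8 * s" "0 + int (length ms) = 3 * r"
    using s card by (simp_all add: r_def)
  have split: "(\<Sum>i\<in>A. f i) + (\<Sum>i\<in>-A. g i) = (\<Sum>i\<in>UNIV. if i \<in> A then f i else g i)" for f g :: "'n \<Rightarrow> 'b::comm_monoid_add"
    by (subst sum.If_cases) auto
  have psplit: "(\<Prod>i\<in>A. f i) * (\<Prod>i\<in>-A. g i) = (\<Prod>i\<in>UNIV. if i \<in> A then f i else g i)" for f g :: "'n \<Rightarrow> complex"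
    by (subst prod.If_cases) auto
  have B: "prod_form ls ms x y = (\<Sum>i\<in>UNIV. of_int (w i) * (x $ i * y $ i))" for x y
  proof -
    have "prod_form ls ms x y = (\<Sum>i\<in>A. x $ i * y $ i) + (\<Sum>i\<in>-A. 3 * (x $ i * y $ i))"
      using xs ys by (simp add: prod_form_def ls_def ms_def o_def sum_list_distinct sum_distrib_left)
    then show ?thesis unfolding split by (simp only:) (intro sum.cong refl, simp add: w_def)
  qed
  have C: "cform (prod_form ls ms) Z W = (\<Sum>i\<in>UNIV. of_int (w i) * (Z $ i * W $ i))" for Z W
  proof -
    have "cform (prod_form ls ms) Z W = (\<Sum>i\<in>A. Z $ i * W $ i) + (\<Sum>i\<in>-A. 3 * (Z $ i * W $ i))"
      using xs ys by (simp add: cform_prod_form ls_def ms_def o_def sum_list_distinct sum_distrib_left)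
    then show ?thesis unfolding split by (simp only:) (intro sum.cong refl, simp add: w_def)
  qed
  have \<phi>: "theta_prod 0 ls ms \<tau> Z = (\<Prod>i\<in>UNIV. gsum (ch i) (8 * of_int (w i)) \<tau> (Z $ i))" if "Im \<tau> > 0" for \<tau> Z
  proof -
    have "theta_prod 0 ls ms \<tau> Z = (\<Prod>i\<in>A. theta \<tau> (Z $ i)) * (\<Prod>i\<in>-A. Qsum \<tau> (Z $ i))"
      by (simp add: theta_prod_Qsum[OF that] ls_def ms_def o_def
          flip: prod.distinct_set_conv_list[OF xs(2), unfolded xs(1)] prod.distinct_set_conv_list[OF ys(2), unfolded ys(1)])
    also have "\<dots> = (\<Prod>i\<in>UNIV. gsum (ch i) (8 * of_int (w i)) \<tau> (Z $ i))"
      unfolding psplit by (intro prod.cong refl) (simp add: theta_gsum w_def ch_def)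
    finally show ?thesis .
  qed
  define K where "K = {k :: 'n \<Rightarrow> int. \<forall>i. ch i (k i) \<noteq> 0}"
  define N where "N = (\<lambda>k :: 'n \<Rightarrow> int. (\<Sum>i\<in>UNIV. v i * k i ^ 2) div 24)"
  define l where "l = (\<lambda>k :: 'n \<Rightarrow> int. (\<chi> i. of_int (k i) / (2 * of_int (w i))) :: real ^ 'n)"
  have w0: "w i \<noteq> 0" "real_of_int (w i) \<noteq> 0" "complex_of_int (w i) \<noteq> 0" for i by (auto simp: w_def)
  \<comment> \<open>The exponent of \<open>q\<close> is an integer on the support: \<open>k\<^sup>2 \<equiv> 1\<close> modulo \<open>8\<close> for odd \<open>k\<close>, and modulo \<open>24\<close> for
    \<open>k\<close> prime to \<open>6\<close>.\<close>
  have N24: "24 * N k = (\<Sum>i\<in>UNIV. v i * k i ^ 2)" if k: "k \<in> K" for k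
  proof -
    have "24 dvd v i * k i ^ 2 - v i" for i
    proof (cases "i \<in> A")
      case True
      have "ch i (k i) \<noteq> 0" using k by (simp add: K_def)
      then have "odd (k i)" using True kronecker_m4_even[of "k i"] by (auto simp: ch_def)
      then show ?thesis using odd_square_mod_24[of "k i"] True by (simp add: v_def mod_eq_0_iff_dvd)
    next
      case False
      have "ch i (k i) \<noteq> 0" using k by (simp add: K_def)
      then have "chi12 (k i) \<noteq> 0" using False by (simp add: ch_def)
      then show ?thesis using coprime_square_mod_24[of "k i"] False by (simp add: v_def mod_eq_0_iff_dvd)
    qed
    then have "24 dvd (\<Sum>i\<in>UNIV. v i * k i ^ 2 - v i)" by (intro dvd_sum) auto
    moreover have "(\<Sum>i\<in>UNIV. v i) = 24 * s"
    proof -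
      have "(\<Sum>i\<in>UNIV. v i) = (\<Sum>i\<in>A. 3) + (\<Sum>i\<in>-A. 1)" unfolding v_def split ..
      also have "\<dots> = 3 * int (card A) + (int (CARD('n)) - int (card A))"
        using cA by simp
      finally show ?thesis using s by simp
    qed
    ultimately have "24 dvd (\<Sum>i\<in>UNIV. v i * k i ^ 2) - 24 * s" by (simp add: sum_subtractf)
    then have "24 dvd (\<Sum>i\<in>UNIV. v i * k i ^ 2)" by presburger
    then show ?thesis unfolding N_def by simp
  qed
  have inj: "inj_on l K"
    by (rule inj_onI) (auto simp: l_def vec_eq_iff w0 fun_eq_iff)
  have Bl: "prod_form ls ms (l k) y = (\<Sum>i\<in>UNIV. of_int (k i) * (y $ i / 2))" for k y
    unfolding B l_def by (intro sum.cong refl) (use w0 in \<open>simp add: field_simps\<close>)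
  have Cl: "cform (prod_form ls ms) (cvec (l k)) Z = (\<Sum>i\<in>UNIV. of_int (k i) / 2 * Z $ i)" for k Z
    unfolding C l_def cvec_def by (intro sum.cong refl) (use w0 in \<open>simp add: field_simps\<close>)
  have dual: "l k \<in> dual_lattice even_lattice (prod_form ls ms)" for k
    unfolding dual_lattice_def mem_Collect_eq Bl
  proof (intro ballI Ints_sum Ints_mult)
    fix x :: "real ^ 'n" and i assume "x \<in> even_lattice"
    then obtain j :: int where "x $ i = 2 * of_int j" by (auto simp: even_lattice_def)
    then show "x $ i / 2 \<in> \<int>" by simp
  qed auto
  have NB: "2 * of_int (N k) = prod_form ls ms (l k) (l k)" if "k \<in> K" for k
  proof -
    have "24 * real_of_int (N k) = (\<Sum>i\<in>UNIV. of_int (v i * k i ^ 2))"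
      using arg_cong[OF N24[OF that], of real_of_int] by simp
    moreover have "12 * prod_form ls ms (l k) (l k) = (\<Sum>i\<in>UNIV. of_int (v i * k i ^ 2))"
      unfolding Bl sum_distrib_left
      by (intro sum.cong refl) (simp add: l_def v_def w_def power2_eq_square)
    ultimately show ?thesis by simp
  qed
  have hs: "((\<lambda>k. (\<Prod>i\<in>UNIV. ch i (k i)) * e2pi (of_int (N k) * \<tau> + cform (prod_form ls ms) (cvec (l k)) Z)) has_sum theta_prod 0 ls ms \<tau> Z) K"
    if \<tau>: "Im \<tau> > 0" for \<tau> Z
  proof -
    have "((\<lambda>k. \<Prod>i\<in>UNIV. gterm (ch i) (8 * of_int (w i)) (k i) \<tau> (Z $ i)) has_sum theta_prod 0 ls ms \<tau> Z) (PiE UNIV (\<lambda>_. UNIV))"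
      unfolding \<phi>[OF \<tau>]
      by (intro has_sum_prod_PiE gsum_has_sum \<tau>) (auto simp: ch_def w_def kronecker_m4_le chi12_le)
    also have "PiE UNIV (\<lambda>_ :: 'n. UNIV :: int set) = UNIV" by simp
    also have "((\<lambda>k. \<Prod>i\<in>UNIV. gterm (ch i) (8 * of_int (w i)) (k i) \<tau> (Z $ i)) has_sum theta_prod 0 ls ms \<tau> Z) UNIV \<longleftrightarrow> ?thesis"
    proof (rule has_sum_cong_neutral)
      fix k assume "k \<in> UNIV - K"
      then obtain i where "ch i (k i) = 0" by (auto simp: K_def)
      then have "gterm (ch i) (8 * of_int (w i)) (k i) \<tau> (Z $ i) = 0" by (simp add: gterm_def)
      then show "(\<Prod>i\<in>UNIV. gterm (ch i) (8 * of_int (w i)) (k i) \<tau> (Z $ i)) = 0" by (intro prod_zero) auto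
    next
      fix k assume "k \<in> UNIV \<inter> K"
      then have k: "k \<in> K" by simp
      have "24 * complex_of_int (N k) = (\<Sum>i\<in>UNIV. of_int (v i * k i ^ 2))"
        using arg_cong[OF N24[OF k], of complex_of_int] by simp
      also have "\<dots> = 24 * (\<Sum>i\<in>UNIV. of_int (k i) ^ 2 / of_real (8 * of_int (w i)))"
        unfolding sum_distrib_left by (intro sum.cong refl) (simp add: v_def w_def)
      finally have Nk: "of_int (N k) = (\<Sum>i\<in>UNIV. of_int (k i) ^ 2 / complex_of_real (8 * of_int (w i)))" by simp
      show "(\<Prod>i\<in>UNIV. gterm (ch i) (8 * of_int (w i)) (k i) \<tau> (Z $ i))
        = (\<Prod>i\<in>UNIV. ch i (k i)) * e2pi (of_int (N k) * \<tau> + cform (prod_form ls ms) (cvec (l k)) Z)"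
        unfolding gterm_def prod.distrib Nk Cl by (simp add: e2pi_sum sum.distrib sum_distrib_right)
    qed auto
    finally show ?thesis .
  qed
  have J: "theta_prod 0 ls ms \<in> jacobi_forms (4 * s + r) even_lattice (prod_form ls ms)"
    by (rule theta_prod_jacobi[OF r1 inj dual NB hs])
  have P: "pos_def_even_lattice even_lattice (prod_form ls ms)"
  proof (rule pos_def_even_lattice_prod_form)
    fix x :: "real ^ 'n" assume 0: "\<And>a. a \<in> set ls \<union> set ms \<Longrightarrow> rform a x = 0"
    have "x $ i = 0" for i
    proof -
      have "unit_form i \<in> set ls \<union> set ms" using xs ys by (auto simp: ls_def ms_def)
      from 0[OF this] show ?thesis by simp
    qed
    then show "x = 0" by (simp add: vec_eq_iff)
  qed
  have nz: "theta_prod 0 ls ms \<i> (\<chi> i. of_real (1/4)) \<noteq> 0"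
  proof (rule theta_prod_nonzero)
    have "2 * complex_of_real (1/4) = of_real (1/2)" by simp
    then show "theta \<i> (2 * lform a (\<chi> i. of_real (1/4))) \<noteq> 0" if "a \<in> set ms" for a
      using that theta_ii_nonzero[OF quarter_half_not_int(2)] by (auto simp: ms_def simp del: of_real_divide)
    show "theta \<i> (lform a (\<chi> i. of_real (1/4))) \<noteq> 0" if "a \<in> set ls" for a
      using that theta_ii_nonzero[OF quarter_half_not_int(1)] by (auto simp: ls_def simp del: of_real_divide)
  qed simp
  have "4 * s + r = 12 * s - int (card A)" by (simp add: r_def)
  then show ?thesis using J P nz theta_product_theta_prod[of 0 ls ms]
    by (intro exI[of _ even_lattice] exI[of _ "prod_form ls ms"] exI[of _ "theta_prod 0 ls ms"] conjI)
      (auto intro!: exI[of _ \<i>])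
qed

lemma lform_plus: "lform (\<lambda>i. a i + b i) Z = lform a Z + lform b Z"
  by (simp add: lform_def sum.distrib algebra_simps)

lemma rform_plus: "rform (\<lambda>i. a i + b i) x = rform a x + rform b x"
  by (simp add: rform_def sum.distrib algebra_simps)

text \<open>
  Rank six: the product over three pairs of coordinates of \<open>\<vartheta>(z) \<vartheta>(w) \<vartheta>(z + w) / \<eta>\<close>. A diagonal product is impossible
  here, since \<open>6 + 2 a\<close> is not divisible by \<open>24\<close> for \<open>a \<le> 6\<close>.
\<close>

lemma a2_cubed_theta_product:
  assumes card6: "CARD('n::finite) = 6"
  shows "\<exists>(L :: (real ^ 'n) set) B \<phi>.
           pos_def_even_lattice L B \<and>
           \<phi> \<in> jacobi_forms 3 L B \<and>
           (\<exists>\<tau> Z. Im \<tau> > 0 \<and> \<phi> \<tau> Z \<noteq> 0) \<and>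
           theta_product \<phi>"
proof -
  obtain h :: "nat \<Rightarrow> 'n" where h: "bij_betw h {..<6} UNIV"
    using ex_bij_betw_nat_finite[of "UNIV :: 'n set"] card6 by (auto simp: atLeast0LessThan)
  define J where "J = {0, 1, 2 :: nat}"
  define p where "p = (\<lambda>j. h (2 * j))"
  define q where "q = (\<lambda>j. h (2 * j + 1))"
  define idx where "idx = inv_into {..<6} h"
  have idx: "idx (h t) = t" if "t < 6" for t
    unfolding idx_def using h that by (simp add: bij_betw_inv_into_left)
  have finJ: "finite J" by (simp add: J_def)
  have idxp: "idx (p j) = 2 * j" "idx (q j) = 2 * j + 1" if "j \<in> J" for j
    using that unfolding p_def q_def by (auto intro!: idx simp: J_def)
  have all: "P i" if "\<And>j. j \<in> J \<Longrightarrow> P (p j) \<and> P (q j)" for P :: "'n \<Rightarrow> bool" and i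
  proof -
    obtain t where t: "t < 6" "i = h t" using h by (auto simp: bij_betw_def)
    have "t = 2 * (t div 2) \<or> t = 2 * (t div 2) + 1" by presburger
    moreover have "t div 2 \<in> J" using t(1) unfolding J_def by (simp; presburger)
    ultimately show ?thesis using that[of "t div 2"] t(2) unfolding p_def q_def by metis
  qed
  define blk where "blk = (\<lambda>j. [unit_form (p j), unit_form (q j), (\<lambda>i. unit_form (p j) i + unit_form (q j) i)])"
  define ls where "ls = blk 0 @ blk 1 @ blk 2"
  note defs = ls_def blk_def J_def lform_plus rform_plus
  have B: "prod_form ls [] x y = (\<Sum>j\<in>J. x $ p j * y $ p j + x $ q j * y $ q j + (x $ p j + x $ q j) * (y $ p j + y $ q j))" for x y
    by (simp add: prod_form_def defs)
  have C: "cform (prod_form ls []) Z W = (\<Sum>j\<in>J. Z $ p j * W $ p j + Z $ q j * W $ q j + (Z $ p j + Z $ q j) * (W $ p j + W $ q j))" for Z W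
    by (simp add: cform_prod_form defs)
  have \<phi>: "theta_prod (- 3) ls [] \<tau> Z = (\<Prod>j\<in>J. theta \<tau> (Z $ p j) * theta \<tau> (Z $ q j) * theta \<tau> (Z $ p j + Z $ q j) / eta \<tau>)" for \<tau> Z
    by (simp add: theta_prod_def defs power_int_minus field_simps power3_eq_cube)
  define a where "a = (\<lambda>(k :: nat \<Rightarrow> int \<times> int) j. fst (k j))"
  define b where "b = (\<lambda>(k :: nat \<Rightarrow> int \<times> int) j. snd (k j))"
  define U where "U = PiE J (\<lambda>_. UNIV :: (int \<times> int) set)"
  define K where "K = {k \<in> U. \<forall>j\<in>J. chi3 (a k j + b k j) \<noteq> 0}"
  define N where "N = (\<lambda>k. (\<Sum>j\<in>J. a k j ^ 2 - a k j * b k j + b k j ^ 2) div 3)"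
  \<comment> \<open>The vector dual to \<open>Z \<mapsto> \<Sum>j. a\<^sub>j Z\<^bsub>p j\<^esub> + b\<^sub>j Z\<^bsub>q j\<^esub>\<close>: on each pair the form has Gram matrix with rows
    \<open>(2, 1)\<close> and \<open>(1, 2)\<close>.\<close>
  define l where "l = (\<lambda>k. (\<chi> i. if even (idx i) then (2 * of_int (a k (idx i div 2)) - of_int (b k (idx i div 2))) / 3
      else (2 * of_int (b k (idx i div 2)) - of_int (a k (idx i div 2))) / 3) :: real ^ 'n)"
  have lp: "l k $ p j = (2 * of_int (a k j) - of_int (b k j)) / 3" "l k $ q j = (2 * of_int (b k j) - of_int (a k j)) / 3" if "j \<in> J" for k j
    unfolding l_def using idxp[OF that] by simp_all
  have Bl: "prod_form ls [] (l k) y = (\<Sum>j\<in>J. of_int (a k j) * y $ p j + of_int (b k j) * y $ q j)" for k y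
    unfolding B by (intro sum.cong refl) (simp add: lp field_simps)
  have Cl: "cform (prod_form ls []) (cvec (l k)) Z = (\<Sum>j\<in>J. of_int (a k j) * Z $ p j + of_int (b k j) * Z $ q j)" for k Z
    unfolding C by (intro sum.cong refl) (simp add: lp cvec_def field_simps)
  \<comment> \<open>On the support \<open>a + b\<close> is prime to \<open>3\<close>, so each of the three summands is \<open>\<equiv> (a + b)\<^sup>2 \<equiv> 1\<close> modulo \<open>3\<close>.\<close>
  have N3: "3 * N k = (\<Sum>j\<in>J. a k j ^ 2 - a k j * b k j + b k j ^ 2)" if k: "k \<in> K" for k
  proof -
    have "3 dvd a k j ^ 2 - a k j * b k j + b k j ^ 2 - 1" if "j \<in> J" for j
    proof -
      let ?s = "a k j + b k j"
      have "?s mod 3 \<noteq> 0" using k that by (auto simp: K_def chi3_def)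
      then have "(?s - 1) mod 3 = 0 \<or> (?s + 1) mod 3 = 0" by presburger
      then have "3 dvd (?s - 1) * (?s + 1)" by (auto simp: mod_eq_0_iff_dvd)
      then have "3 dvd (?s - 1) * (?s + 1) - 3 * (a k j * b k j)" by (intro dvd_diff) auto
      moreover have "a k j ^ 2 - a k j * b k j + b k j ^ 2 - 1 = (?s - 1) * (?s + 1) - 3 * (a k j * b k j)"
        by (simp add: power2_eq_square algebra_simps)
      ultimately show ?thesis by (simp only:)
    qed
    then have "3 dvd (\<Sum>j\<in>J. a k j ^ 2 - a k j * b k j + b k j ^ 2 - 1)" by (intro dvd_sum) auto
    then have "3 dvd (\<Sum>j\<in>J. a k j ^ 2 - a k j * b k j + b k j ^ 2) - 3" by (simp add: sum_subtractf J_def)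
    then have "3 dvd (\<Sum>j\<in>J. a k j ^ 2 - a k j * b k j + b k j ^ 2)" by presburger
    then show ?thesis unfolding N_def by simp
  qed
  have inj: "inj_on l K"
  proof (rule inj_onI)
    fix k k' assume k: "k \<in> K" "k' \<in> K" and e: "l k = l k'"
    have "k j = k' j" if j: "j \<in> J" for j
    proof -
      have "l k $ p j = l k' $ p j" "l k $ q j = l k' $ q j" using e by simp_all
      then have "2 * real_of_int (a k j) - of_int (b k j) = 2 * of_int (a k' j) - of_int (b k' j)"
        "2 * real_of_int (b k j) - of_int (a k j) = 2 * of_int (b k' j) - of_int (a k' j)"
        unfolding lp[OF j] by simp_all
      then have "real_of_int (a k j) = of_int (a k' j)" "real_of_int (b k j) = of_int (b k' j)" by linarith+
      then show ?thesis by (simp add: a_def b_def prod_eq_iff)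
    qed
    then show "k = k'" using k unfolding K_def U_def by (intro PiE_ext[of k J "\<lambda>_. UNIV" k']) auto
  qed
  have dual: "l k \<in> dual_lattice even_lattice (prod_form ls [])" for k
    unfolding dual_lattice_def mem_Collect_eq Bl
  proof (intro ballI Ints_sum Ints_add Ints_mult)
    fix x :: "real ^ 'n" and j assume x: "x \<in> even_lattice"
    have "x $ i \<in> \<int>" for i
    proof -
      obtain m :: int where "x $ i = 2 * of_int m" using x by (auto simp: even_lattice_def)
      then show ?thesis by simp
    qed
    then show "x $ p j \<in> \<int>" "x $ q j \<in> \<int>" by blast+
  qed auto
  have NB: "2 * of_int (N k) = prod_form ls [] (l k) (l k)" if "k \<in> K" for k
  proof -
    have "3 * real_of_int (N k) = (\<Sum>j\<in>J. of_int (a k j ^ 2 - a k j * b k j + b k j ^ 2))"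
      using arg_cong[OF N3[OF that], of real_of_int] by simp
    moreover have "3 * prod_form ls [] (l k) (l k) = 2 * (\<Sum>j\<in>J. of_int (a k j ^ 2 - a k j * b k j + b k j ^ 2))"
      unfolding Bl sum_distrib_left
      by (intro sum.cong refl) (simp add: lp power2_eq_square field_simps)
    ultimately show ?thesis by simp
  qed
  have hs: "((\<lambda>k. (\<Prod>j\<in>J. - chi3 (a k j + b k j)) * e2pi (of_int (N k) * \<tau> + cform (prod_form ls []) (cvec (l k)) Z)) has_sum theta_prod (- 3) ls [] \<tau> Z) K"
    if \<tau>: "Im \<tau> > 0" for \<tau> Z
  proof -
    define T where "T = (\<lambda>j (x, y). - chi3 (x + y) * e2pi (of_int (x ^ 2 - x * y + y ^ 2) / 3 * \<tau> + of_int x * Z $ p j + of_int y * Z $ q j))"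
    have "((\<lambda>k. \<Prod>j\<in>J. T j (k j)) has_sum theta_prod (- 3) ls [] \<tau> Z) U"
      unfolding \<phi> U_def T_def
      by (intro has_sum_prod_PiE finJ) (use a2_product[OF \<tau>] in simp)
    also have "?this \<longleftrightarrow> ?thesis"
    proof (rule has_sum_cong_neutral)
      fix k assume "k \<in> U - K"
      then obtain j where j: "j \<in> J" "chi3 (a k j + b k j) = 0" by (auto simp: K_def)
      then have "T j (k j) = 0" by (simp add: T_def a_def b_def case_prod_unfold)
      then show "(\<Prod>j\<in>J. T j (k j)) = 0" using finJ j(1) by (intro prod_zero) auto
    next
      fix k assume "k \<in> U \<inter> K"
      then have k: "k \<in> K" by simp
      have "3 * complex_of_int (N k) = (\<Sum>j\<in>J. of_int (a k j ^ 2 - a k j * b k j + b k j ^ 2))"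
        using arg_cong[OF N3[OF k], of complex_of_int] by simp
      then have Nk: "of_int (N k) = (\<Sum>j\<in>J. complex_of_int (a k j ^ 2 - a k j * b k j + b k j ^ 2) / 3)"
        unfolding sum_divide_distrib[symmetric] by (simp add: mult.commute)
      have "(\<Prod>j\<in>J. T j (k j)) = (\<Prod>j\<in>J. - chi3 (a k j + b k j) * e2pi (of_int (a k j ^ 2 - a k j * b k j + b k j ^ 2) / 3 * \<tau>
            + (of_int (a k j) * Z $ p j + of_int (b k j) * Z $ q j)))"
        by (intro prod.cong refl) (simp add: T_def a_def b_def case_prod_unfold add_ac)
      also have "\<dots> = (\<Prod>j\<in>J. - chi3 (a k j + b k j)) * e2pi (of_int (N k) * \<tau> + cform (prod_form ls []) (cvec (l k)) Z)"
        unfolding prod.distrib e2pi_sum[OF finJ] Nk Cl sum_distrib_right sum.distrib ..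
      finally show "(\<Prod>j\<in>J. T j (k j)) = (\<Prod>j\<in>J. - chi3 (a k j + b k j)) * e2pi (of_int (N k) * \<tau> + cform (prod_form ls []) (cvec (l k)) Z)" .
    qed (auto simp: K_def)
    finally show ?thesis .
  qed
  have "theta_prod (- 3) ls [] \<in> jacobi_forms (4 * 1 + (- 1)) even_lattice (prod_form ls [])"
    by (rule theta_prod_jacobi[OF _ _ inj dual NB hs]) (simp_all add: defs)
  then have Jac: "theta_prod (- 3) ls [] \<in> jacobi_forms 3 even_lattice (prod_form ls [])" by simp
  have P: "pos_def_even_lattice even_lattice (prod_form ls [])"
  proof (rule pos_def_even_lattice_prod_form)
    fix x :: "real ^ 'n" assume 0: "\<And>a. a \<in> set ls \<union> set [] \<Longrightarrow> rform a x = 0"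
    have "x $ i = 0" for i
    proof (rule all[of "\<lambda>i. x $ i = 0"])
      fix j assume j: "j \<in> J"
      have "unit_form (p j) \<in> set ls \<union> set []" "unit_form (q j) \<in> set ls \<union> set []"
        using j by (auto simp: ls_def blk_def J_def)
      from this[THEN 0] show "x $ p j = 0 \<and> x $ q j = 0" by simp
    qed
    then show "x = 0" by (simp add: vec_eq_iff)
  qed
  have nz: "theta_prod (- 3) ls [] \<i> (\<chi> i. of_real (1/4)) \<noteq> 0"
  proof (rule theta_prod_nonzero)
    have h: "complex_of_real (1/4) + of_real (1/4) = of_real (1/2)" unfolding of_real_add[symmetric] by simp
    show "theta \<i> (lform a (\<chi> i. of_real (1/4))) \<noteq> 0" if "a \<in> set ls" for a
      using that theta_ii_nonzero[OF quarter_half_not_int(1)] theta_ii_nonzero[OF quarter_half_not_int(2)]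
      by (auto simp: ls_def blk_def lform_plus h simp del: of_real_divide)
  qed auto
  show ?thesis using Jac P nz theta_product_theta_prod[of "- 3" ls "[]"]
    by (intro exI[of _ even_lattice] exI[of _ "prod_form ls []"] exI[of _ "theta_prod (- 3) ls []"] conjI)
      (auto intro!: exI[of _ \<i>])
qed

theorem proposition3p6:
  fixes n :: nat
  assumes "even n" and "n \<ge> 6" and "CARD('n::finite) = n"
  shows "\<exists>(L :: (real ^ 'n) set) B \<phi>.
           pos_def_even_lattice L B \<and>
           \<phi> \<in> jacobi_forms (int (n div 2)) L B \<and>
           (\<exists>\<tau> Z. Im \<tau> > 0 \<and> \<phi> \<tau> Z \<noteq> 0) \<and>
           theta_product \<phi>"
proof (cases "n = 6")
  case True
  then show ?thesis using a2_cubed_theta_product assms(3) by simp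
next
  case False
  define k where "k = n div 2"
  have n: "n = 2 * k" and k4: "k \<ge> 4" using assms False unfolding k_def by presburger+
  \<comment> \<open>The least \<open>a\<close> with \<open>n + 2 a\<close> divisible by \<open>24\<close>; it is at most \<open>n\<close> because \<open>n \<ge> 8\<close>.\<close>
  define a where "a = (12 - k mod 12) mod 12"
  have an: "a \<le> n"
  proof (cases "k \<ge> 12")
    case True
    have "a < 12" unfolding a_def by simp
    then show ?thesis using True n by simp
  next
    case False
    then show ?thesis using k4 n unfolding a_def by simp
  qed
  have "(k + a) mod 12 = (k mod 12 + (12 - k mod 12)) mod 12"
    unfolding a_def by (simp only: mod_add_left_eq mod_add_right_eq)
  also have "k mod 12 + (12 - k mod 12) = 12" by simp
  finally have "(k + a) mod 12 = 0" by simp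
  then obtain s where s: "k + a = 12 * s" by auto
  obtain A :: "'n set" where A: "card A = a"
    using obtain_subset_with_card_n[of a "UNIV :: 'n set"] an assms(3) by auto
  have "int (CARD('n)) + 2 * int (card A) = 24 * int s" unfolding A assms(3) n using s by simp
  from diagonal_theta_product[OF this]
  have "\<exists>(L :: (real ^ 'n) set) B \<phi>. pos_def_even_lattice L B \<and> \<phi> \<in> jacobi_forms (12 * int s - int (card A)) L B \<and>
           (\<exists>\<tau> Z. Im \<tau> > 0 \<and> \<phi> \<tau> Z \<noteq> 0) \<and> theta_product \<phi>" .
  moreover have "12 * int s - int (card A) = int (n div 2)" using s unfolding A k_def[symmetric] by simp
  ultimately show ?thesis by simp
qed

end
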